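(* Let $d\in\mathbb{N}$ with $d>4$, let $p\in\{2,3,\dots,\lfloor d/2\rfloor\}$ and let $\epsilon\in\{+,-\}$. Then the set $\mathbf{S}(\mathcal{F}_d;\Phi_{d,p,\epsilon})$ is non-empty. It consists of tilings of the plane by tiles that are congruent to members of $\mathcal{F}_d$.
   Context: **Segments.** Identify $\mathbb{R}^2$ with $\mathbb{C}$. Let $z(\varphi)=2e^{i\varphi}+e^{-2i\varphi}$ (a parametrization of the deltoid), and let $G(\varphi)$ be the closed segment with endpoints $z(\varphi)$ and $z(\varphi+\pi)$; it depends only on $\varphi$ mod $\pi$. For integers $d,\nu$ and $\kappa\in\{-2,0,2\}$ put $G^{(\kappa)}_{\nu,d}=G\big(\tfrac{(3\nu-\kappa)\pi}{3d}\big)$; the index $\nu$ is taken mod $d$. Let $K_d=\{0\}$ if $3\nmid d$ and $K_d=\{-2,0,2\}$ if $3\mid d$. For $\kappa\in K_d$ the family of segments $\{G^{(\kappa)}_{\nu,d}\}_{\nu \bmod d}$ is called family $\kappa$. Put $s_\nu=\sin(\nu\pi/d)$ and $\iota_{d,p}=s_p/s_1$. **Elementary triangles.** $\Delta_d^{(\kappa)}(\lambda,\mu,\nu)$ denotes the triangle formed by $G^{(\kappa)}_{\lambda,d},G^{(\kappa)}_{\mu,d},G^{(\kappa)}_{\nu,d}$ ($\lambda,\mu,\nu$ distinct mod $d$, segments not concurrent). It is elementary if $\lambda+\mu+\nu\equiv\kappa\pm1 \pmod d$; equivalently, if it is formed by $G(\varphi_1),G(\varphi_2),G(\varphi_3)$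 with $\varphi_1+\varphi_2+\varphi_3\equiv\pm\pi/d \pmod \pi$. The sign $\pm$ is called the sign of the triangle. **Decorated prototiles $\mathcal{F}_d$.** An elementary triangle $t$ of sign $\pm$ formed by $G(\varphi_1),G(\varphi_2),G(\varphi_3)$ is decorated by the triangle $t'$ formed by $G(\varphi_i\mp\frac{\pi}{2d})$, $i=1,2,3$, which is inscribed in $t$ (one vertex of $t'$ on each edge of $t$, cutting that edge into two sections). The decorated triangle $T=t\cup t'$ is a prototile, and $t'$ is its interior decoration. $\mathcal{F}_d$ is the set of all decorated elementary triangles arising from the families $\kappa\in K_d$. For $T\in\mathcal{F}_d$, $\widetilde T$ denotes the mirror image of $T$ including its decoration; if $T$ is not isosceles, $\hat T$ denotes the prototile whose underlying triangle is the mirror image of that of $T$, but whose edges carry the same subdivisions into sections as those of $T$ (each edge read anticlockwise). **Tilings.** A tiling of the plane is a decomposition into countably many tiles with pairwise disjoint interiors whose union is the plane; a patch is a collection of tiles any two of which intersect only in their boundaries. Tiles are isometric copies (reflections allowed, decoration included) of prototiles. **Inflation rules.** Let $T\in\mathcal{F}_d$ be formed by $G(\varphi_1),G(\varphi_2),G(\varphi_3)$. Choose $\theta$ with $3\theta\equiv (p+1)\pi/d \pmod\pi$ if $T$ has sign $-$, and $3\theta\equiv-(p+1)\pi/d\pmod\pi$ if $T$ has sign $+$, such that all three segments $G(\varphi_i+\theta)$ belong to one family $\kappa'\in K_d$. The triangle formed by the $G(\varphi_i+\theta)$ is directly congruent to $\iota_{d,p}\cdot T$ (sides corresponding by index), and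 the segments of family $\kappa'$ cut it into elementary triangles of family $\kappa'$, each carrying its decoration. The resulting patch, transported to $\iota_{d,p}\cdot T$, is $\Phi_{d,p,+}(T)$. Thus $\Phi_{d,p,+}(\widetilde T)$ is the mirror image of $\Phi_{d,p,+}(T)$. The rule $\Phi_{d,p,-}$ is defined by $\Phi_{d,p,-}(T)=\Phi_{d,p,+}(\widetilde{\hat T})$ if $T$ is not isosceles (so $\Phi_{d,p,-}(\widetilde T)=\Phi_{d,p,+}(\hat T)$, $\Phi_{d,p,-}(\hat T)=\Phi_{d,p,+}(\widetilde T)$, $\Phi_{d,p,-}(\widetilde{\hat T})=\Phi_{d,p,+}(T)$), and by $\Phi_{d,p,-}(T)=\Phi_{d,p,+}(\widetilde T)$, $\Phi_{d,p,-}(\widetilde T)=\Phi_{d,p,+}(T)$ if $T$ is isosceles. The rules extend to patches by inflating by $\iota_{d,p}$ and replacing each inflated tile by the corresponding isometric copy of its patch; $\Phi^n_{d,p,\epsilon}$ is the $n$-fold iterate. **The set of tilings.** $\mathbf{S}(\mathcal{F}_d;\Phi_{d,p,\epsilon})$ is the set of all tilings $\mathcal{P}$ of the entire plane such that every (finite) patch of $\mathcal{P}$ is congruent to some patch in some $\Phi^n_{d,p,\epsilon}(T)$, $T\in\mathcal{F}_d$, $n\in\mathbb{N}$. *)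

theory Defs
  imports "HOL-Analysis.Analysis" "HOL-Number_Theory.Cong" "HOL-Library.Real_Mod"
begin

subsection \<open>Segments\<close>

definition deltoid :: "real \<Rightarrow> complex" where
  "deltoid \<phi> = 2 * cis \<phi> + cis (- 2 * \<phi>)"

definition seg :: "real \<Rightarrow> complex set" where
  "seg \<phi> = closed_segment (deltoid \<phi>) (deltoid (\<phi> + pi))"

definition fam_angle :: "nat \<Rightarrow> int \<Rightarrow> int \<Rightarrow> real" where
  "fam_angle d \<kappa> \<nu> = of_int (3 * \<nu> - \<kappa>) * pi / (3 * of_nat d)"

definition fam_index :: "nat \<Rightarrow> int set" where
  "fam_index d = (if 3 dvd d then {-2, 0, 2} else {0})"

definition family :: "nat \<Rightarrow> int \<Rightarrow> complex set set" where
  "family d \<kappa> = range (\<lambda>\<nu>. seg (fam_angle d \<kappa> \<nu>))"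

definition iota :: "nat \<Rightarrow> nat \<Rightarrow> real" where
  "iota d p = sin (of_nat p * pi / of_nat d) / sin (pi / of_nat d)"


subsection \<open>Elementary triangles\<close>

datatype sign = Plus | Minus

primrec sign_val :: "sign \<Rightarrow> int" where
  "sign_val Plus = 1"
| "sign_val Minus = - 1"

text \<open>
  Two segments \<^term>\<open>seg \<phi>\<close>, \<^term>\<open>seg \<psi>\<close> that are distinct meet in exactly one point (the angles
  differ modulo \<^term>\<open>pi\<close>), so three pairwise distinct, non-concurrent segments form the triangle
  spanned by their pairwise intersections.
\<close>

definition formed_triangle :: "real \<Rightarrow> real \<Rightarrow> real \<Rightarrow> complex set" where
  "formed_triangle \<phi>1 \<phi>2 \<phi>3 =
     convex hull (seg \<phi>1 \<inter> seg \<phi>2 \<union> seg \<phi>2 \<inter> seg \<phi>3 \<union> seg \<phi>3 \<inter> seg \<phi>1)"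

definition elementary :: "nat \<Rightarrow> int \<Rightarrow> sign \<Rightarrow> real \<Rightarrow> real \<Rightarrow> real \<Rightarrow> bool" where
  "elementary d \<kappa> s \<phi>1 \<phi>2 \<phi>3 \<longleftrightarrow>
     (\<exists>l m n. \<phi>1 = fam_angle d \<kappa> l \<and> \<phi>2 = fam_angle d \<kappa> m \<and> \<phi>3 = fam_angle d \<kappa> n \<and>
        \<not> [l = m] (mod int d) \<and> \<not> [m = n] (mod int d) \<and> \<not> [n = l] (mod int d) \<and>
        seg \<phi>1 \<inter> seg \<phi>2 \<inter> seg \<phi>3 = {} \<and>
        [l + m + n = \<kappa> + sign_val s] (mod int d))"


subsection \<open>Decorated tiles\<close>

text \<open>
  A tile is a pair of the underlying triangle \<open>t\<close> and its interior decoration \<open>t'\<close>, both as subsets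
  of the plane.
\<close>

type_synonym tile = "complex set \<times> complex set"

definition map_tile :: "(complex \<Rightarrow> complex) \<Rightarrow> tile \<Rightarrow> tile" where
  "map_tile f X = (f ` fst X, f ` snd X)"

definition decorated :: "nat \<Rightarrow> sign \<Rightarrow> real \<Rightarrow> real \<Rightarrow> real \<Rightarrow> tile" where
  "decorated d s \<phi>1 \<phi>2 \<phi>3 =
     (let \<delta> = of_int (sign_val s) * pi / (2 * of_nat d)
      in (formed_triangle \<phi>1 \<phi>2 \<phi>3, formed_triangle (\<phi>1 - \<delta>) (\<phi>2 - \<delta>) (\<phi>3 - \<delta>)))"

definition prototiles :: "nat \<Rightarrow> tile set" where
  "prototiles d =
     {decorated d s \<phi>1 \<phi>2 \<phi>3 | s \<phi>1 \<phi>2 \<phi>3. \<exists>\<kappa>\<in>fam_index d. elementary d \<kappa> s \<phi>1 \<phi>2 \<phi>3}"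

definition isometry :: "(complex \<Rightarrow> complex) \<Rightarrow> bool" where
  "isometry f \<longleftrightarrow> (\<forall>x y. dist (f x) (f y) = dist x y)"

definition direct_isometry :: "(complex \<Rightarrow> complex) \<Rightarrow> bool" where
  "direct_isometry f \<longleftrightarrow> (\<exists>a b. cmod a = 1 \<and> f = (\<lambda>z. a * z + b))"

definition congruent_tile :: "tile \<Rightarrow> tile \<Rightarrow> bool" where
  "congruent_tile X Y \<longleftrightarrow> (\<exists>f. isometry f \<and> Y = map_tile f X)"

definition isosceles :: "tile \<Rightarrow> bool" where
  "isosceles X \<longleftrightarrow>
     (\<exists>a b c. \<not> collinear {a, b, c} \<and> fst X = convex hull {a, b, c} \<and> dist a b = dist a c)"

definition mirror :: "tile \<Rightarrow> tile" where
  "mirror X = map_tile cnj X"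

definition anticlockwise :: "complex \<Rightarrow> complex \<Rightarrow> complex \<Rightarrow> bool" where
  "anticlockwise a b c \<longleftrightarrow> Im (cnj (b - a) * (c - a)) > 0"

text \<open>
  \<open>is_hat X H\<close>: the tile \<open>H\<close> is \<open>X\<close> hat. Its underlying triangle is the mirror image of that of \<open>X\<close>.
  The points \<open>q\<close>, \<open>r\<close>, \<open>s\<close> subdivide the edges \<open>ab\<close>, \<open>bc\<close>, \<open>ca\<close> of \<open>X\<close>, and \<open>q'\<close>, \<open>r'\<close>, \<open>s'\<close> the
  corresponding edges of \<open>H\<close>. As complex conjugation reverses orientation, the edge of \<open>H\<close>
  corresponding to the anticlockwise edge from \<open>a\<close> to \<open>b\<close> runs anticlockwise from \<^term>\<open>cnj b\<close>
  to \<^term>\<open>cnj a\<close>.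
\<close>

definition is_hat :: "tile \<Rightarrow> tile \<Rightarrow> bool" where
  "is_hat X H \<longleftrightarrow>
     (\<exists>a b c q r s q' r' s'.
        anticlockwise a b c \<and>
        X = (convex hull {a, b, c}, convex hull {q, r, s}) \<and>
        q \<in> closed_segment a b \<and> r \<in> closed_segment b c \<and> s \<in> closed_segment c a \<and>
        H = (convex hull {cnj a, cnj b, cnj c}, convex hull {q', r', s'}) \<and>
        q' \<in> closed_segment (cnj b) (cnj a) \<and> dist (cnj b) q' = dist a q \<and>
        r' \<in> closed_segment (cnj c) (cnj b) \<and> dist (cnj c) r' = dist b r \<and>
        s' \<in> closed_segment (cnj a) (cnj c) \<and> dist (cnj a) s' = dist c s)"


subsection \<open>Tilings and patches\<close>

definition is_patch :: "tile set \<Rightarrow> bool" where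
  "is_patch P \<longleftrightarrow>
     (\<forall>X\<in>P. \<forall>Y\<in>P. X \<noteq> Y \<longrightarrow> fst X \<inter> fst Y \<subseteq> frontier (fst X) \<inter> frontier (fst Y))"

definition congruent_patch :: "tile set \<Rightarrow> tile set \<Rightarrow> bool" where
  "congruent_patch P Q \<longleftrightarrow> (\<exists>f. isometry f \<and> Q = map_tile f ` P)"

definition tiling_by :: "tile set \<Rightarrow> tile set \<Rightarrow> bool" where
  "tiling_by F P \<longleftrightarrow>
     countable P \<and>
     (\<forall>X\<in>P. \<exists>T\<in>F. congruent_tile T X) \<and>
     (\<forall>X\<in>P. \<forall>Y\<in>P. X \<noteq> Y \<longrightarrow> interior (fst X) \<inter> interior (fst Y) = {}) \<and>
     (\<Union>X\<in>P. fst X) = UNIV"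


subsection \<open>Inflation rules\<close>

definition cut_pieces :: "complex set set \<Rightarrow> complex set \<Rightarrow> complex set set" where
  "cut_pieces L t = closure ` components (interior t - \<Union>L)"

definition family_patch :: "nat \<Rightarrow> int \<Rightarrow> complex set \<Rightarrow> tile set" where
  "family_patch d \<kappa> t =
     {decorated d s \<phi>1 \<phi>2 \<phi>3 | s \<phi>1 \<phi>2 \<phi>3.
        elementary d \<kappa> s \<phi>1 \<phi>2 \<phi>3 \<and> formed_triangle \<phi>1 \<phi>2 \<phi>3 \<in> cut_pieces (family d \<kappa>) t}"

text \<open>
  The patch on \<open>iota d p \<cdot> T\<close> for a prototile \<open>T\<close>. The map \<open>h\<close> transports the triangle formed by the
  segments \<^term>\<open>seg (\<phi>i + \<theta>)\<close> to the inflated triangle. Neither the labelling of the segments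
  of \<open>T\<close> nor the choice of \<open>\<theta>\<close> affects the resulting patch, so the set comprehension, which ranges
  over all of them, describes just this one patch.
\<close>

definition Phi_plus :: "nat \<Rightarrow> nat \<Rightarrow> tile \<Rightarrow> tile set" where
  "Phi_plus d p T =
     {map_tile h Y | h Y.
        \<exists>\<kappa>\<in>fam_index d. \<exists>\<kappa>'\<in>fam_index d. \<exists>s \<phi>1 \<phi>2 \<phi>3 \<theta>.
          elementary d \<kappa> s \<phi>1 \<phi>2 \<phi>3 \<and> T = decorated d s \<phi>1 \<phi>2 \<phi>3 \<and>
          [3 * \<theta> = - of_int (sign_val s) * (of_nat p + 1) * pi / of_nat d] (rmod pi) \<and>
          seg (\<phi>1 + \<theta>) \<in> family d \<kappa>' \<and> seg (\<phi>2 + \<theta>) \<in> family d \<kappa>' \<and> seg (\<phi>3 + \<theta>) \<in> family d \<kappa>' \<and>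
          direct_isometry h \<and>
          h ` (seg (\<phi>1 + \<theta>) \<inter> seg (\<phi>2 + \<theta>)) = (*\<^sub>R) (iota d p) ` (seg \<phi>1 \<inter> seg \<phi>2) \<and>
          h ` (seg (\<phi>2 + \<theta>) \<inter> seg (\<phi>3 + \<theta>)) = (*\<^sub>R) (iota d p) ` (seg \<phi>2 \<inter> seg \<phi>3) \<and>
          h ` (seg (\<phi>3 + \<theta>) \<inter> seg (\<phi>1 + \<theta>)) = (*\<^sub>R) (iota d p) ` (seg \<phi>3 \<inter> seg \<phi>1) \<and>
          Y \<in> family_patch d \<kappa>' (formed_triangle (\<phi>1 + \<theta>) (\<phi>2 + \<theta>) (\<phi>3 + \<theta>))}"

text \<open>
  If \<open>f\<close> carries \<open>T\<close> to \<open>X\<close>, then \<open>inflated c f\<close> carries \<open>c \<cdot> T\<close> to \<open>c \<cdot> X\<close>.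
\<close>

definition inflated :: "real \<Rightarrow> (complex \<Rightarrow> complex) \<Rightarrow> complex \<Rightarrow> complex" where
  "inflated c f = (\<lambda>z. c *\<^sub>R f (z /\<^sub>R c))"

text \<open>
  Extension to patches of a rule \<open>R\<close> given on the prototiles. The patch that replaces a tile \<open>X\<close> does
  not depend on the prototile \<open>T\<close> and the isometry \<open>f\<close> used to represent \<open>X\<close>.
\<close>

definition inflate_patch :: "nat \<Rightarrow> nat \<Rightarrow> (tile \<Rightarrow> tile set) \<Rightarrow> tile set \<Rightarrow> tile set" where
  "inflate_patch d p R P =
     {map_tile (inflated (iota d p) f) Y | f T Y.
        T \<in> prototiles d \<and> isometry f \<and> map_tile f T \<in> P \<and> Y \<in> R T}"

text \<open>
  The tile \<open>W\<close> with \<open>\<Phi>\<^sub>-(T) = \<Phi>\<^sub>+(W)\<close>, as a tile somewhere in the plane. Its underlying triangle is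
  directly congruent to that of \<open>T\<close>.
\<close>

definition minus_partner :: "tile \<Rightarrow> tile \<Rightarrow> bool" where
  "minus_partner T W \<longleftrightarrow>
     (if isosceles T then W = mirror T else \<exists>H. is_hat T H \<and> W = mirror H)"

text \<open>
  The direct isometry \<open>k\<close> places \<open>W\<close> on the underlying triangle of \<open>T\<close>. It is the identity if \<open>T\<close> is
  not isosceles, and it is unique unless \<open>T\<close> is equilateral, when the three choices give the same
  patch.
\<close>

definition Phi_minus :: "nat \<Rightarrow> nat \<Rightarrow> tile \<Rightarrow> tile set" where
  "Phi_minus d p T =
     {map_tile (inflated (iota d p) k) Y | k W Y.
        minus_partner T W \<and> direct_isometry k \<and> k ` fst W = fst T \<and>
        Y \<in> inflate_patch d p (Phi_plus d p) {W}}"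

primrec Phi_rule :: "nat \<Rightarrow> nat \<Rightarrow> sign \<Rightarrow> tile \<Rightarrow> tile set" where
  "Phi_rule d p Plus = Phi_plus d p"
| "Phi_rule d p Minus = Phi_minus d p"

definition Phi :: "nat \<Rightarrow> nat \<Rightarrow> sign \<Rightarrow> tile set \<Rightarrow> tile set" where
  "Phi d p \<epsilon> = inflate_patch d p (Phi_rule d p \<epsilon>)"

definition tilings_S :: "nat \<Rightarrow> nat \<Rightarrow> sign \<Rightarrow> tile set set" where
  "tilings_S d p \<epsilon> =
     {P. tiling_by (prototiles d) P \<and>
         (\<forall>Q. Q \<subseteq> P \<and> finite Q \<and> is_patch Q \<longrightarrow>
            (\<exists>T\<in>prototiles d. \<exists>n. \<exists>Q'. Q' \<subseteq> (Phi d p \<epsilon> ^^ n) {T} \<and> is_patch Q' \<and>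
               congruent_patch Q Q'))}"

end

(*
  The line through seg \<psi> is the zero set of an affine function L \<psi>.  If the lines \<phi>1, \<phi>2, \<phi>3 through a point
  satisfy \<phi>1 + \<phi>2 + \<phi>3 = 0, then L \<psi> takes the value 4 sin (\<phi>1 - \<psi>) sin (\<phi>2 - \<psi>) sin (\<phi>3 - \<psi>) there.
  For a point inside a triangle formed by three of the segments, L changes sign three times within a
  half turn, so the intermediate value theorem supplies the \<phi>i, and they interlace the angles of the triangle.
  In these angular coordinates a family of segments is a triangular lattice: rounding the \<phi>i to the lattice
  yields the elementary triangle that contains the point, and no segment of the family enters it.
  Hence each inflation rule contains an exact dissection of the inflated prototile.  Rotating all angles by
  \<theta> scales the triangle by the ratio of the sines of the angle sums, which gives the inflation factor; the shift
  with factor 1 exchanges the signs and reverses the decoration, which is what the negative rule needs.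

  There are finitely many prototiles, so some level k has an inner tile in every supertile, at distance 1
  from its boundary.  The map from a prototile to the prototile of its inner tile has a periodic point.  Going
  backwards along its orbit gives nested supertiles of increasing level that exhaust the plane.  The arguments only
  select subsets of the iterated rules, so uniqueness of the patches is never needed.
*)
theory Submission
  imports Defs
begin

subsection \<open>Lines and their crossings\<close>

text \<open>Each \<open>seg\<close> is a chord of constant length 4 that the deltoid cuts from one
  of its tangents, with midpoint \<open>cis (- 2 * \<psi>)\<close> on the unit circle. Tangents with
  angle sum 0 modulo pi are concurrent, so a point is encoded by an unordered triple of angles with
  zero sum. This answers the main obstacle: the pieces of an inflated triangle are given only
  topologically, as components of a complement, and have to be recognised as elementary triangles.
  Because the line forms factor into sines, every question about sides becomes one about the sign of
  a sine, and sines keep their signs between neighbouring multiples of pi / d.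

  The orbit of inner tiles runs in the wrong direction: it leads from a supertile to smaller ones
  inside it, whereas the plane requires each supertile to sit inside a larger one. Only along a
  cycle can the orbit be reversed for ever. The margin 1 is a uniform gain: nested supertiles that
  share a boundary point for ever would exhaust merely a half-plane or a sector.\<close>

definition line_form :: "real \<Rightarrow> complex \<Rightarrow> real" where
  "line_form \<psi> v = Im (cis (- \<psi>) * v) + sin (3 * \<psi>)"

text \<open>With \<open>c = - a - b\<close> this is the sum of the midpoints of the segments
  \<open>a\<close>, \<open>b\<close> and \<open>c\<close>. It is therefore symmetric in three angles
  of zero sum, and the line of angle \<open>c\<close> runs through the crossing as well.\<close>

definition crossing :: "real \<Rightarrow> real \<Rightarrow> complex" where
  "crossing a b = cis (- 2 * a) + cis (- 2 * b) + cis (2 * (a + b))"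

lemma crossing_commute: "crossing a b = crossing b a"
  by (simp add: crossing_def add.commute)

lemma crossing_third: "a + b + c = 0 \<Longrightarrow> crossing a b = crossing b c"
proof -
  assume "a + b + c = 0"
  then have "2 * (b + c) = - 2 * a" "2 * (a + b) = - 2 * c" by auto
  then show ?thesis unfolding crossing_def by (simp only: add_ac)
qed

text \<open>Expanding gives four sines. Sum-to-product joins them in two pairs that share the factor
  \<open>sin (a + b + \<psi>)\<close>, and the difference of the remaining cosines splits into the
  other two factors. The value thus vanishes exactly when \<psi> is one of \<open>a\<close>,
  \<open>b\<close>, \<open>- a - b\<close> modulo pi.\<close>

lemma line_form_crossing: "line_form \<psi> (crossing a b) = - 4 * sin (a - \<psi>) * sin (b - \<psi>) * sin (a + b + \<psi>)"
proof -
  define A B where "A = a - \<psi>" and "B = b - \<psi>"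
  have "line_form \<psi> (crossing a b) = Im (cis (- \<psi>) * cis (- 2 * a)) + Im (cis (- \<psi>) * cis (- 2 * b))
      + Im (cis (- \<psi>) * cis (2 * (a + b))) + sin (3 * \<psi>)"
    unfolding line_form_def crossing_def by (simp only: distrib_left plus_complex.simps)
  also have "\<dots> = sin (- \<psi> - 2 * a) + sin (- \<psi> - 2 * b) + sin (2 * a + 2 * b - \<psi>) + sin (3 * \<psi>)"
    unfolding cis_mult cis.simps by (simp add: algebra_simps)
  also have "\<dots> = (sin (2 * a + 2 * b - \<psi>) + sin (3 * \<psi>)) - (sin (2 * a + \<psi>) + sin (2 * b + \<psi>))"
    using sin_minus[of "2 * a + \<psi>"] sin_minus[of "2 * b + \<psi>"] by (simp add: algebra_simps)
  also have "sin (2 * a + 2 * b - \<psi>) + sin (3 * \<psi>) = 2 * sin (a + b + \<psi>) * cos (A + B)"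
  proof -
    have "(2 * a + 2 * b - \<psi> + 3 * \<psi>) / 2 = a + b + \<psi>" "(2 * a + 2 * b - \<psi> - 3 * \<psi>) / 2 = A + B"
      by (simp_all add: A_def B_def)
    then show ?thesis by (simp only: sin_plus_sin)
  qed
  also have "sin (2 * a + \<psi>) + sin (2 * b + \<psi>) = 2 * sin (a + b + \<psi>) * cos (A - B)"
  proof -
    have "(2 * a + \<psi> + (2 * b + \<psi>)) / 2 = a + b + \<psi>" "(2 * a + \<psi> - (2 * b + \<psi>)) / 2 = A - B"
      by (simp_all add: A_def B_def)
    then show ?thesis by (simp only: sin_plus_sin)
  qed
  finally show ?thesis
    unfolding A_def[symmetric] B_def[symmetric] by (simp add: cos_add cos_diff algebra_simps)
qed

text \<open>The parameter \<open>2 * cos (a + 2 * b)\<close> never leaves the interval from -2 to 2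
  that parametrises the segment, so the crossing of two lines always lies on both segments.\<close>

lemma crossing_on_line: "crossing a b = cis (- 2 * a) + (2 * cos (a + 2 * b)) *\<^sub>R cis a"
proof -
  have "cis (- 2 * b) = cis a * cis (- (a + 2 * b))" "cis (2 * (a + b)) = cis a * cis (a + 2 * b)"
    unfolding cis_mult by (simp_all add: algebra_simps)
  moreover have "cis (- (a + 2 * b)) + cis (a + 2 * b) = of_real (2 * cos (a + 2 * b))"
    unfolding complex_eq_iff plus_complex.simps cis.simps sin_minus cos_minus by simp
  ultimately show ?thesis
    unfolding crossing_def scaleR_conv_of_real by (metis (no_types) add.assoc distrib_left mult.commute)
qed

text \<open>Signed side length along line \<open>a\<close> of the triangle on \<open>a\<close>,
  \<open>b\<close>, \<open>c\<close>. The differences of the angles fix the shape and their sum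
  fixes the size; a common shift of all angles therefore gives a similar triangle.\<close>

lemma crossing_diff: "crossing a b - crossing a c = of_real (4 * sin (a + b + c) * sin (c - b)) * cis a"
proof -
  have "cos (a + 2 * b) - cos (a + 2 * c) = 2 * sin (a + b + c) * sin (c - b)"
  proof -
    have "(a + 2 * b + (a + 2 * c)) / 2 = a + b + c" "(a + 2 * c - (a + 2 * b)) / 2 = c - b"
      by simp_all
    then show ?thesis by (simp only: cos_diff_cos)
  qed
  then have "2 * cos (a + 2 * b) - 2 * cos (a + 2 * c) = 4 * sin (a + b + c) * sin (c - b)"
    by simp
  then have "of_real (4 * sin (a + b + c) * sin (c - b)) * cis a
      = of_real (2 * cos (a + 2 * b)) * cis a - of_real (2 * cos (a + 2 * c)) * cis a"
    by (metis left_diff_distrib of_real_diff)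
  then show ?thesis
    unfolding crossing_on_line scaleR_conv_of_real by (simp only: add_diff_cancel_left)
qed

lemma crossing_add_int_pi: "crossing (a + of_int k * pi) b = crossing a b"
proof -
  have 1: "- 2 * (a + of_int k * pi) = - 2 * a + 2 * pi * of_int (-k)"
    and 2: "2 * (a + of_int k * pi + b) = 2 * (a + b) + 2 * pi * of_int k" by (simp_all add: algebra_simps)
  show ?thesis unfolding crossing_def 1 2 cis_mult[symmetric] using cis_multiple_2pi[of "of_int k"] cis_multiple_2pi[of "of_int (-k)"] by simp
qed

lemma line_form_add_int_pi: "line_form (a + of_int k * pi) v = cos (of_int k * pi) * line_form a v"
proof -
  have s: "sin (of_int k * pi) = 0" by (simp add: sin_zero_iff_int2)
  have "cos (of_int k * pi) ^ 2 = 1" using sin_cos_squared_add[of "of_int k * pi"] s by simp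
  then have "cos (of_int k * pi) ^ 3 = cos (of_int k * pi)" by (simp add: power3_eq_cube power2_eq_square)
  then have c: "cos (3 * (of_int k * pi)) = cos (of_int k * pi)"
    unfolding cos_treble_cos by simp
  have s3: "sin (3 * (of_int k * pi)) = 0" unfolding sin_zero_iff_int2 by (rule exI[of _ "3 * k"]) simp
  have "sin (3 * (a + of_int k * pi)) = sin (3 * a + 3 * (of_int k * pi))" by (simp add: algebra_simps)
  also have "\<dots> = cos (of_int k * pi) * sin (3 * a)" unfolding sin_add s3 c by simp
  finally have 1: "sin (3 * (a + of_int k * pi)) = cos (of_int k * pi) * sin (3 * a)" .
  have 2: "sin (a + of_int k * pi) = cos (of_int k * pi) * sin a"
    "cos (a + of_int k * pi) = cos (of_int k * pi) * cos a"
    unfolding sin_add cos_add s by auto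
  obtain C where C: "cos (of_int k * pi) = C" by blast
  show ?thesis unfolding line_form_def times_complex.simps cis.simps sin_minus cos_minus 1 2 C
    by (simp add: algebra_simps)
qed

lemma seg_eq: "seg a = (\<lambda>t. cis (- 2 * a) + t *\<^sub>R cis a) ` {-2..2}"
proof -
  have 1: "deltoid a = cis (- 2 * a) + 2 *\<^sub>R cis a" by (simp add: deltoid_def scaleR_conv_of_real)
  have "deltoid (a + pi) = cis (- 2 * a) + (-2) *\<^sub>R cis a"
  proof -
    have "cis (- 2 * (a + pi)) = cis (- 2 * a) * cis (2 * pi * -1)" unfolding cis_mult by (simp add: algebra_simps)
    also have "cis (2 * pi * -1) = 1" by (metis Ints_1 Ints_minus cis_multiple_2pi)
    finally show ?thesis unfolding deltoid_def by (simp add: scaleR_conv_of_real complex_eq_iff)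
  qed
  note 2 = this
  have "((\<lambda>t. cis (- 2 * a) + t *\<^sub>R cis a) ` {-2..2}) = closed_segment (cis (- 2 * a) + 2 *\<^sub>R cis a) (cis (- 2 * a) + (-2) *\<^sub>R cis a)"
  proof -
    have "{-2..2} = closed_segment (2::real) (-2)" by (simp add: closed_segment_eq_real_ivl)
    moreover have "(\<lambda>t. cis (- 2 * a) + t *\<^sub>R cis a) = (\<lambda>x. cis (- 2 * a) + x) \<circ> (\<lambda>t. t *\<^sub>R cis a)" by auto
    moreover have "linear (\<lambda>t. t *\<^sub>R cis a)" by (rule linear_scaleR_left)
    ultimately show ?thesis
      by (metis (no_types, lifting) closed_segment_linear_image closed_segment_translation image_comp)
  qed
  then show ?thesis unfolding seg_def 1 2 by simp
qed

lemma crossing_in_seg1: "crossing a b \<in> seg a"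
proof -
  have "2 * cos (a + 2 * b) \<in> {-2..2}" using cos_le_one[of "a + 2 * b"] cos_ge_minus_one[of "a + 2 * b"] by auto
  then show ?thesis unfolding seg_eq crossing_on_line by blast
qed

lemma crossing_in_seg2: "crossing a b \<in> seg b"
  using crossing_in_seg1[of b a] by (simp add: crossing_commute)

lemma line_form_seg: "v \<in> seg a \<Longrightarrow> line_form a v = 0"
proof -
  assume "v \<in> seg a"
  then obtain t where v: "v = cis (- 2 * a) + t *\<^sub>R cis a" unfolding seg_eq by auto
  have "cis (- a) * v = cis (- (3 * a)) + of_real t"
    unfolding v scaleR_conv_of_real distrib_left cis_mult mult.left_commute[of "cis (-a)"] by (simp add: algebra_simps)
  then show ?thesis unfolding line_form_def by (simp del: cis.simps times_complex.simps add: Im_complex_of_real) (simp)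
qed

lemma line_form_zero_unique:
  assumes "line_form a v = line_form a w" "line_form b v = line_form b w" "sin (a - b) \<noteq> 0"
  shows "v = w"
proof -
  define x y where "x = Re v - Re w" and "y = Im v - Im w"
  have 1: "cos a * y = sin a * x" "cos b * y = sin b * x"
    using assms(1,2) unfolding line_form_def x_def y_def by (simp_all add: algebra_simps)
  have "sin (a - b) * x = cos b * (sin a * x) - cos a * (sin b * x)" by (simp add: sin_diff algebra_simps)
  also have "\<dots> = 0" unfolding 1[symmetric] by simp
  finally have x: "x = 0" using assms(3) by simp
  have "sin (a - b) * y = sin a * (cos b * y) - sin b * (cos a * y)" by (simp add: sin_diff algebra_simps)
  also have "\<dots> = 0" unfolding 1 by simp
  finally have "y = 0" using assms(3) by simp
  with x show ?thesis by (simp add: x_def y_def complex_eq_iff)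
qed

lemma line_form_crossing_self [simp]: "line_form a (crossing a b) = 0" "line_form b (crossing a b) = 0"
  by (simp_all add: line_form_crossing)

lemma line_form_zero_crossing:
  assumes "line_form a v = 0" "line_form b v = 0" "sin (a - b) \<noteq> 0"
  shows "v = crossing a b"
  by (rule line_form_zero_unique[OF _ _ assms(3)]) (simp_all add: assms)

lemma seg_Int:
  assumes "sin (a - b) \<noteq> 0"
  shows "seg a \<inter> seg b = {crossing a b}"
  using crossing_in_seg1 crossing_in_seg2 line_form_zero_crossing[OF line_form_seg line_form_seg assms] by blast

subsection \<open>Triangles formed by three lines\<close>

text \<open>By \<open>line_form_crossing\<close>, the condition on the sum excludes a common point
  of three lines with distinct directions.\<close>

definition proper :: "real \<Rightarrow> real \<Rightarrow> real \<Rightarrow> bool" where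
  "proper a b c \<longleftrightarrow> sin (a - b) \<noteq> 0 \<and> sin (b - c) \<noteq> 0 \<and> sin (c - a) \<noteq> 0 \<and> sin (a + b + c) \<noteq> 0"

text \<open>The side of each edge is compared with that of the opposite vertex, so the definition
  does not depend on the orientation of the triangle.\<close>

definition in_triangle :: "real \<Rightarrow> real \<Rightarrow> real \<Rightarrow> complex \<Rightarrow> bool" where
  "in_triangle a b c v \<longleftrightarrow> line_form a v * line_form a (crossing b c) > 0 \<and> line_form b v * line_form b (crossing c a) > 0 \<and> line_form c v * line_form c (crossing a b) > 0"

lemma sin_diff_swap_nonzero: "sin (a - b) \<noteq> 0 \<longleftrightarrow> sin (b - a) \<noteq> 0" for a b :: real
  using sin_minus[of "a - b"] by simp

lemma proper_heights:
  assumes "proper a b c"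
  shows "line_form a (crossing b c) \<noteq> 0" "line_form b (crossing c a) \<noteq> 0" "line_form c (crossing a b) \<noteq> 0"
  using assms sin_diff_swap_nonzero[of a b] sin_diff_swap_nonzero[of b c] sin_diff_swap_nonzero[of c a]
  unfolding proper_def line_form_crossing by (simp_all add: add_ac)

lemma line_form_affine3:
  assumes "x + y + z = 1"
  shows "line_form \<psi> (x *\<^sub>R p + y *\<^sub>R q + z *\<^sub>R r) = x * line_form \<psi> p + y * line_form \<psi> q + z * line_form \<psi> r"
proof -
  have "sin (3 * \<psi>) = (x + y + z) * sin (3 * \<psi>)" using assms by simp
  then show ?thesis unfolding line_form_def by (simp add: algebra_simps)
qed

lemma formed_triangle_eq:
  assumes "proper a b c"
  shows "formed_triangle a b c = convex hull {crossing a b, crossing b c, crossing c a}"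
  using assms unfolding proper_def formed_triangle_def by (simp add: seg_Int insert_commute)

lemma proper_not_collinear:
  assumes "proper a b c"
  shows "\<not> collinear {crossing a b, crossing b c, crossing c a}"
proof
  assume "collinear {crossing a b, crossing b c, crossing c a}"
  then consider "crossing a b = crossing c a" | u where "crossing b c = u *\<^sub>R crossing a b + (1 - u) *\<^sub>R crossing c a"
    unfolding collinear_3_expand by blast
  then show False
  proof cases
    case 1
    then show ?thesis using proper_heights[OF assms] by (metis line_form_crossing_self)
  next
    case 2
    then have "line_form a (crossing b c) = 0"
      using line_form_affine3[of u "1 - u" 0 a "crossing a b" "crossing c a" 0] by simp
    then show ?thesis using proper_heights[OF assms] by simp
  qed
qed

lemma interior_formed_triangle:
  assumes "proper a b c"
  shows "interior (formed_triangle a b c) = Collect (in_triangle a b c)"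
proof -
  let ?P = "crossing a b" and ?Q = "crossing b c" and ?R = "crossing c a"
  note h = proper_heights[OF assms]
  have "interior (formed_triangle a b c) =
      {v. \<exists>x y z. 0 < x \<and> 0 < y \<and> 0 < z \<and> x + y + z = 1 \<and> x *\<^sub>R ?P + y *\<^sub>R ?Q + z *\<^sub>R ?R = v}"
    unfolding formed_triangle_eq[OF assms]
    by (rule interior_convex_hull_3_minimal[OF proper_not_collinear[OF assms]]) simp
  also have "\<dots> = Collect (in_triangle a b c)"
  proof (intro Collect_cong iffI)
    fix v
    assume "\<exists>x y z. 0 < x \<and> 0 < y \<and> 0 < z \<and> x + y + z = 1 \<and> x *\<^sub>R ?P + y *\<^sub>R ?Q + z *\<^sub>R ?R = v"
    then obtain x y z where pos: "0 < x" "0 < y" "0 < z" and s: "x + y + z = 1"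
      and v: "v = x *\<^sub>R ?P + y *\<^sub>R ?Q + z *\<^sub>R ?R" by blast
    have "line_form a v = y * line_form a ?Q" "line_form b v = z * line_form b ?R" "line_form c v = x * line_form c ?P"
      unfolding v line_form_affine3[OF s] by simp_all
    moreover have "0 < (t * e) * e" if "0 < t" "e \<noteq> 0" for t e :: real
      using that by (auto simp: zero_less_mult_iff mult_less_0_iff linorder_neq_iff)
    ultimately show "in_triangle a b c v" unfolding in_triangle_def using pos h by simp
  next
    fix v
    assume i: "in_triangle a b c v"
    \<comment> \<open>The form of an edge vanishes at both of its ends, so the barycentric
      coordinate of the opposite vertex is the quotient of the form at \<open>v\<close> by its value
      at that vertex.\<close>
    define y z x where "y = line_form a v / line_form a ?Q" and "z = line_form b v / line_form b ?R" and "x = 1 - y - z"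
    define w where "w = x *\<^sub>R ?P + y *\<^sub>R ?Q + z *\<^sub>R ?R"
    have s: "x + y + z = 1" by (simp add: x_def)
    have w: "line_form a w = y * line_form a ?Q" "line_form b w = z * line_form b ?R" "line_form c w = x * line_form c ?P"
      unfolding w_def line_form_affine3[OF s] by simp_all
    have "v = w"
      by (rule line_form_zero_unique[of a _ _ b]) (use w h assms in \<open>simp_all add: y_def z_def proper_def\<close>)
    have x: "x = line_form c v / line_form c ?P" using w(3) h(3) \<open>v = w\<close> by simp
    have "0 < x" "0 < y" "0 < z"
      using i unfolding in_triangle_def x y_def z_def by (simp_all add: zero_less_divide_iff zero_less_mult_iff)
    then show "\<exists>x y z. 0 < x \<and> 0 < y \<and> 0 < z \<and> x + y + z = 1 \<and> x *\<^sub>R ?P + y *\<^sub>R ?Q + z *\<^sub>R ?R = v"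
      using s \<open>v = w\<close> w_def by blast
  qed
  finally show ?thesis .
qed

lemma closed_formed_triangle:
  assumes "proper a b c"
  shows "closed (formed_triangle a b c)"
  unfolding formed_triangle_eq[OF assms] by (simp add: compact_imp_closed finite_imp_compact_convex_hull)

lemma convex_formed_triangle: "convex (formed_triangle a b c)"
  unfolding formed_triangle_def by (rule convex_convex_hull)

lemma formed_triangle_interior_nonempty:
  assumes "proper a b c"
  shows "interior (formed_triangle a b c) \<noteq> {}"
proof -
  have "in_triangle a b c ((1/3) *\<^sub>R crossing a b + (1/3) *\<^sub>R crossing b c + (1/3) *\<^sub>R crossing c a)"
    using proper_heights[OF assms] unfolding in_triangle_def by (auto simp: line_form_affine3 zero_less_mult_iff linorder_neq_iff)
  then show ?thesis unfolding interior_formed_triangle[OF assms] by blast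
qed

text \<open>Points with a vanishing barycentric coordinate lie on an edge. An edge belongs to the
  segment, and not just to its line, because both of its ends are crossings on that segment.\<close>

lemma frontier_formed_triangle:
  assumes "proper a b c"
  shows "frontier (formed_triangle a b c) \<subseteq> seg a \<union> seg b \<union> seg c"
proof
  fix v
  assume "v \<in> frontier (formed_triangle a b c)"
  then have v: "v \<in> formed_triangle a b c" "\<not> in_triangle a b c v"
    using interior_formed_triangle[OF assms] closed_formed_triangle[OF assms]
    by (auto simp: frontier_def closure_closed)
  have cs: "convex (seg \<psi>)" for \<psi> unfolding seg_def by simp
  from v(1) obtain x y z where nn: "0 \<le> x" "0 \<le> y" "0 \<le> z" and s: "x + y + z = 1"
    and e: "v = x *\<^sub>R crossing a b + y *\<^sub>R crossing b c + z *\<^sub>R crossing c a"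
    unfolding formed_triangle_eq[OF assms] convex_hull_3 by blast
  consider "x = 0" | "y = 0" | "z = 0" | "0 < x" "0 < y" "0 < z" using nn by linarith
  then show "v \<in> seg a \<union> seg b \<union> seg c"
  proof cases
    case 1
    then have "v \<in> seg c" using convexD[OF cs crossing_in_seg2[of b c] crossing_in_seg1[of c a] nn(2,3)] s e by simp
    then show ?thesis by blast
  next
    case 2
    then have "v \<in> seg a" using convexD[OF cs crossing_in_seg1[of a b] crossing_in_seg2[of c a] nn(1,3)] s e by simp
    then show ?thesis by blast
  next
    case 3
    then have "v \<in> seg b" using convexD[OF cs crossing_in_seg2[of a b] crossing_in_seg1[of b c] nn(1,2)] s e by simp
    then show ?thesis by blast
  next
    case 4
    have "v \<in> interior (formed_triangle a b c)"
      unfolding formed_triangle_eq[OF assms]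
      using interior_convex_hull_3_minimal[OF proper_not_collinear[OF assms]] 4 s e by auto
    then show ?thesis using v interior_formed_triangle[OF assms] by blast
  qed
qed

section \<open>Interlacing of the lines through a point with the edges of a triangle\<close>

text \<open>
  The function \<open>\<psi> \<mapsto> line_form \<psi> v\<close> changes sign under \<open>\<psi> \<mapsto> \<psi> + pi\<close>; if \<open>v\<close> lies inside the triangle, its signs at the
  three angles alternate, which forces a zero in each of the three gaps.
\<close>

definition interlaced :: "real \<Rightarrow> real \<Rightarrow> real \<Rightarrow> complex \<Rightarrow> bool" where
  "interlaced a b c v \<longleftrightarrow> (\<exists>g1 g2 g3. 0 < g1 \<and> 0 < g2 \<and> 0 < g3 \<and> g1 + g2 + g3 < pi \<and>
     line_form (a + g1) v = 0 \<and> line_form (b + g2) v = 0 \<and> line_form (c + g3) v = 0 \<and>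
     sin ((a + g1) - (b + g2)) \<noteq> 0 \<and> sin ((b + g2) - (c + g3)) \<noteq> 0 \<and> sin ((c + g3) - (a + g1)) \<noteq> 0)"

lemma interlaced_ordered:
  assumes "a < b" "b < c" "c < a + pi" "proper a b c" "in_triangle a b c v"
  shows "interlaced a b c v"
proof -
  \<comment> \<open>The factor \<open>sin (a + b + c)\<close> removes the orientation: with it the
    signs at \<open>a\<close>, \<open>b\<close>, \<open>c\<close> are always minus, plus,
    minus.\<close>
  define F where "F \<psi> = line_form \<psi> v * sin (a + b + c)" for \<psi>
  have cont: "continuous_on S F" for S
    unfolding F_def line_form_def cis.simps times_complex.simps by (intro continuous_intros)
  have pos: "0 < sin (b - a)" "0 < sin (c - b)" "0 < sin (c - a)"
    using assms(1-3) by (auto intro!: sin_gt_zero)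
  have neg: "sin (a - b) = - sin (b - a)" "sin (b - c) = - sin (c - b)" "sin (a - c) = - sin (c - a)"
    by (simp_all flip: sin_minus)
  have Fa: "F a < 0" and Fb: "F b > 0" and Fc: "F c < 0"
  proof -
    have "0 < line_form a v * (- 4 * sin (b - a) * sin (c - a) * sin (a + b + c))"
      using assms(5) unfolding in_triangle_def line_form_crossing by (simp add: add_ac)
    then have "0 < (4 * sin (b - a) * sin (c - a)) * - F a" unfolding F_def by (simp only: mult_ac) (simp add: mult_ac)
    then show "F a < 0" using pos by (simp add: zero_less_mult_iff mult_less_0_iff)
    have "0 < line_form b v * (- 4 * sin (c - b) * sin (a - b) * sin (a + b + c))"
      using assms(5) unfolding in_triangle_def line_form_crossing by (simp add: add_ac)
    then have "0 < (4 * sin (b - a) * sin (c - b)) * F b" unfolding F_def neg by (simp add: mult_ac)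
    then show "F b > 0" using pos by (simp add: zero_less_mult_iff mult_less_0_iff)
    have "0 < line_form c v * (- 4 * sin (a - c) * sin (b - c) * sin (a + b + c))"
      using assms(5) unfolding in_triangle_def line_form_crossing by (simp add: add_ac)
    then have "0 < (4 * sin (c - a) * sin (c - b)) * - F c" unfolding F_def neg by (simp add: mult_ac)
    then show "F c < 0" using pos by (simp add: zero_less_mult_iff mult_less_0_iff)
  qed
  have Fap: "F (a + pi) > 0" using Fa line_form_add_int_pi[of a 1 v] unfolding F_def by simp
  have ivt: "\<exists>x. l < x \<and> x < u \<and> F x = 0" if "l < u" "F l * F u < 0" for l u
  proof -
    have "\<exists>x\<ge>l. x \<le> u \<and> F x = 0"
    proof (cases "F l < 0")
      case True
      then show ?thesis using that IVT'[of F l 0 u] cont by (auto simp: mult_less_0_iff)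
    next
      case False
      then show ?thesis using that IVT2'[of F u 0 l] cont by (auto simp: mult_less_0_iff)
    qed
    then obtain x where "l \<le> x" "x \<le> u" "F x = 0" by blast
    moreover then have "x \<noteq> l" "x \<noteq> u" using that by auto
    ultimately show ?thesis by (auto intro!: exI[of _ x])
  qed
  obtain x where x: "a < x" "x < b" "F x = 0" using ivt[of a b] Fa Fb assms by (auto simp: mult_less_0_iff)
  obtain y where y: "b < y" "y < c" "F y = 0" using ivt[of b c] Fb Fc assms by (auto simp: mult_less_0_iff)
  obtain z where z: "c < z" "z < a + pi" "F z = 0" using ivt[of c "a + pi"] Fc Fap assms by (auto simp: mult_less_0_iff)
  have S: "sin (a + b + c) \<noteq> 0" using assms(4) by (simp add: proper_def)
  have "0 < sin (y - x)" "0 < sin (z - y)" "0 < sin (z - x)"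
    using x y z by (auto intro!: sin_gt_zero)
  then have "sin (x - y) \<noteq> 0" "sin (y - z) \<noteq> 0" "sin (z - x) \<noteq> 0"
    using sin_diff_swap_nonzero[of x y] sin_diff_swap_nonzero[of y z] by simp_all
  \<comment> \<open>The three gaps fill the half turn from \<open>a\<close> to
    \<open>a + pi\<close>, which keeps the sum of the three offsets below pi.\<close>
  then show ?thesis unfolding interlaced_def
    using x y z S by (intro exI[of _ "x - a"] exI[of _ "y - b"] exI[of _ "z - c"]) (auto simp: F_def)
qed

lemma cos_int_pi_squared: "cos (of_int k * pi) ^ 2 = 1"
proof -
  have "sin (of_int k * pi) = 0" by (simp add: sin_zero_iff_int2)
  then show ?thesis using sin_cos_squared_add[of "of_int k * pi"] by simp
qed

lemma cos_int_pi_nonzero: "cos (of_int k * pi) \<noteq> 0"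
  using cos_int_pi_squared[of k] by (metis power_zero_numeral zero_neq_one)

lemma sin_add_int_pi: "sin (x + of_int k * pi) = cos (of_int k * pi) * sin x"
  unfolding sin_add by (simp add: sin_zero_iff_int2)

lemma proper_add_pi: "proper a (b + of_int k * pi) c \<longleftrightarrow> proper a b c"
proof -
  have s: "sin (x + of_int k * pi) \<noteq> 0 \<longleftrightarrow> sin x \<noteq> 0" for x :: real
    unfolding sin_add_int_pi using cos_int_pi_nonzero by simp
  have "sin (a - (b + of_int k * pi)) \<noteq> 0 \<longleftrightarrow> sin (a - b) \<noteq> 0"
    using s[of "b - a"] sin_diff_swap_nonzero[of a] by (simp add: algebra_simps)
  then show ?thesis unfolding proper_def using s[of "b - c"] s[of "a + b + c"] by (simp add: algebra_simps)
qed

lemma proper_swap: "proper a b c \<longleftrightarrow> proper a c b"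
  unfolding proper_def
  using sin_diff_swap_nonzero[of a b] sin_diff_swap_nonzero[of b c] sin_diff_swap_nonzero[of c a]
  by (auto simp: add_ac)

lemma in_triangle_swap: "in_triangle a b c v \<longleftrightarrow> in_triangle a c b v"
  unfolding in_triangle_def by (auto simp: crossing_commute)

lemma in_triangle_add_pi: "in_triangle a (b + of_int k * pi) c v \<longleftrightarrow> in_triangle a b c v"
proof -
  have 1: "crossing x (b + of_int k * pi) = crossing x b" "crossing (b + of_int k * pi) x = crossing x b" for x
    using crossing_add_int_pi crossing_commute by metis+
  have 2: "(cos (of_int k * pi) * x) * (cos (of_int k * pi) * y) = x * y" for x y
    using cos_int_pi_squared[of k] by (metis mult.assoc mult.left_commute mult_1 power2_eq_square)
  show ?thesis unfolding in_triangle_def 1 line_form_add_int_pi 2 by (simp only: crossing_commute[of c b])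
qed

lemma interlaced_swap: "interlaced a b c v \<Longrightarrow> interlaced a c b v"
  unfolding interlaced_def
  apply (elim exE conjE)
  subgoal for g1 g2 g3
    using sin_diff_swap_nonzero[of "a + g1" "b + g2"] sin_diff_swap_nonzero[of "b + g2" "c + g3"]
      sin_diff_swap_nonzero[of "c + g3" "a + g1"]
    by (intro exI[of _ g1] exI[of _ g3] exI[of _ g2]) simp
  done

lemma interlaced_add_pi: "interlaced a (b + of_int k * pi) c v \<Longrightarrow> interlaced a b c v"
proof -
  assume "interlaced a (b + of_int k * pi) c v"
  then obtain g1 g2 g3 where g: "0 < g1 \<and> 0 < g2 \<and> 0 < g3 \<and> g1 + g2 + g3 < pi"
     "line_form (a + g1) v = 0" "line_form (b + of_int k * pi + g2) v = 0" "line_form (c + g3) v = 0"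
     and s: "sin ((a + g1) - (b + of_int k * pi + g2)) \<noteq> 0" "sin ((b + of_int k * pi + g2) - (c + g3)) \<noteq> 0"
       "sin ((c + g3) - (a + g1)) \<noteq> 0"
    unfolding interlaced_def by blast
  have e: "b + of_int k * pi + g2 = (b + g2) + of_int k * pi" by simp
  note k = cos_int_pi_nonzero[of k]
  have sk: "sin (x + of_int k * pi) \<noteq> 0 \<longleftrightarrow> sin x \<noteq> 0" for x :: real
    unfolding sin_add_int_pi using cos_int_pi_nonzero by simp
  have "line_form (b + g2) v = 0" using g(3) k unfolding e line_form_add_int_pi by simp
  moreover have "sin ((b + g2) - (c + g3)) \<noteq> 0" using s(2) sk[of "(b + g2) - (c + g3)"] by (simp add: algebra_simps)
  moreover have "sin ((a + g1) - (b + g2)) \<noteq> 0"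
    using s(1) sk[of "(b + g2) - (a + g1)"] sin_diff_swap_nonzero[of "a + g1"] by (simp add: algebra_simps)
  ultimately show ?thesis using g s(3) unfolding interlaced_def by blast
qed

lemma exists_shift_into_period:
  assumes "sin (b - a) \<noteq> 0"
  shows "\<exists>k::int. a < b + of_int k * pi \<and> b + of_int k * pi < a + pi"
proof -
  define k where "k = - \<lfloor>(b - a) / pi\<rfloor>"
  have "of_int (-k) \<le> (b - a) / pi" "(b - a) / pi < of_int (-k) + 1" unfolding k_def by linarith+
  then have 1: "a \<le> b + of_int k * pi" "b + of_int k * pi < a + pi" by (simp_all add: field_simps)
  have "a \<noteq> b + of_int k * pi"
  proof
    assume "a = b + of_int k * pi"
    then have "b - a = of_int (-k) * pi" by simp
    then show False using assms sin_zero_iff_int2 by blast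
  qed
  then show ?thesis using 1 by (intro exI[of _ k]) auto
qed

text \<open>Shifting an angle by a multiple of pi or exchanging two angles leaves the triangle
  unchanged, so the angles may be taken in increasing order within a half turn, where the
  intermediate value argument applies.\<close>

lemma in_triangle_interlaced:
  assumes "proper a b c" "in_triangle a b c v"
  shows "interlaced a b c v"
proof -
  have ordered: "interlaced a b' c' v" if "proper a b' c'" "in_triangle a b' c' v" "a < b'" "b' < a + pi" "a < c'" "c' < a + pi" for b' c'
  proof -
    have "b' \<noteq> c'" using that(1) unfolding proper_def by auto
    then consider "b' < c'" | "c' < b'" by linarith
    then show ?thesis
      using interlaced_ordered[of a b' c' v] interlaced_ordered[of a c' b' v] interlaced_swap[of a c' b' v]
        that proper_swap[of a b' c'] in_triangle_swap[of a b' c' v] by cases auto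
  qed
  obtain k where k: "a < b + of_int k * pi" "b + of_int k * pi < a + pi"
    using exists_shift_into_period assms(1) sin_diff_swap_nonzero unfolding proper_def by metis
  obtain l where l: "a < c + of_int l * pi" "c + of_int l * pi < a + pi"
    using exists_shift_into_period assms(1) unfolding proper_def by metis
  have p: "proper a (b + of_int k * pi) (c + of_int l * pi)"
    using assms(1) proper_add_pi proper_swap by blast
  have i: "in_triangle a (b + of_int k * pi) (c + of_int l * pi) v"
    using assms(2) in_triangle_add_pi in_triangle_swap by blast
  have "interlaced a (b + of_int k * pi) (c + of_int l * pi) v" by (rule ordered[OF p i k l])
  then show ?thesis using interlaced_add_pi interlaced_swap by blast
qed

lemma line_form_three_zeros:
  assumes "line_form x v = 0" "line_form y v = 0" "line_form z v = 0"
    "sin (x - y) \<noteq> 0" "sin (y - z) \<noteq> 0" "sin (z - x) \<noteq> 0"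
  shows "v = crossing x y" "sin (x + y + z) = 0"
proof -
  show v: "v = crossing x y" using assms line_form_zero_crossing by blast
  show "sin (x + y + z) = 0"
    using assms(3-6) sin_diff_swap_nonzero[of z x] unfolding v line_form_crossing by auto
qed

subsection \<open>Elementary triangles and lattice cells\<close>

lemma fam_angle_diff:
  assumes "0 < d"
  shows "fam_angle d \<kappa> m - fam_angle d \<kappa> l = of_int (m - l) * pi / of_nat d"
  using assms by (simp add: fam_angle_def field_simps)

lemma fam_angle_sum:
  assumes "0 < d"
  shows "fam_angle d \<kappa> l + fam_angle d \<kappa> m + fam_angle d \<kappa> n = of_int (l + m + n - \<kappa>) * pi / of_nat d"
  using assms by (simp add: fam_angle_def field_simps)

section \<open>Signs of sines on lattice intervals\<close>

lemma sin_lattice_zero_iff: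
  assumes "0 < d"
  shows "sin (of_int k * pi / of_nat d) = 0 \<longleftrightarrow> int d dvd k"
proof -
  have "sin (of_int k * pi / of_nat d) = 0 \<longleftrightarrow> (\<exists>i. k = i * int d)"
    unfolding sin_zero_iff_int2
  proof (intro ex_cong1)
    fix i
    have "of_int k * pi / of_nat d = of_int i * pi \<longleftrightarrow> real_of_int k = of_int i * of_nat d"
      using assms by (simp add: field_simps)
    also have "\<dots> \<longleftrightarrow> real_of_int k = real_of_int (i * int d)" by simp
    also have "\<dots> \<longleftrightarrow> k = i * int d" by (rule of_int_eq_iff)
    finally show "of_int k * pi / of_nat d = of_int i * pi \<longleftrightarrow> k = i * int d" .
  qed
  then show ?thesis unfolding dvd_def by (simp add: mult.commute)
qed

lemma sin_fam_diff_zero_iff: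
  assumes "0 < d"
  shows "sin (fam_angle d \<kappa> m - fam_angle d \<kappa> l) = 0 \<longleftrightarrow> [m = l] (mod int d)"
  unfolding fam_angle_diff[OF assms] sin_lattice_zero_iff[OF assms] by (simp add: cong_iff_dvd_diff)

text \<open>All zeros of the sine are lattice points, so the sign can change only at an end of a
  lattice interval. The interval is moved into the range from 0 to pi by splitting off the quotient
  of \<open>k\<close> by \<open>d\<close>.\<close>

lemma sin_mult_pos_same_interval:
  fixes k :: int
  assumes d: "0 < d" and x: "x \<in> {of_int k * pi / of_nat d .. of_int (k + 1) * pi / of_nat d}"
    and y: "y \<in> {of_int k * pi / of_nat d .. of_int (k + 1) * pi / of_nat d}"
    and nz: "sin x \<noteq> 0" "sin y \<noteq> 0"
  shows "0 < sin x * sin y"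
proof -
  define q r where "q = k div int d" and "r = k mod int d"
  have k: "k = q * int d + r" by (simp add: q_def r_def)
  have "0 \<le> r" "r < int d" unfolding r_def using d by simp_all
  then have r: "0 \<le> r" "r + 1 \<le> int d" by linarith+
  have *: "sin t = cos (of_int q * pi) * sin (t - of_int q * pi)" "0 \<le> sin (t - of_int q * pi)"
    if t: "t \<in> {of_int k * pi / of_nat d .. of_int (k + 1) * pi / of_nat d}" for t
  proof -
    show "sin t = cos (of_int q * pi) * sin (t - of_int q * pi)"
      using sin_add_int_pi[of "t - of_int q * pi" q] by simp
    have e: "of_int k * pi / of_nat d = of_int q * pi + of_int r * pi / of_nat d"
      "of_int (k + 1) * pi / of_nat d = of_int q * pi + of_int (r + 1) * pi / of_nat d"
      unfolding k using d by (simp_all add: field_simps)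
    have "0 \<le> of_int r * pi / of_nat d" using r by simp
    moreover have "of_int (r + 1) * pi / of_nat d \<le> pi"
    proof -
      have "real_of_int (r + 1) \<le> real_of_int (int d)" using r(2) by (simp only: of_int_le_iff)
      then have "real_of_int (r + 1) \<le> of_nat d" by simp
      then show ?thesis using d by (simp add: divide_le_eq mult_right_mono mult.commute[of pi])
    qed
    ultimately have "0 \<le> t - of_int q * pi" "t - of_int q * pi \<le> pi" using t unfolding e by auto
    then show "0 \<le> sin (t - of_int q * pi)" by (rule sin_ge_zero)
  qed
  let ?c = "cos (of_int q * pi)"
  have "sin x * sin y = ?c ^ 2 * (sin (x - of_int q * pi) * sin (y - of_int q * pi))"
    unfolding *(1)[OF x] *(1)[OF y] by (simp add: power2_eq_square)
  also have "\<dots> = sin (x - of_int q * pi) * sin (y - of_int q * pi)" by (simp only: cos_int_pi_squared mult_1)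
  also have "\<dots> \<ge> 0" using *(2)[OF x] *(2)[OF y] by simp
  finally have "0 \<le> sin x * sin y" .
  moreover have "sin x * sin y \<noteq> 0" using nz by simp
  ultimately show ?thesis by (simp only: less_le) simp
qed

lemma sin_nonzero_open_interval:
  fixes k :: int
  assumes d: "0 < d" and x: "of_int k * pi / of_nat d < x" "x < of_int (k + 1) * pi / of_nat d"
  shows "sin x \<noteq> 0"
proof
  assume "sin x = 0"
  then obtain i where "x = of_int i * pi" unfolding sin_zero_iff_int2 by blast
  then have "real_of_int k * pi < real_of_int (i * int d) * pi" "real_of_int (i * int d) * pi < real_of_int (k + 1) * pi"
    using x d by (simp_all add: field_simps)
  then have "real_of_int k < real_of_int (i * int d)" "real_of_int (i * int d) < real_of_int (k + 1)"
    by (simp_all only: mult_less_cancel_right_pos pi_gt_zero)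
  then show False unfolding of_int_less_iff by linarith
qed

text \<open>Number of the lattice interval that contains the difference of two family angles both
  before and after the first of them is moved into its cell. The move goes down for
  \<open>Plus\<close> and up for \<open>Minus\<close>, so a \<open>Plus\<close> cell lies below its
  lattice angle; hence the shift by 1.\<close>

definition cell_index :: "sign \<Rightarrow> int \<Rightarrow> int" where
  "cell_index s k = (case s of Plus \<Rightarrow> k - 1 | Minus \<Rightarrow> k)"

context
  fixes d :: nat and s :: sign and \<kappa> m l :: int and g :: real
  assumes d: "0 < d" and g: "0 < g" "g < pi / of_nat d"
begin

lemma cell_interval:
  defines "k \<equiv> cell_index s (m - l)"
  shows "of_int k * pi / of_nat d < fam_angle d \<kappa> m - of_int (sign_val s) * g - fam_angle d \<kappa> l"
    and "fam_angle d \<kappa> m - of_int (sign_val s) * g - fam_angle d \<kappa> l < of_int (k + 1) * pi / of_nat d"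
    and "of_int k * pi / of_nat d \<le> fam_angle d \<kappa> m - fam_angle d \<kappa> l"
    and "fam_angle d \<kappa> m - fam_angle d \<kappa> l \<le> of_int (k + 1) * pi / of_nat d"
proof -
  have *: "fam_angle d \<kappa> m - of_int (sign_val s) * g - fam_angle d \<kappa> l
    = of_int (m - l) * pi / of_nat d - of_int (sign_val s) * g"
    using fam_angle_diff[OF d, of \<kappa> m l] by simp
  have "0 < pi / of_nat d" using d by simp
  then show "of_int k * pi / of_nat d < fam_angle d \<kappa> m - of_int (sign_val s) * g - fam_angle d \<kappa> l"
    and "fam_angle d \<kappa> m - of_int (sign_val s) * g - fam_angle d \<kappa> l < of_int (k + 1) * pi / of_nat d"
    and "of_int k * pi / of_nat d \<le> fam_angle d \<kappa> m - fam_angle d \<kappa> l"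
    and "fam_angle d \<kappa> m - fam_angle d \<kappa> l \<le> of_int (k + 1) * pi / of_nat d"
    unfolding * fam_angle_diff[OF d] k_def cell_index_def
    using g by (cases s; simp add: diff_divide_distrib add_divide_distrib distrib_right left_diff_distrib)+
qed

lemma cell_sin_nonzero: "sin (fam_angle d \<kappa> m - of_int (sign_val s) * g - fam_angle d \<kappa> l) \<noteq> 0"
  using sin_nonzero_open_interval[OF d] cell_interval(1,2) by blast

lemma cell_sin_corner:
  assumes "\<not> [m = l] (mod int d)"
  shows "0 < sin (fam_angle d \<kappa> m - fam_angle d \<kappa> l)
    * sin (fam_angle d \<kappa> m - of_int (sign_val s) * g - fam_angle d \<kappa> l)"
  by (rule sin_mult_pos_same_interval[OF d, of _ "cell_index s (m - l)"])
    (use cell_interval cell_sin_nonzero assms sin_fam_diff_zero_iff[OF d] in auto)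

end

lemma cell_sin_same_sign:
  assumes d: "0 < d" and g: "0 < g" "g < pi / of_nat d" and h: "0 < h" "h < pi / of_nat d"
  shows "0 < sin (fam_angle d \<kappa> m - of_int (sign_val s) * g - fam_angle d \<kappa> l)
    * sin (fam_angle d \<kappa> m - of_int (sign_val s) * h - fam_angle d \<kappa> l)"
  by (rule sin_mult_pos_same_interval[OF d, of _ "cell_index s (m - l)"])
    (use cell_interval[OF d g] cell_interval[OF d h] cell_sin_nonzero[OF d g] cell_sin_nonzero[OF d h] in \<open>auto intro: less_imp_le\<close>)

lemma line_form_cnj: "line_form (- \<psi>) (cnj v) = - line_form \<psi> v"
  by (simp add: line_form_def)

lemma crossing_cnj: "crossing (- a) (- b) = cnj (crossing a b)"
  unfolding crossing_def complex_cnj_add cis_cnj by (simp add: algebra_simps)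

text \<open>The zeros can be read as following or as preceding the angles of the triangle. The
  second reading comes from the first by complex conjugation, which negates all angles. The sign is
  left free so that it can be matched with the sign of an elementary triangle.\<close>

lemma in_triangle_signed_interlaced:
  assumes "proper a b c" "in_triangle a b c v"
  defines "\<sigma> s \<equiv> real_of_int (sign_val s)"
  shows "\<exists>g1 g2 g3. 0 < g1 \<and> 0 < g2 \<and> 0 < g3 \<and> g1 + g2 + g3 < pi \<and> v = crossing (a - \<sigma> s * g1) (b - \<sigma> s * g2) \<and>
    sin (a + b + c - \<sigma> s * (g1 + g2 + g3)) = 0"
proof (cases s)
  case Minus
  obtain g1 g2 g3 where g: "0 < g1" "0 < g2" "0 < g3" "g1 + g2 + g3 < pi"
    and z: "line_form (a + g1) v = 0" "line_form (b + g2) v = 0" "line_form (c + g3) v = 0"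
     "sin ((a + g1) - (b + g2)) \<noteq> 0" "sin ((b + g2) - (c + g3)) \<noteq> 0" "sin ((c + g3) - (a + g1)) \<noteq> 0"
    using in_triangle_interlaced[OF assms(1,2)] unfolding interlaced_def by blast
  show ?thesis using g line_form_three_zeros[OF z] Minus
    by (intro exI[of _ g1] exI[of _ g2] exI[of _ g3]) (simp add: \<sigma>_def algebra_simps)
next
  case Plus
  have p: "proper (-a) (-b) (-c)"
  proof -
    have "sin (- a - - b) = - sin (a - b)" "sin (- b - - c) = - sin (b - c)" "sin (- c - - a) = - sin (c - a)"
      "sin (- a + - b + - c) = - sin (a + b + c)"
      unfolding sin_minus[symmetric] by (simp_all add: algebra_simps)
    then show ?thesis using assms(1) unfolding proper_def by simp
  qed
  have i: "in_triangle (-a) (-b) (-c) (cnj v)"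
    using assms(2) unfolding in_triangle_def crossing_cnj line_form_cnj by simp
  obtain g1 g2 g3 where g: "0 < g1" "0 < g2" "0 < g3" "g1 + g2 + g3 < pi"
    and z: "line_form (-a + g1) (cnj v) = 0" "line_form (-b + g2) (cnj v) = 0" "line_form (-c + g3) (cnj v) = 0"
     "sin ((-a + g1) - (-b + g2)) \<noteq> 0" "sin ((-b + g2) - (-c + g3)) \<noteq> 0" "sin ((-c + g3) - (-a + g1)) \<noteq> 0"
    using in_triangle_interlaced[OF p i] unfolding interlaced_def by blast
  have e: "-a + g1 = - (a - g1)" "-b + g2 = - (b - g2)" by simp_all
  have "cnj v = cnj (crossing (a - g1) (b - g2))" using line_form_three_zeros(1)[OF z] unfolding e crossing_cnj .
  moreover have "sin (a + b + c - (g1 + g2 + g3)) = 0"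
    using line_form_three_zeros(2)[OF z] sin_minus[of "a + b + c - (g1 + g2 + g3)"] by (simp add: algebra_simps)
  ultimately show ?thesis using g Plus
    by (intro exI[of _ g1] exI[of _ g2] exI[of _ g3]) (simp add: \<sigma>_def)
qed

lemma elementary_imp_proper:
  assumes d: "1 < d" and "elementary d \<kappa> s a b c"
  shows "proper a b c"
proof -
  have d0: "0 < d" using d by simp
  obtain l m n where a: "a = fam_angle d \<kappa> l" "b = fam_angle d \<kappa> m" "c = fam_angle d \<kappa> n"
    and ne: "\<not> [l = m] (mod int d)" "\<not> [m = n] (mod int d)" "\<not> [n = l] (mod int d)"
    and sum: "[l + m + n = \<kappa> + sign_val s] (mod int d)"
    using assms(2) unfolding elementary_def by blast
  have "sin (a + b + c) \<noteq> 0"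
  proof
    assume "sin (a + b + c) = 0"
    then have "int d dvd l + m + n - \<kappa>" unfolding a fam_angle_sum[OF d0] sin_lattice_zero_iff[OF d0] .
    moreover have "int d dvd l + m + n - (\<kappa> + sign_val s)" using sum by (simp add: cong_iff_dvd_diff)
    ultimately have "int d dvd sign_val s"
      using dvd_diff[of "int d" "l + m + n - \<kappa>" "l + m + n - (\<kappa> + sign_val s)"] by simp
    then show False using d by (cases s) auto
  qed
  then show ?thesis using ne sin_fam_diff_zero_iff[OF d0] unfolding proper_def a by blast
qed

text \<open>Non-concurrency follows from the congruence: for \<open>d > 1\<close> the index sum
  differs from \<kappa> modulo \<open>d\<close>, so the angle sum is no multiple of pi.\<close>

lemma elementaryI:
  assumes d: "1 < d"
    and ne: "\<not> [l = m] (mod int d)" "\<not> [m = n] (mod int d)" "\<not> [n = l] (mod int d)"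
    and sum: "[l + m + n = \<kappa> + sign_val s] (mod int d)"
  shows "elementary d \<kappa> s (fam_angle d \<kappa> l) (fam_angle d \<kappa> m) (fam_angle d \<kappa> n)"
proof -
  let ?a = "fam_angle d \<kappa> l" and ?b = "fam_angle d \<kappa> m" and ?c = "fam_angle d \<kappa> n"
  have d0: "0 < d" using d by simp
  have "\<not> int d dvd l + m + n - \<kappa>"
  proof
    assume "int d dvd l + m + n - \<kappa>"
    moreover have "int d dvd l + m + n - (\<kappa> + sign_val s)" using sum by (simp add: cong_iff_dvd_diff)
    ultimately have "int d dvd sign_val s"
      using dvd_diff[of "int d" "l + m + n - \<kappa>" "l + m + n - (\<kappa> + sign_val s)"] by simp
    then show False using d by (cases s) auto
  qed
  then have p: "proper ?a ?b ?c"
    using ne sin_fam_diff_zero_iff[OF d0] fam_angle_sum[OF d0] sin_lattice_zero_iff[OF d0] unfolding proper_def by metis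
  have "seg ?a \<inter> seg ?b \<inter> seg ?c = {}"
    using seg_Int[of ?a ?b] p proper_heights(3)[OF p] line_form_seg[of "crossing ?a ?b" ?c] unfolding proper_def by auto
  then show ?thesis using ne sum unfolding elementary_def by blast
qed

lemma elementary_sum:
  assumes d: "1 < d" and "elementary d \<kappa> s a b c"
  obtains k :: int where "a + b + c = of_int (sign_val s) * pi / of_nat d + of_int k * pi"
proof -
  have d0: "0 < d" using d by simp
  obtain l m n where a: "a = fam_angle d \<kappa> l" "b = fam_angle d \<kappa> m" "c = fam_angle d \<kappa> n"
    and sum: "[l + m + n = \<kappa> + sign_val s] (mod int d)"
    using assms(2) unfolding elementary_def by blast
  then obtain k where "l + m + n = \<kappa> + sign_val s + int d * k"
    using cong_iff_lin cong_sym by metis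
  then have "l + m + n - \<kappa> = sign_val s + int d * k" by simp
  then have "a + b + c = of_int (sign_val s + int d * k) * pi / of_nat d"
    unfolding a fam_angle_sum[OF d0] by simp
  also have "\<dots> = of_int (sign_val s) * pi / of_nat d + of_int k * pi" using d0 by (simp add: field_simps)
  finally show ?thesis by (rule that)
qed

text \<open>For an elementary triangle the three offsets of the lines through an interior point are
  positive with sum pi / d. Each line therefore stays inside one open lattice interval while the
  point varies, and no factor of the product formula for a family line changes sign.\<close>

lemma elementary_same_side:
  assumes d: "1 < d" and e: "elementary d \<kappa> s a b c" and v: "in_triangle a b c v" and w: "in_triangle a b c w"
  shows "0 < line_form (fam_angle d \<kappa> \<nu>) v * line_form (fam_angle d \<kappa> \<nu>) w"
proof -
  have d0: "0 < d" using d by simp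
  note p = elementary_imp_proper[OF d e]
  obtain k where k: "a + b + c = of_int (sign_val s) * pi / of_nat d + of_int k * pi" using elementary_sum[OF d e] .
  let ?\<psi> = "fam_angle d \<kappa> \<nu>" and ?\<sigma> = "real_of_int (sign_val s)"
  let ?C = "cos (of_int k * pi)"
  have pd: "0 < pi / of_nat d" "pi / of_nat d < pi" using d by (simp_all add: field_simps)
  have rep: "\<exists>g1 g2 g3. 0 < g1 \<and> g1 < pi / of_nat d \<and> 0 < g2 \<and> g2 < pi / of_nat d \<and> 0 < g3 \<and> g3 < pi / of_nat d \<and>
      line_form ?\<psi> u = 4 * ?C * (sin (a - ?\<sigma> * g1 - ?\<psi>) * sin (b - ?\<sigma> * g2 - ?\<psi>) * sin (c - ?\<sigma> * g3 - ?\<psi>))"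
    if u: "in_triangle a b c u" for u
  proof -
    obtain g1 g2 g3 where g: "0 < g1" "0 < g2" "0 < g3" "g1 + g2 + g3 < pi"
      and u: "u = crossing (a - ?\<sigma> * g1) (b - ?\<sigma> * g2)" and s0: "sin (a + b + c - ?\<sigma> * (g1 + g2 + g3)) = 0"
      using in_triangle_signed_interlaced[OF p u] by blast
    \<comment> \<open>The offset sum equals pi / d up to a multiple of pi; both lie strictly between
      0 and pi, so they agree.\<close>
    let ?t = "pi / of_nat d - (g1 + g2 + g3)"
    have "sin (a + b + c - ?\<sigma> * (g1 + g2 + g3)) = ?C * sin (?\<sigma> * ?t)"
      unfolding k using sin_add_int_pi[of "?\<sigma> * ?t" k] by (simp add: algebra_simps)
    then have "sin (?\<sigma> * ?t) = 0" using s0 cos_int_pi_nonzero by simp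
    then have "sin ?t = 0" by (cases s) (use sin_minus[of ?t] in auto)
    moreover have "- pi < ?t" "?t < pi" using g pd by linarith+
    ultimately have t: "g1 + g2 + g3 = pi / of_nat d" using sin_eq_0_pi by force
    have "a - ?\<sigma> * g1 + (b - ?\<sigma> * g2) + ?\<psi> = - (c - ?\<sigma> * g3 - ?\<psi>) + of_int k * pi"
    proof -
      have "a - ?\<sigma> * g1 + (b - ?\<sigma> * g2) + ?\<psi> = (a + b + c) - ?\<sigma> * (g1 + g2 + g3) - (c - ?\<sigma> * g3 - ?\<psi>)"
        by (simp add: algebra_simps)
      then show ?thesis unfolding k t by simp
    qed
    then have "sin (a - ?\<sigma> * g1 + (b - ?\<sigma> * g2) + ?\<psi>) = - ?C * sin (c - ?\<sigma> * g3 - ?\<psi>)"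
      by (simp only: sin_add_int_pi sin_minus minus_mult_commute)
    then have "line_form ?\<psi> u = 4 * ?C * (sin (a - ?\<sigma> * g1 - ?\<psi>) * sin (b - ?\<sigma> * g2 - ?\<psi>) * sin (c - ?\<sigma> * g3 - ?\<psi>))"
      unfolding u line_form_crossing by simp
    then show ?thesis using g t by (intro exI[of _ g1] exI[of _ g2] exI[of _ g3]) auto
  qed
  obtain g1 g2 g3 where g: "0 < g1" "g1 < pi / of_nat d" "0 < g2" "g2 < pi / of_nat d" "0 < g3" "g3 < pi / of_nat d"
    and V: "line_form ?\<psi> v = 4 * ?C * (sin (a - ?\<sigma> * g1 - ?\<psi>) * sin (b - ?\<sigma> * g2 - ?\<psi>) * sin (c - ?\<sigma> * g3 - ?\<psi>))"
    using rep[OF v] by blast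
  obtain h1 h2 h3 where h: "0 < h1" "h1 < pi / of_nat d" "0 < h2" "h2 < pi / of_nat d" "0 < h3" "h3 < pi / of_nat d"
    and W: "line_form ?\<psi> w = 4 * ?C * (sin (a - ?\<sigma> * h1 - ?\<psi>) * sin (b - ?\<sigma> * h2 - ?\<psi>) * sin (c - ?\<sigma> * h3 - ?\<psi>))"
    using rep[OF w] by blast
  obtain l m n where abc: "a = fam_angle d \<kappa> l" "b = fam_angle d \<kappa> m" "c = fam_angle d \<kappa> n"
    using e unfolding elementary_def by blast
  let ?A = "sin (a - ?\<sigma> * g1 - ?\<psi>) * sin (a - ?\<sigma> * h1 - ?\<psi>)"
  let ?B = "sin (b - ?\<sigma> * g2 - ?\<psi>) * sin (b - ?\<sigma> * h2 - ?\<psi>)"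
  let ?D = "sin (c - ?\<sigma> * g3 - ?\<psi>) * sin (c - ?\<sigma> * h3 - ?\<psi>)"
  have "0 < ?A" "0 < ?B" "0 < ?D"
    unfolding abc by (intro cell_sin_same_sign d0 g h)+
  then have "0 < 16 * (?C ^ 2 * (?A * ?B * ?D))" unfolding cos_int_pi_squared by simp
  also have "\<dots> = line_form ?\<psi> v * line_form ?\<psi> w" unfolding V W by (simp only: power2_eq_square mult_ac)
  finally show ?thesis .
qed

section \<open>The elementary triangle around a given point\<close>

lemma sin_three_term: "sin (b - c) * sin (z - a) + sin (c - a) * sin (z - b) + sin (a - b) * sin (z - c) = 0" for a b c z :: real
  unfolding sin_diff by (simp add: algebra_simps)

lemma line_form_crossing_sum_zero:
  assumes "x + y + z = 0"
  shows "line_form \<psi> (crossing x y) = 4 * sin (x - \<psi>) * sin (y - \<psi>) * sin (z - \<psi>)"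
proof -
  have "x + y + \<psi> = - (z - \<psi>)" using assms by simp
  then show ?thesis unfolding line_form_crossing by (simp only: sin_minus minus_mult_minus)
qed

text \<open>If two of the lines through the point had the same index modulo \<open>d\<close>, their
  two factors would have a positive product, up to the common sign \<epsilon>, at each edge of the
  triangle. The third line alone would then have to decide all three sides, which
  \<open>sin_three_term\<close> forbids. This keeps the triangle obtained by rounding
  nondegenerate.\<close>

lemma in_triangle_zeros_in_distinct_cells:
  assumes d: "1 < d" and p: "proper a b c" and i: "in_triangle a b c (crossing x y)" and xyz: "x + y + z = 0"
    and a: "a = fam_angle d \<kappa> l1" and b: "b = fam_angle d \<kappa> l2" and c: "c = fam_angle d \<kappa> l3"
    and x: "x = fam_angle d \<kappa> l - of_int (sign_val s) * g" and y: "y = fam_angle d \<kappa> m - of_int (sign_val s) * h"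
    and g: "0 < g" "g < pi / of_nat d" and h: "0 < h" "h < pi / of_nat d"
  shows "\<not> [l = m] (mod int d)"
proof
  assume "[l = m] (mod int d)"
  then obtain q where q: "m = l + int d * q" using cong_iff_lin by metis
  have d0: "0 < d" using d by simp
  define y' where "y' = fam_angle d \<kappa> l - of_int (sign_val s) * h"
  have y': "y = y' + of_int q * pi" unfolding y y'_def q fam_angle_def using d0 by (simp add: field_simps)
  define \<epsilon> where "\<epsilon> = cos (of_int q * pi)"
  have siny: "sin (y - \<psi>) = \<epsilon> * sin (y' - \<psi>)" for \<psi>
    using sin_add_int_pi[of "y' - \<psi>" q] unfolding y' \<epsilon>_def by (simp add: algebra_simps)
  define P where "P \<psi> = sin (x - \<psi>) * sin (y' - \<psi>)" for \<psi>
  have pos: "0 < P a" "0 < P b" "0 < P c" unfolding P_def x y'_def a b c by (intro cell_sin_same_sign d0 g h)+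
  have line_form: "line_form \<psi> (crossing x y) = 4 * \<epsilon> * P \<psi> * sin (z - \<psi>)" for \<psi>
    unfolding line_form_crossing_sum_zero[OF xyz] siny P_def by simp
  define A B C where "A = sin (b - c)" and "B = sin (c - a)" and "C = sin (a - b)"
  have neg: "sin (c - b) = - A" "sin (a - c) = - B" "sin (b - a) = - C"
    unfolding A_def B_def C_def by (simp_all flip: sin_minus)
  define S where "S = \<epsilon> * sin (a + b + c)"
  have ha: "line_form a (crossing b c) = 4 * sin (a + b + c) * B * C"
    unfolding line_form_crossing neg B_def[symmetric] by (simp add: add_ac)
  have hb: "line_form b (crossing c a) = 4 * sin (a + b + c) * C * A"
    unfolding line_form_crossing neg C_def[symmetric] by (simp add: add_ac)
  have hc: "line_form c (crossing a b) = 4 * sin (a + b + c) * A * B"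
    unfolding line_form_crossing neg A_def[symmetric] by (simp add: add_ac)
  have pm: "0 < r" if "0 < (16 * t) * r" "0 < t" for t r :: real
    using that by (auto simp: zero_less_mult_iff)
  have 1: "0 < S * sin (z - a) * B * C" "0 < S * sin (z - b) * C * A" "0 < S * sin (z - c) * A * B"
  proof -
    show "0 < S * sin (z - a) * B * C"
      by (rule pm[of "P a"]) (use i pos in \<open>simp_all add: in_triangle_def line_form ha S_def mult_ac\<close>)
    show "0 < S * sin (z - b) * C * A"
      by (rule pm[of "P b"]) (use i pos in \<open>simp_all add: in_triangle_def line_form hb S_def mult_ac\<close>)
    show "0 < S * sin (z - c) * A * B"
      by (rule pm[of "P c"]) (use i pos in \<open>simp_all add: in_triangle_def line_form hc S_def mult_ac\<close>)
  qed
  have nz: "A \<noteq> 0" "B \<noteq> 0" "C \<noteq> 0" using p unfolding proper_def A_def B_def C_def by auto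
  \<comment> \<open>The weights turn the three positive quantities into a multiple of the left-hand
    side of \<open>sin_three_term\<close>.\<close>
  have "0 < A^2 * (S * sin (z - a) * B * C) + B^2 * (S * sin (z - b) * C * A) + C^2 * (S * sin (z - c) * A * B)"
    using 1 nz by (intro add_pos_pos mult_pos_pos[OF _ 1(1)] mult_pos_pos[OF _ 1(2)] mult_pos_pos[OF _ 1(3)]) simp_all
  also have "\<dots> = A * B * C * S * (A * sin (z - a) + B * sin (z - b) + C * sin (z - c))"
    by (simp add: power2_eq_square algebra_simps)
  also have "\<dots> = 0" using sin_three_term[of b c z a] unfolding A_def B_def C_def by simp
  finally show False by simp
qed

text \<open>Replacing the lines through the point by the lattice angles they are rounded to changes
  no sign, since the factors of the other two lines stay in their intervals. The factor of the edge
  itself is \<open>- sin g\<close>, and the sine of the angle sum is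
  \<open>sin (pi / of_nat d)\<close>, both up to the sign \<open>s\<close>.\<close>

lemma cell_corner_height:
  assumes d: "1 < d" and xyz: "x + y + z = 0"
    and g: "0 < g" "g < pi / of_nat d" "0 < h" "h < pi / of_nat d" "0 < k" "k < pi / of_nat d"
    and x: "x = fam_angle d \<kappa> l - of_int (sign_val s) * g" and y: "y = fam_angle d \<kappa> m - of_int (sign_val s) * h"
    and z: "z = fam_angle d \<kappa> n - of_int (sign_val s) * k"
    and lmn: "l + m + n = \<kappa> + sign_val s"
    and ne: "\<not> [m = l] (mod int d)" "\<not> [n = l] (mod int d)"
  shows "0 < line_form (fam_angle d \<kappa> l) (crossing x y) * line_form (fam_angle d \<kappa> l) (crossing (fam_angle d \<kappa> m) (fam_angle d \<kappa> n))"
proof -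
  have d0: "0 < d" using d by simp
  let ?a = "fam_angle d \<kappa> l" and ?b = "fam_angle d \<kappa> m" and ?c = "fam_angle d \<kappa> n" and ?\<sigma> = "real_of_int (sign_val s)"
  have sum: "?b + ?c + ?a = ?\<sigma> * pi / of_nat d"
  proof -
    have "m + n + l - \<kappa> = sign_val s" using lmn by simp
    then show ?thesis unfolding fam_angle_sum[OF d0] by simp
  qed
  have pd: "pi / of_nat d < pi" using d by (simp add: field_simps)
  have pos: "0 < sin g" "0 < sin (pi / of_nat d)" using g pd d by (auto intro!: sin_gt_zero)
  have xa: "sin (x - ?a) = - ?\<sigma> * sin g" unfolding x by (cases s) simp_all
  have S: "sin (?b + ?c + ?a) = ?\<sigma> * sin (pi / of_nat d)" unfolding sum by (cases s) simp_all
  have sq: "?\<sigma> * ?\<sigma> = 1" by (cases s) simp_all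
  have "line_form ?a (crossing x y) * line_form ?a (crossing ?b ?c) = 16 * (sin g * sin (pi / of_nat d)) *
      ((?\<sigma> * ?\<sigma>) * ((sin (?b - ?a) * sin (y - ?a)) * (sin (?c - ?a) * sin (z - ?a))))"
    unfolding line_form_crossing_sum_zero[OF xyz] line_form_crossing[of _ ?b ?c] xa S by (simp add: mult_ac)
  moreover have "0 < sin (?b - ?a) * sin (y - ?a)" "0 < sin (?c - ?a) * sin (z - ?a)"
    unfolding y z by (intro cell_sin_corner d0 g ne)+
  ultimately show ?thesis unfolding sq using pos by simp
qed

lemma exists_cell:
  assumes "0 < d"
  obtains i f where "0 \<le> f" "f < 1" "x = fam_angle d \<kappa> i + f * (pi / of_nat d)"
proof
  let ?t = "x * of_nat d / pi + of_int \<kappa> / 3"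
  show "0 \<le> frac ?t" "frac ?t < 1" by (simp_all add: frac_lt_1)
  have "fam_angle d \<kappa> \<lfloor>?t\<rfloor> + frac ?t * (pi / of_nat d) = (?t - of_int \<kappa> / 3) * (pi / of_nat d)"
    unfolding fam_angle_def frac_def using assms by (simp add: field_simps)
  also have "\<dots> = x" using assms by simp
  finally show "x = fam_angle d \<kappa> \<lfloor>?t\<rfloor> + frac ?t * (pi / of_nat d)" by simp
qed

lemma elementary_cell_exists:
  assumes d: "1 < d" and p: "proper a b c" and i: "in_triangle a b c v"
    and abc: "a = fam_angle d \<kappa> l1" "b = fam_angle d \<kappa> l2" "c = fam_angle d \<kappa> l3"
    and off: "\<And>\<nu>. line_form (fam_angle d \<kappa> \<nu>) v \<noteq> 0"
  obtains s a' b' c' where "elementary d \<kappa> s a' b' c'" "in_triangle a' b' c' v"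
proof -
  have d0: "0 < d" using d by simp
  obtain g1 g2 where "v = crossing (a - of_int (sign_val Minus) * g1) (b - of_int (sign_val Minus) * g2)"
    using in_triangle_signed_interlaced[OF p i, of Minus] by blast
  then obtain x y where v: "v = crossing x y" by blast
  define z where "z = - x - y"
  have xyz: "x + y + z = 0" "y + z + x = 0" "z + x + y = 0" by (simp_all add: z_def)
  have v': "v = crossing y z" "v = crossing z x" using crossing_third[OF xyz(1)] crossing_third[OF xyz(2)] v by auto
  have zero: "line_form x v = 0" "line_form y v = 0" "line_form z v = 0" using v v' by (metis line_form_crossing_self)+
  obtain lx fx where fx: "0 \<le> fx" "fx < 1" "x = fam_angle d \<kappa> lx + fx * (pi / of_nat d)" using exists_cell[OF d0] by blast
  obtain ly fy where fy: "0 \<le> fy" "fy < 1" "y = fam_angle d \<kappa> ly + fy * (pi / of_nat d)" using exists_cell[OF d0] by blast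
  obtain lz fz where fz: "0 \<le> fz" "fz < 1" "z = fam_angle d \<kappa> lz + fz * (pi / of_nat d)" using exists_cell[OF d0] by blast
  have "fx \<noteq> 0" "fy \<noteq> 0" "fz \<noteq> 0" using fx fy fz zero off by auto
  then have f0: "0 < fx" "0 < fy" "0 < fz" using fx fy fz by simp_all
  have pd: "0 < pi / of_nat d" using d0 by simp
  have "0 = (of_int (lx + ly + lz - \<kappa>) + (fx + fy + fz)) * (pi / of_nat d)"
  proof -
    have "x + y + z = (fam_angle d \<kappa> lx + fam_angle d \<kappa> ly + fam_angle d \<kappa> lz) + (fx + fy + fz) * (pi / of_nat d)"
      unfolding fx(3) fy(3) fz(3) by (simp only: distrib_right add_ac)
    then show ?thesis unfolding xyz(1) fam_angle_sum[OF d0]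
      by (simp only: distrib_right times_divide_eq_right add_divide_distrib)
  qed
  then have "of_int (lx + ly + lz - \<kappa>) + (fx + fy + fz) = 0" using pd by (metis less_irrefl mult_eq_0_iff)
  then have fs: "fx + fy + fz = of_int (\<kappa> - (lx + ly + lz))" by simp
  \<comment> \<open>The fractional parts add up to an integer strictly between 0 and 3. Sum 1 means
    index sum \<kappa> - 1: rounding down gives a \<open>Minus\<close> triangle. Sum 2 means index
    sum \<kappa> - 2, and rounding all three up gives \<kappa> + 1, a \<open>Plus\<close>
    triangle.\<close>
  have "0 < real_of_int (\<kappa> - (lx + ly + lz))" "real_of_int (\<kappa> - (lx + ly + lz)) < 3"
    using f0 fx fy fz unfolding fs[symmetric] by linarith+
  then have "\<kappa> - (lx + ly + lz) = 1 \<or> \<kappa> - (lx + ly + lz) = 2" by linarith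
  then obtain s l m n g h k where
    lmn: "l + m + n = \<kappa> + sign_val s" and
    g: "0 < g" "g < pi / of_nat d" and h: "0 < h" "h < pi / of_nat d" and k: "0 < k" "k < pi / of_nat d" and
    x: "x = fam_angle d \<kappa> l - of_int (sign_val s) * g" and y: "y = fam_angle d \<kappa> m - of_int (sign_val s) * h" and
    z: "z = fam_angle d \<kappa> n - of_int (sign_val s) * k"
  proof
    assume *: "\<kappa> - (lx + ly + lz) = 1"
    have 1: "f * (pi / of_nat d) < pi / of_nat d" if "f < 1" for f using mult_strict_right_mono[OF that pd] by (simp only: mult_1)
    have 4: "fam_angle d \<kappa> i - of_int (sign_val Minus) * g = fam_angle d \<kappa> i + g" for i g
      by simp
    show ?thesis
    proof (rule that[of lx ly lz Minus "fx * (pi / of_nat d)" "fy * (pi / of_nat d)" "fz * (pi / of_nat d)"])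
      show "lx + ly + lz = \<kappa> + sign_val Minus" using * by simp
    qed (simp_all only: 1 4 mult_pos_pos pd f0 fx(2) fy(2) fz(2) fx(3)[symmetric] fy(3)[symmetric] fz(3)[symmetric])
  next
    assume *: "\<kappa> - (lx + ly + lz) = 2"
    have 1: "(1 - f) * (pi / of_nat d) < pi / of_nat d" if "0 < f" for f
      using mult_strict_right_mono[of "1 - f" 1, OF _ pd] that by (simp only: mult_1)
    have 2: "0 < (1 - f) * (pi / of_nat d)" if "f < 1" for f using mult_pos_pos[OF _ pd, of "1 - f"] that by (simp only: diff_gt_0_iff_gt)
    have 3: "fam_angle d \<kappa> i + f * (pi / of_nat d) = fam_angle d \<kappa> (i + 1) - of_int (sign_val Plus) * ((1 - f) * (pi / of_nat d))" for i f
      using d0 by (simp add: fam_angle_def field_simps)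
    show ?thesis
    proof (rule that[of "lx + 1" "ly + 1" "lz + 1" Plus "(1 - fx) * (pi / of_nat d)" "(1 - fy) * (pi / of_nat d)" "(1 - fz) * (pi / of_nat d)"])
      show "lx + 1 + (ly + 1) + (lz + 1) = \<kappa> + sign_val Plus" using * by simp
    qed (simp_all only: 3[symmetric] fx(3)[symmetric] fy(3)[symmetric] fz(3)[symmetric] 1 2 f0 fx(2) fy(2) fz(2))
  qed
  let ?a = "fam_angle d \<kappa> l" and ?b = "fam_angle d \<kappa> m" and ?c = "fam_angle d \<kappa> n"
  have ne: "\<not> [l = m] (mod int d)" "\<not> [m = n] (mod int d)" "\<not> [n = l] (mod int d)"
    using in_triangle_zeros_in_distinct_cells[OF d p i[unfolded v] xyz(1) abc x y g h]
      in_triangle_zeros_in_distinct_cells[OF d p i[unfolded v'(1)] xyz(2) abc y z h k]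
      in_triangle_zeros_in_distinct_cells[OF d p i[unfolded v'(2)] xyz(3) abc z x k g] by blast+
  have ne': "\<not> [m = l] (mod int d)" "\<not> [n = m] (mod int d)" "\<not> [l = n] (mod int d)"
    using ne cong_sym by blast+
  have "elementary d \<kappa> s ?a ?b ?c"
    by (rule elementaryI[OF d ne]) (simp add: lmn)
  moreover have "in_triangle ?a ?b ?c v"
    unfolding in_triangle_def
    using cell_corner_height[OF d xyz(1) g h k x y z lmn ne'(1) ne(3)]
      cell_corner_height[OF d xyz(2) h k g y z x _ ne'(2) ne(1)]
      cell_corner_height[OF d xyz(3) k g h z x y _ ne'(3) ne(2)] lmn
    unfolding v[symmetric] v'[symmetric] by (simp add: add_ac)
  ultimately show thesis by (rule that)
qed

subsection \<open>Cutting a triangle by a family\<close>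

definition dissects :: "tile set \<Rightarrow> tile set \<Rightarrow> complex set \<Rightarrow> bool" where
  "dissects F C R \<longleftrightarrow> finite C \<and> (\<forall>X\<in>C. \<exists>T\<in>F. congruent_tile T X) \<and>
     (\<forall>X\<in>C. \<forall>Y\<in>C. X \<noteq> Y \<longrightarrow> interior (fst X) \<inter> interior (fst Y) = {}) \<and> (\<Union>X\<in>C. fst X) = R"

lemma seg_add_int_pi: "seg (a + of_int k * pi) = seg a"
proof -
  let ?c = "cos (of_int k * pi)"
  have s: "sin (of_int k * pi) = 0" by (simp add: sin_zero_iff_int2)
  have c: "cis (a + of_int k * pi) = ?c *\<^sub>R cis a"
    unfolding complex_eq_iff cis.simps scaleR_complex.simps sin_add cos_add s by simp
  have "- 2 * (a + of_int k * pi) = - 2 * a + 2 * pi * of_int (- k)" by (simp add: algebra_simps)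
  then have e: "cis (- 2 * (a + of_int k * pi)) = cis (- 2 * a)"
    using cis_multiple_2pi[of "of_int (- k)"] by (simp only: cis_mult[symmetric]) simp
  have "?c = 1 \<or> ?c = -1" using cos_int_pi_squared[of k] by (simp only: power2_eq_1_iff)
  then have "\<exists>f. f ` {-2..2} = {-2..2::real} \<and> (\<forall>t. t * ?c = f t)"
  proof
    assume "?c = 1" then show ?thesis by (intro exI[of _ "\<lambda>t. t"]) simp
  next
    assume "?c = -1" then show ?thesis by (intro exI[of _ "\<lambda>t. - t"]) simp
  qed
  then obtain f where f: "f ` {-2..2} = {-2..2::real}" "\<And>t. t * ?c = f t" by blast
  have "seg (a + of_int k * pi) = (\<lambda>t. cis (- 2 * a) + f t *\<^sub>R cis a) ` {-2..2}"
    unfolding seg_eq e c scaleR_scaleR f(2) ..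
  also have "\<dots> = (\<lambda>t. cis (- 2 * a) + t *\<^sub>R cis a) ` (f ` {-2..2})" by (simp only: image_image)
  finally show ?thesis unfolding f seg_eq .
qed

lemma fam_angle_mod:
  assumes "0 < d"
  shows "fam_angle d \<kappa> l = fam_angle d \<kappa> (l mod int d) + of_int (l div int d) * pi"
proof -
  have "l = l mod int d + int d * (l div int d)" by simp
  then have "real_of_int l = real_of_int (l mod int d) + of_nat d * real_of_int (l div int d)"
    by (metis of_int_add of_int_mult of_int_of_nat_eq)
  then show ?thesis unfolding fam_angle_def using assms by (simp add: field_simps)
qed

lemma finite_family:
  assumes "0 < d"
  shows "finite (family d \<kappa>)"
proof -
  have "seg (fam_angle d \<kappa> l) \<in> (\<lambda>\<nu>. seg (fam_angle d \<kappa> \<nu>)) ` {0..<int d}" for l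
    using fam_angle_mod[OF assms, of \<kappa> l] seg_add_int_pi assms by (metis atLeastLessThan_iff imageI of_nat_0_less_iff pos_mod_bound pos_mod_sign)
  then have "family d \<kappa> \<subseteq> (\<lambda>\<nu>. seg (fam_angle d \<kappa> \<nu>)) ` {0..<int d}" unfolding family_def by blast
  then show ?thesis by (rule finite_subset) simp
qed

lemma decorated_add_int_pi:
  "decorated d s (a + of_int i * pi) (b + of_int j * pi) (c + of_int k * pi) = decorated d s a b c"
proof -
  have "seg (x + of_int q * pi - y) = seg (x - y)" for x y q
    using seg_add_int_pi[of "x - y" q] by (simp add: algebra_simps)
  then show ?thesis unfolding decorated_def formed_triangle_def Let_def seg_add_int_pi by simp
qed

text \<open>Indices matter only modulo \<open>d\<close>: a shift of an angle by a multiple of pi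
  changes neither the triangle nor its decoration.\<close>

lemma finite_prototiles:
  assumes "0 < d"
  shows "finite (prototiles d)"
proof -
  let ?I = "{0..<int d}"
  let ?f = "\<lambda>(s, \<kappa>, l, m, n). decorated d s (fam_angle d \<kappa> l) (fam_angle d \<kappa> m) (fam_angle d \<kappa> n)"
  have fs: "finite (UNIV :: sign set)"
  proof -
    have "(UNIV :: sign set) = {Plus, Minus}" using sign.exhaust by auto
    then show ?thesis by (metis finite.emptyI finite_insert)
  qed
  have fk: "finite (fam_index d)" unfolding fam_index_def by simp
  have "prototiles d \<subseteq> ?f ` (UNIV \<times> fam_index d \<times> ?I \<times> ?I \<times> ?I)"
  proof
    fix T
    assume "T \<in> prototiles d"
    then obtain s \<kappa> l m n where k: "\<kappa> \<in> fam_index d"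
      and T: "T = decorated d s (fam_angle d \<kappa> l) (fam_angle d \<kappa> m) (fam_angle d \<kappa> n)"
      unfolding prototiles_def elementary_def by auto
    have "T = decorated d s (fam_angle d \<kappa> (l mod int d)) (fam_angle d \<kappa> (m mod int d)) (fam_angle d \<kappa> (n mod int d))"
      unfolding T fam_angle_mod[OF assms, of \<kappa> l] fam_angle_mod[OF assms, of \<kappa> m] fam_angle_mod[OF assms, of \<kappa> n]
        decorated_add_int_pi by simp
    then have "T = ?f (s, \<kappa>, l mod int d, m mod int d, n mod int d)" by simp
    moreover have "(s, \<kappa>, l mod int d, m mod int d, n mod int d) \<in> UNIV \<times> fam_index d \<times> ?I \<times> ?I \<times> ?I"
      using k assms by auto
    ultimately show "T \<in> ?f ` (UNIV \<times> fam_index d \<times> ?I \<times> ?I \<times> ?I)" by (rule image_eqI)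
  qed
  then show ?thesis by (rule finite_subset) (intro finite_imageI finite_cartesian_product fs fk finite_atLeastLessThan_int)
qed

lemma closed_seg: "closed (seg a)"
  unfolding seg_def by simp

lemma interior_seg: "interior (seg a) = {}"
  unfolding seg_def by (rule interior_closed_segment_ge2) simp

lemma closed_interior_Union_family:
  assumes "0 < d"
  shows "closed (\<Union>(family d \<kappa>)) \<and> interior (\<Union>(family d \<kappa>)) = {}"
proof -
  have "closed (\<Union>L) \<and> interior (\<Union>L) = {}" if "finite L" "L \<subseteq> range seg" for L
    using that
  proof (induction L)
    case (insert S L)
    then obtain a where S: "S = seg a" by blast
    have "closed (\<Union>L) \<and> interior (\<Union>L) = {}" using insert.IH insert.prems by blast
    then have L: "closed (\<Union>L)" "interior (\<Union>L) = {}" by blast+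
    have "interior (seg a \<union> \<Union>L) = {}"
      unfolding interior_closed_Un_empty_interior[OF closed_seg L(2)] by (rule interior_seg)
    then show ?case using closed_Un[OF closed_seg L(1)] unfolding S Union_insert by blast
  qed simp
  then show ?thesis using finite_family[OF assms] unfolding family_def by blast
qed

lemma subset_closure_diff:
  fixes U N :: "'a::topological_space set"
  assumes "open U" "interior N = {}"
  shows "U \<subseteq> closure (U - N)"
proof
  fix x assume x: "x \<in> U"
  show "x \<in> closure (U - N)"
  proof (rule ccontr)
    assume "x \<notin> closure (U - N)"
    then have "x \<in> U \<inter> - closure (U - N)" using x by blast
    moreover have "open (U \<inter> - closure (U - N))" using assms(1) by (intro open_Int open_Compl closed_closure)
    moreover have "U \<inter> - closure (U - N) \<subseteq> N" using closure_subset[of "U - N"] by blast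
    ultimately have "x \<in> interior N" using interior_maximal[of "U \<inter> - closure (U - N)" N] by (metis subsetD)
    then show False using assms(2) by simp
  qed
qed

text \<open>The triangle is cut by segments, whereas the line forms see whole lines. Inside a
  triangle formed by segments the two agree: the point is the crossing of three lines, a vanishing
  product makes \<psi> one of them modulo pi, and crossings lie on segments.\<close>

lemma in_triangle_on_line_in_seg:
  assumes "proper a b c" "in_triangle a b c v" "line_form \<psi> v = 0"
  shows "v \<in> seg \<psi>"
proof -
  obtain g1 g2 where "v = crossing (a - of_int (sign_val Minus) * g1) (b - of_int (sign_val Minus) * g2)"
    using in_triangle_signed_interlaced[OF assms(1,2), of Minus] by blast
  then obtain x y where v: "v = crossing x y" by blast
  define z where "z = - x - y"
  have xyz: "x + y + z = 0" "y + z + x = 0" by (simp_all add: z_def)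
  have v': "v = crossing y z" "v = crossing z x" using crossing_third[OF xyz(1)] crossing_third[OF xyz(2)] v by auto
  have *: "crossing r t \<in> seg \<psi>" if r0: "sin (r - \<psi>) = 0" for r t
  proof -
    obtain k where "r - \<psi> = of_int k * pi" using r0 unfolding sin_zero_iff_int2 by blast
    then have r: "r = \<psi> + of_int k * pi" by simp
    show ?thesis unfolding r crossing_add_int_pi by (rule crossing_in_seg1)
  qed
  have "sin (x - \<psi>) = 0 \<or> sin (y - \<psi>) = 0 \<or> sin (z - \<psi>) = 0"
    using assms(3) unfolding v line_form_crossing_sum_zero[OF xyz(1)] by simp
  then show ?thesis using * v v' by metis
qed

text \<open>The open elementary triangle around a point of the component is connected and misses the
  family, so it lies in the component. Its frontier consists of points of the family, so the
  connected component cannot leave it.\<close>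

lemma component_of_cut_triangle:
  assumes d: "1 < d" and p: "proper a b c"
    and abc: "a = fam_angle d \<kappa> l1" "b = fam_angle d \<kappa> l2" "c = fam_angle d \<kappa> l3"
    and K: "K \<in> components (interior (formed_triangle a b c) - \<Union>(family d \<kappa>))"
  obtains s a' b' c' where "elementary d \<kappa> s a' b' c'" "K = interior (formed_triangle a' b' c')"
proof -
  let ?S = "interior (formed_triangle a b c) - \<Union>(family d \<kappa>)"
  obtain v where v: "v \<in> K" using in_components_nonempty[OF K] by blast
  then have vS: "v \<in> ?S" using in_components_subset[OF K] by blast
  then have iv: "in_triangle a b c v" using interior_formed_triangle[OF p] by blast
  have off: "line_form (fam_angle d \<kappa> \<nu>) v \<noteq> 0" for \<nu>
    using in_triangle_on_line_in_seg[OF p iv, of "fam_angle d \<kappa> \<nu>"] vS unfolding family_def by blast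
  obtain s a' b' c' where e: "elementary d \<kappa> s a' b' c'" and i: "in_triangle a' b' c' v"
    using elementary_cell_exists[OF d p iv abc off] .
  note p' = elementary_imp_proper[OF d e]
  let ?E = "formed_triangle a' b' c'"
  have intE: "interior ?E = Collect (in_triangle a' b' c')" by (rule interior_formed_triangle[OF p'])
  have same: "0 < line_form (fam_angle d \<kappa> \<nu>) v * line_form (fam_angle d \<kappa> \<nu>) w" if "w \<in> interior ?E" for w \<nu>
    using elementary_same_side[OF d e i, of w] that intE by simp
  have "interior ?E \<subseteq> ?S"
  proof
    fix w assume w: "w \<in> interior ?E"
    \<comment> \<open>The edges of the large triangle belong to the family themselves, so no
      elementary triangle straddles them.\<close>
    have "in_triangle a b c w"
      using iv same[OF w, of l1] same[OF w, of l2] same[OF w, of l3] unfolding in_triangle_def abc[symmetric]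
      by (auto simp: zero_less_mult_iff)
    moreover have "w \<notin> \<Union>(family d \<kappa>)"
    proof
      assume "w \<in> \<Union>(family d \<kappa>)"
      then obtain \<nu> where "w \<in> seg (fam_angle d \<kappa> \<nu>)" unfolding family_def by blast
      then have "line_form (fam_angle d \<kappa> \<nu>) w = 0" by (rule line_form_seg)
      then show False using same[OF w, of \<nu>] by simp
    qed
    ultimately show "w \<in> ?S" using interior_formed_triangle[OF p] by blast
  qed
  moreover have "connected (interior ?E)"
    by (intro convex_connected convex_interior convex_formed_triangle)
  moreover have vE: "v \<in> interior ?E" using i intE by blast
  ultimately have 1: "interior ?E \<subseteq> K" using components_maximal[OF K] v by blast
  obtain l m n where abc': "a' = fam_angle d \<kappa> l" "b' = fam_angle d \<kappa> m" "c' = fam_angle d \<kappa> n"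
    using e unfolding elementary_def by blast
  have "frontier (interior ?E) \<subseteq> \<Union>(family d \<kappa>)"
    using frontier_interior_subset[of ?E] frontier_formed_triangle[OF p'] unfolding family_def abc' by blast
  then have "K \<inter> frontier (interior ?E) = {}" using in_components_subset[OF K] by blast
  then have "K - interior ?E = {}"
    using connected_Int_frontier[OF in_components_connected[OF K], of "interior ?E"] v vE by blast
  then have "K = interior ?E" using 1 by blast
  then show thesis using that e by blast
qed

lemma congruent_tile_refl: "congruent_tile T T"
  unfolding congruent_tile_def by (rule exI[of _ "\<lambda>x. x"]) (simp add: isometry_def map_tile_def)

text \<open>One decorated tile is chosen for each component, so that distinct tiles have disjoint
  interiors. They cover the triangle because the family is a finite union of segments with empty
  interior, and removing it leaves a dense subset of the open triangle.\<close>

lemma family_patch_dissects: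
  assumes d: "1 < d" and p: "proper a b c" and \<kappa>: "\<kappa> \<in> fam_index d"
    and abc: "a = fam_angle d \<kappa> l1" "b = fam_angle d \<kappa> l2" "c = fam_angle d \<kappa> l3"
  shows "\<exists>C \<subseteq> family_patch d \<kappa> (formed_triangle a b c). dissects (prototiles d) C (formed_triangle a b c)"
proof -
  have d0: "0 < d" using d by simp
  let ?t = "formed_triangle a b c"
  let ?S = "interior ?t - \<Union>(family d \<kappa>)"
  have "\<exists>X. X \<in> family_patch d \<kappa> ?t \<and> X \<in> prototiles d \<and> fst X = closure K \<and> interior (fst X) = K"
    if K: "K \<in> components ?S" for K
  proof -
    obtain s a' b' c' where e: "elementary d \<kappa> s a' b' c'" and Ke: "K = interior (formed_triangle a' b' c')"
      using component_of_cut_triangle[OF d p abc K] .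
    note p' = elementary_imp_proper[OF d e]
    have cl: "closure K = formed_triangle a' b' c'"
      unfolding Ke using convex_closure_interior[OF convex_formed_triangle formed_triangle_interior_nonempty[OF p']]
        closed_formed_triangle[OF p'] by (simp add: closure_closed)
    let ?X = "decorated d s a' b' c'"
    have f: "fst ?X = formed_triangle a' b' c'" unfolding decorated_def Let_def by simp
    have "formed_triangle a' b' c' \<in> cut_pieces (family d \<kappa>) ?t" unfolding cut_pieces_def using K cl by blast
    then have "?X \<in> family_patch d \<kappa> ?t" unfolding family_patch_def using e by blast
    moreover have "?X \<in> prototiles d" unfolding prototiles_def using e \<kappa> by blast
    ultimately show ?thesis using f cl Ke by metis
  qed
  then obtain X where X: "\<And>K. K \<in> components ?S \<Longrightarrow> X K \<in> family_patch d \<kappa> ?t \<and> X K \<in> prototiles d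
      \<and> fst (X K) = closure K \<and> interior (fst (X K)) = K" by metis
  let ?C = "X ` components ?S"
  have "?C \<subseteq> prototiles d" using X by blast
  then have fin: "finite ?C" using finite_prototiles[OF d0] by (rule finite_subset)
  have "(\<Union>Y\<in>?C. fst Y) = ?t"
  proof
    have "fst Y \<subseteq> ?t" if Y: "Y \<in> ?C" for Y
    proof -
      obtain K where K: "K \<in> components ?S" "fst Y = closure K" using X Y by blast
      have "K \<subseteq> ?t" using in_components_subset[OF K(1)] interior_subset[of ?t] by blast
      then show ?thesis unfolding K(2) by (rule closure_minimal[OF _ closed_formed_triangle[OF p]])
    qed
    then show "(\<Union>Y\<in>?C. fst Y) \<subseteq> ?t" by blast
    have cl: "closed (\<Union>Y\<in>?C. fst Y)"
    proof (rule closed_UN[OF fin])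
      show "\<forall>Y\<in>?C. closed (fst Y)"
      proof
        fix Y assume "Y \<in> ?C"
        then obtain K where "fst Y = closure K" using X by blast
        then show "closed (fst Y)" by (simp only: closed_closure)
      qed
    qed
    have "?S \<subseteq> (\<Union>Y\<in>?C. fst Y)"
    proof
      fix v assume "v \<in> ?S"
      then obtain K where K: "K \<in> components ?S" "v \<in> K" using Union_components[of ?S] by blast
      then have "v \<in> fst (X K)" using X[OF K(1)] closure_subset[of K] by blast
      then show "v \<in> (\<Union>Y\<in>?C. fst Y)" using K by blast
    qed
    then have "closure ?S \<subseteq> (\<Union>Y\<in>?C. fst Y)" by (rule closure_minimal[OF _ cl])
    then have "interior ?t \<subseteq> (\<Union>Y\<in>?C. fst Y)"
      using subset_closure_diff[OF open_interior closed_interior_Union_family[OF d0, THEN conjunct2], of ?t]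
      by (rule order_trans[rotated])
    then have "closure (interior ?t) \<subseteq> (\<Union>Y\<in>?C. fst Y)" by (rule closure_minimal[OF _ cl])
    moreover have "?t \<subseteq> closure (interior ?t)"
      unfolding convex_closure_interior[OF convex_formed_triangle formed_triangle_interior_nonempty[OF p]]
      by (rule closure_subset)
    ultimately show "?t \<subseteq> (\<Union>Y\<in>?C. fst Y)" by (rule order_trans[rotated])
  qed
  moreover have "interior (fst Y) \<inter> interior (fst Z) = {}" if YZ: "Y \<in> ?C" "Z \<in> ?C" "Y \<noteq> Z" for Y Z
  proof -
    obtain K where K: "K \<in> components ?S" "Y = X K" using YZ(1) by blast
    obtain L where L: "L \<in> components ?S" "Z = X L" using YZ(2) by blast
    have "K \<noteq> L" using YZ(3) K(2) L(2) by blast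
    then have "K \<inter> L = {}" using components_nonoverlap[OF K(1) L(1)] by (simp only: simp_thms)
    moreover have "interior (fst (X K)) = K" "interior (fst (X L)) = L" using X[OF K(1)] X[OF L(1)] by blast+
    ultimately show ?thesis unfolding K(2) L(2) by metis
  qed
  moreover have "\<exists>T\<in>prototiles d. congruent_tile T Y" if "Y \<in> ?C" for Y
  proof -
    have "Y \<in> prototiles d" using that X by blast
    then show ?thesis using congruent_tile_refl by (rule bexI[rotated])
  qed
  ultimately have "dissects (prototiles d) ?C ?t" unfolding dissects_def using fin
    by (intro conjI ballI impI) assumption+
  then show ?thesis using X by blast
qed

subsection \<open>Isometries and inflation\<close>

lemma isometryE:
  assumes "isometry f"
  obtains L where "orthogonal_transformation L" "f = (\<lambda>z. L z + f 0)"
proof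
  have "dist (f x - f 0) (f y - f 0) = dist x y" for x y
    using assms by (simp add: isometry_def dist_norm)
  then show "orthogonal_transformation (\<lambda>z. f z - f 0)"
    unfolding orthogonal_transformation_isometry by simp
  show "f = (\<lambda>z. (f z - f 0) + f 0)" by simp
qed

lemma isometry_id: "isometry (\<lambda>x. x)"
  by (simp add: isometry_def)

lemma isometry_compose: "isometry f \<Longrightarrow> isometry g \<Longrightarrow> isometry (f \<circ> g)"
  by (simp add: isometry_def)

lemma isometry_bij:
  assumes "isometry f"
  shows "bij f"
proof -
  obtain L where L: "orthogonal_transformation L" "f = (\<lambda>z. L z + f 0)" using isometryE[OF assms] .
  have "bij ((\<lambda>z. z + f 0) \<circ> L)"
    by (rule bij_comp[OF orthogonal_transformation_bij[OF L(1)] bij_plus_right])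
  then show ?thesis using L(2) by (simp add: comp_def)
qed

lemma isometry_inv:
  assumes "isometry f"
  shows "isometry (inv f)"
proof -
  have "dist (inv f x) (inv f y) = dist (f (inv f x)) (f (inv f y))" for x y
    using assms unfolding isometry_def by simp
  then show ?thesis using bij_is_surj[OF isometry_bij[OF assms]] unfolding isometry_def by (simp add: surj_f_inv_f)
qed

lemma isometry_interior:
  assumes "isometry f"
  shows "interior (f ` S) = f ` interior S"
proof -
  obtain L where L: "orthogonal_transformation L" "f = (\<lambda>z. L z + f 0)" using isometryE[OF assms] .
  have e: "f ` T = (\<lambda>z. f 0 + z) ` (L ` T)" for T
    unfolding image_image by (subst L(2)) (simp add: add.commute)
  have "interior (L ` S) = L ` interior S"
    by (intro interior_bijective_linear_image orthogonal_transformation_linear orthogonal_transformation_bij L)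
  then show ?thesis unfolding e interior_translation by simp
qed

lemma direct_isometry_imp_isometry: "direct_isometry h \<Longrightarrow> isometry h"
  unfolding direct_isometry_def isometry_def
  by (auto simp: dist_norm norm_mult simp flip: right_diff_distrib)

lemma isometry_cnj: "isometry cnj"
  unfolding isometry_def dist_norm by (metis complex_cnj_diff complex_mod_cnj)

lemma isometry_inflated:
  assumes "0 < c" "isometry f"
  shows "isometry (inflated c f)"
  using assms unfolding isometry_def inflated_def
  by (simp add: dist_norm flip: scaleR_diff_right)

lemma inflated_compose: "0 < c \<Longrightarrow> inflated c f \<circ> inflated c g = inflated c (f \<circ> g)"
  by (auto simp: inflated_def)

lemma inflated_mult: "0 < c \<Longrightarrow> 0 < c' \<Longrightarrow> inflated c (inflated c' f) = inflated (c * c') f"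
  by (auto simp: inflated_def mult.commute)

lemma inflated_image: "0 < c \<Longrightarrow> inflated c f ` ((*\<^sub>R) c ` S) = (*\<^sub>R) c ` (f ` S)"
  by (auto simp: inflated_def image_image)

lemma map_tile_compose: "map_tile f (map_tile g X) = map_tile (f \<circ> g) X"
  by (simp add: map_tile_def image_comp)

lemma map_tile_id [simp]: "map_tile (\<lambda>z. z) X = X" "map_tile id X = X"
  by (simp_all add: map_tile_def)

lemma map_tile_inv: "bij f \<Longrightarrow> map_tile (inv f) (map_tile f X) = X" "bij f \<Longrightarrow> map_tile f (map_tile (inv f) X) = X"
  by (simp_all add: map_tile_compose inv_o_cancel bij_is_inj surj_iff[THEN iffD1] bij_is_surj)

lemma fst_map_tile [simp]: "fst (map_tile f X) = f ` fst X"
  by (simp add: map_tile_def)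

lemma congruent_tile_map: "congruent_tile T X \<Longrightarrow> isometry f \<Longrightarrow> congruent_tile T (map_tile f X)"
  unfolding congruent_tile_def using isometry_compose map_tile_compose by metis

lemma dissects_map:
  assumes f: "isometry f" and C: "dissects F C R"
  shows "dissects F (map_tile f ` C) (f ` R)"
proof -
  have inj: "inj f" using isometry_bij[OF f] by (rule bij_is_inj)
  have "interior (fst (map_tile f X)) \<inter> interior (fst (map_tile f Y)) = {}"
    if "X \<in> C" "Y \<in> C" "map_tile f X \<noteq> map_tile f Y" for X Y
  proof -
    have "X \<noteq> Y" using that(3) by blast
    then have "interior (fst X) \<inter> interior (fst Y) = {}" using C that unfolding dissects_def by blast
    then show ?thesis unfolding fst_map_tile isometry_interior[OF f] image_Int[OF inj, symmetric] by simp
  qed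
  moreover have "(\<Union>X\<in>map_tile f ` C. fst X) = f ` R"
    using C unfolding dissects_def by auto
  moreover have "finite (map_tile f ` C)" using C unfolding dissects_def by blast
  moreover have "\<exists>T\<in>F. congruent_tile T X" if "X \<in> map_tile f ` C" for X
    using that C congruent_tile_map[OF _ f] unfolding dissects_def by blast
  ultimately show ?thesis unfolding dissects_def by blast
qed

lemma inflate_patch_mono: "P \<subseteq> Q \<Longrightarrow> inflate_patch d p R P \<subseteq> inflate_patch d p R Q"
  unfolding inflate_patch_def by blast

lemma inflate_patch_map:
  assumes c: "0 < iota d p" and g: "isometry g"
  shows "map_tile (inflated (iota d p) g) ` inflate_patch d p R P \<subseteq> inflate_patch d p R (map_tile g ` P)"
proof
  fix Z assume "Z \<in> map_tile (inflated (iota d p) g) ` inflate_patch d p R P"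
  then obtain f T Y where Z: "Z = map_tile (inflated (iota d p) g) (map_tile (inflated (iota d p) f) Y)"
    and *: "T \<in> prototiles d" "isometry f" "map_tile f T \<in> P" "Y \<in> R T"
    unfolding inflate_patch_def by blast
  have "Z = map_tile (inflated (iota d p) (g \<circ> f)) Y" unfolding Z map_tile_compose inflated_compose[OF c] ..
  moreover have "map_tile (g \<circ> f) T \<in> map_tile g ` P" using *(3) map_tile_compose by (metis imageI)
  ultimately show "Z \<in> inflate_patch d p R (map_tile g ` P)"
    unfolding inflate_patch_def using * isometry_compose[OF g *(2)] by blast
qed

lemma inflate_patch_dissects:
  assumes c: "0 < iota d p" and T: "T \<in> prototiles d" and f: "isometry f"
    and C: "C \<subseteq> R T" "dissects F C ((*\<^sub>R) (iota d p) ` fst T)"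
  shows "\<exists>C'\<subseteq>inflate_patch d p R {map_tile f T}. dissects F C' ((*\<^sub>R) (iota d p) ` fst (map_tile f T))"
proof -
  let ?C = "map_tile (inflated (iota d p) f) ` C"
  have "?C \<subseteq> inflate_patch d p R {map_tile f T}" unfolding inflate_patch_def using C(1) T f by blast
  moreover have "dissects F ?C ((*\<^sub>R) (iota d p) ` fst (map_tile f T))"
    using dissects_map[OF isometry_inflated[OF c f] C(2)] unfolding inflated_image[OF c] fst_map_tile .
  ultimately show ?thesis by blast
qed

subsection \<open>The positive inflation rule\<close>

text \<open>Prescribing \<open>3 * \<theta>\<close> modulo pi leaves a multiple of pi / 3 free in
  \<theta>, which is used to land in a family. If 3 divides \<open>d\<close>, the values -2, 0, 2 of
  \<kappa>' represent all residues modulo 3; otherwise \<open>d\<close> is invertible modulo 3 and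
  \<open>k\<close> makes the adjustment.\<close>

lemma fam_index_shift:
  assumes d: "0 < d" and \<kappa>: "\<kappa> \<in> fam_index d"
  obtains \<kappa>' k where "\<kappa>' \<in> fam_index d"
    "\<And>l. \<exists>l'. fam_angle d \<kappa> l + (of_int r * pi / of_nat d + of_int k * pi) / 3 = fam_angle d \<kappa>' l'"
proof -
  have "\<exists>\<kappa>'\<in>fam_index d. \<exists>k. 3 dvd (r + k * int d - \<kappa> + \<kappa>')"
  proof (cases "3 dvd d")
    case True
    have "3 dvd (r - \<kappa> + -2) \<or> 3 dvd (r - \<kappa> + 0) \<or> 3 dvd (r - \<kappa> + 2)" by presburger
    then obtain \<kappa>' where "\<kappa>' \<in> {-2, 0, 2}" "3 dvd (r - \<kappa> + \<kappa>')" by blast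
    then show ?thesis using True unfolding fam_index_def
      by (intro bexI[of _ \<kappa>'] exI[of _ 0]) simp_all
  next
    case False
    have "\<kappa> = 0" using False \<kappa> by (simp add: fam_index_def)
    have "\<not> 3 dvd int d" using False by presburger
    then have "3 dvd (r + (- r) * int d) \<or> 3 dvd (r + r * int d)"
    proof -
      have "int d mod 3 = 1 \<or> int d mod 3 = 2" using \<open>\<not> 3 dvd int d\<close> by presburger
      then obtain q where "int d = 3 * q + 1 \<or> int d = 3 * q + 2" by (metis mult_div_mod_eq)
      then have "r + (- r) * int d = 3 * (- r * q) \<or> r + r * int d = 3 * (r * q + r)" by (auto simp: algebra_simps)
      then show ?thesis by (metis dvd_triv_left)
    qed
    then obtain k where "3 dvd (r + k * int d)" by blast
    then show ?thesis using False \<open>\<kappa> = 0\<close> unfolding fam_index_def by auto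
  qed
  then obtain \<kappa>' k q where k: "\<kappa>' \<in> fam_index d" "r + k * int d - \<kappa> + \<kappa>' = 3 * q" by (auto elim: dvdE)
  have "fam_angle d \<kappa> l + (of_int r * pi / of_nat d + of_int k * pi) / 3 = fam_angle d \<kappa>' (l + q)" for l
  proof -
    have "3 * (l + q) - \<kappa>' = 3 * l - \<kappa> + r + k * int d" using k(2) by simp
    then have "real_of_int (3 * (l + q) - \<kappa>') = real_of_int (3 * l - \<kappa>) + of_int r + of_int k * of_nat d"
      by (metis of_int_add of_int_mult of_int_of_nat_eq)
    then show ?thesis unfolding fam_angle_def using d by (simp only:) (simp add: field_simps)
  qed
  then show thesis using that k(1) by blast
qed

text \<open>By \<open>crossing_diff\<close> the common shift turns every side by \<theta> and
  multiplies it by the quotient of the sines of the angle sums; \<open>u\<close> undoes the turn,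
  and \<epsilon> records a possible half turn.\<close>

lemma direct_isometry_between_triangles:
  assumes S: "\<rho> * sin (a + b + c) = \<epsilon> * sin (a + b + c + 3 * \<theta>)" and \<epsilon>: "\<bar>\<epsilon>\<bar> = 1"
  obtains h where "direct_isometry h"
    "h (crossing (a + \<theta>) (b + \<theta>)) = \<rho> *\<^sub>R crossing a b" "h (crossing (b + \<theta>) (c + \<theta>)) = \<rho> *\<^sub>R crossing b c"
    "h (crossing (c + \<theta>) (a + \<theta>)) = \<rho> *\<^sub>R crossing c a"
proof -
  define u where "u = of_real \<epsilon> * cis (- \<theta>)"
  define h where "h z = u * z + (\<rho> *\<^sub>R crossing a b - u * crossing (a + \<theta>) (b + \<theta>))" for z
  have "cmod u = 1" unfolding u_def norm_mult using \<epsilon> by simp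
  then have dir: "direct_isometry h" unfolding direct_isometry_def h_def by blast
  have diff: "u * (crossing (x + \<theta>) (y + \<theta>) - crossing (x + \<theta>) (z + \<theta>)) = \<rho> *\<^sub>R (crossing x y - crossing x z)"
    if "x + y + z = a + b + c" for x y z
  proof -
    have 1: "x + \<theta> + (y + \<theta>) + (z + \<theta>) = a + b + c + 3 * \<theta>" "z + \<theta> - (y + \<theta>) = z - y" using that by simp_all
    have "u * (crossing (x + \<theta>) (y + \<theta>) - crossing (x + \<theta>) (z + \<theta>))
      = of_real (4 * (\<epsilon> * sin (a + b + c + 3 * \<theta>)) * sin (z - y)) * (cis (- \<theta>) * cis (x + \<theta>))"
      unfolding crossing_diff 1 u_def by (simp add: mult_ac del: cis_mult)
    also have "\<dots> = of_real (4 * (\<rho> * sin (a + b + c)) * sin (z - y)) * cis x"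
      unfolding S[symmetric] cis_mult by simp
    also have "\<dots> = \<rho> *\<^sub>R (crossing x y - crossing x z)" unfolding crossing_diff that scaleR_conv_of_real by (simp add: mult_ac)
    finally show ?thesis .
  qed
  have ab: "h (crossing (a + \<theta>) (b + \<theta>)) = \<rho> *\<^sub>R crossing a b" unfolding h_def by simp
  have "h (crossing (c + \<theta>) (a + \<theta>)) = \<rho> *\<^sub>R crossing c a"
  proof -
    have "h (crossing (a + \<theta>) (b + \<theta>)) - h (crossing (a + \<theta>) (c + \<theta>)) = \<rho> *\<^sub>R (crossing a b - crossing a c)"
      using diff[of a b c] unfolding h_def by (simp add: right_diff_distrib)
    then show ?thesis unfolding ab by (simp add: scaleR_diff_right crossing_commute)
  qed
  moreover have "h (crossing (b + \<theta>) (c + \<theta>)) = \<rho> *\<^sub>R crossing b c"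
  proof -
    have "h (crossing (b + \<theta>) (a + \<theta>)) - h (crossing (b + \<theta>) (c + \<theta>)) = \<rho> *\<^sub>R (crossing b a - crossing b c)"
      using diff[of b a c] unfolding h_def by (simp add: right_diff_distrib)
    then show ?thesis using ab by (simp add: scaleR_diff_right crossing_commute)
  qed
  ultimately show thesis using that dir ab by blast
qed

lemma isometry_convex_hull:
  assumes "isometry f"
  shows "f ` (convex hull S) = convex hull (f ` S)"
proof -
  obtain L where L: "orthogonal_transformation L" "f = (\<lambda>z. L z + f 0)" using isometryE[OF assms] .
  have e: "f ` T = (\<lambda>z. f 0 + z) ` (L ` T)" for T
    unfolding image_image by (subst L(2)) (simp add: add.commute)
  show ?thesis unfolding e convex_hull_translation
    by (simp only: convex_hull_linear_image[OF orthogonal_transformation_linear[OF L(1)]])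
qed

lemma iota_ge:
  assumes "4 < d" "p \<in> {2..d div 2}"
  shows "1 < iota d p" "sin (of_nat p * pi / of_nat d) \<noteq> 0"
proof -
  have d: "0 < real d" using assms by simp
  have "2 * p \<le> d" "2 \<le> p" using assms by auto
  then have p: "2 * real p \<le> real d" "2 \<le> real p" by linarith+
  have "sin (pi / of_nat d) < sin (of_nat p * pi / of_nat d)"
  proof (rule sin_monotone_2pi)
    show "- (pi / 2) \<le> pi / of_nat d" using d by (simp add: order_trans[of _ 0])
    show "pi / of_nat d < of_nat p * pi / of_nat d" using d p by (simp add: divide_strict_right_mono)
    show "of_nat p * pi / of_nat d \<le> pi / 2"
      using d mult_right_mono[OF p(1), of pi] by (simp add: field_simps)
  qed
  moreover have "0 < sin (pi / of_nat d)"
    using assms by (intro sin_gt_zero) (simp_all add: divide_less_eq)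
  ultimately show "1 < iota d p" "sin (of_nat p * pi / of_nat d) \<noteq> 0" unfolding iota_def by simp_all
qed

lemma iota_one: "1 < d \<Longrightarrow> iota d 1 = 1"
proof -
  assume "1 < d"
  then have "0 < sin (pi / of_nat d)"
    by (intro sin_gt_zero) (simp_all add: divide_less_eq)
  then show ?thesis unfolding iota_def by simp
qed

lemma sign_cases: "of_int (sign_val s) = (1::real) \<or> of_int (sign_val s) = (-1::real)"
  by (cases s) simp_all

text \<open>
  The case \<^term>\<open>p = (1::nat)\<close> has ratio 1 and reverses the sign; it produces the tile with reversed decoration
  that the rule for the sign \<^const>\<open>Minus\<close> asks for.
\<close>

lemma shifted_triangle:
  fixes p :: nat
  assumes d: "1 < d" and \<kappa>: "\<kappa> \<in> fam_index d" and e: "elementary d \<kappa> s a b c"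
    and p: "sin (of_nat p * pi / of_nat d) \<noteq> 0"
  obtains \<kappa>' \<theta> l m n h k where "\<kappa>' \<in> fam_index d"
    "3 * \<theta> = - of_int (sign_val s) * (of_nat p + 1) * pi / of_nat d + of_int k * pi"
    "a + \<theta> = fam_angle d \<kappa>' l" "b + \<theta> = fam_angle d \<kappa>' m" "c + \<theta> = fam_angle d \<kappa>' n"
    "proper (a + \<theta>) (b + \<theta>) (c + \<theta>)" "direct_isometry h"
    "h (crossing (a + \<theta>) (b + \<theta>)) = iota d p *\<^sub>R crossing a b" "h (crossing (b + \<theta>) (c + \<theta>)) = iota d p *\<^sub>R crossing b c"
    "h (crossing (c + \<theta>) (a + \<theta>)) = iota d p *\<^sub>R crossing c a"
proof -
  have d0: "0 < d" using d by simp
  let ?\<sigma> = "real_of_int (sign_val s)"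
  obtain \<kappa>' k where \<kappa>': "\<kappa>' \<in> fam_index d"
    and sh: "\<And>l. \<exists>l'. fam_angle d \<kappa> l + (of_int (- sign_val s * (int p + 1)) * pi / of_nat d + of_int k * pi) / 3 = fam_angle d \<kappa>' l'"
    using fam_index_shift[OF d0 \<kappa>, of "- sign_val s * (int p + 1)"] by blast
  define \<theta> where "\<theta> = (of_int (- sign_val s * (int p + 1)) * pi / of_nat d + of_int k * pi) / 3"
  obtain l m n where abc: "a = fam_angle d \<kappa> l" "b = fam_angle d \<kappa> m" "c = fam_angle d \<kappa> n"
    using e unfolding elementary_def by blast
  obtain l' m' n' where abc': "a + \<theta> = fam_angle d \<kappa>' l'" "b + \<theta> = fam_angle d \<kappa>' m'" "c + \<theta> = fam_angle d \<kappa>' n'"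
    using sh unfolding abc \<theta>_def by blast
  have th: "3 * \<theta> = - ?\<sigma> * (of_nat p + 1) * pi / of_nat d + of_int k * pi"
    unfolding \<theta>_def by simp
  obtain j where j: "a + b + c = ?\<sigma> * pi / of_nat d + of_int j * pi" using elementary_sum[OF d e] .
  \<comment> \<open>The summand \<open>of_nat p + 1\<close> in \<theta> is chosen for this: modulo
    pi, the angle sum pi / d times the sign becomes p pi / d times the opposite sign, and the
    quotient of the sines is the inflation factor up to sign.\<close>
  have S': "a + b + c + 3 * \<theta> = - (?\<sigma> * (of_nat p * pi / of_nat d)) + of_int (j + k) * pi"
    unfolding j th using d0 by (simp add: field_simps)
  have sinS: "sin (a + b + c) = cos (of_int j * pi) * (?\<sigma> * sin (pi / of_nat d))"
    unfolding j sin_add_int_pi using sign_cases[of s] by auto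
  have sinS': "sin (a + b + c + 3 * \<theta>) = - cos (of_int (j + k) * pi) * (?\<sigma> * sin (of_nat p * pi / of_nat d))"
    unfolding S' sin_add_int_pi using sign_cases[of s] by auto
  have c1: "cos (of_int i * pi) = 1 \<or> cos (of_int i * pi) = -1" for i
    using cos_int_pi_squared[of i] by (simp only: power2_eq_1_iff)
  have "0 < sin (pi / of_nat d)" using d by (intro sin_gt_zero) (simp_all add: divide_less_eq)
  then have "iota d p * sin (a + b + c) = cos (of_int j * pi) * (?\<sigma> * sin (of_nat p * pi / of_nat d))"
    unfolding iota_def sinS by simp
  also have "\<dots> = (- cos (of_int j * pi) * cos (of_int (j + k) * pi)) * sin (a + b + c + 3 * \<theta>)"
  proof -
    have "x * y = (- x * z) * (- z * y)" if "z ^ 2 = 1" for x y z :: real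
    proof -
      have "(- x * z) * (- z * y) = z ^ 2 * (x * y)" by (simp add: power2_eq_square)
      then show ?thesis using that by simp
    qed
    then show ?thesis unfolding sinS' using cos_int_pi_squared[of "j + k"] by blast
  qed
  finally have S: "iota d p * sin (a + b + c) = (- cos (of_int j * pi) * cos (of_int (j + k) * pi)) * sin (a + b + c + 3 * \<theta>)" .
  have \<epsilon>: "\<bar>- cos (of_int j * pi) * cos (of_int (j + k) * pi)\<bar> = 1"
  proof -
    have "\<bar>cos (of_int i * pi)\<bar> = 1" for i using cos_int_pi_squared[of i] by (simp only: abs_square_eq_1)
    then show ?thesis by (simp only: abs_mult abs_minus_cancel mult_1)
  qed
  have "proper (a + \<theta>) (b + \<theta>) (c + \<theta>)"
  proof -
    have "a + \<theta> + (b + \<theta>) + (c + \<theta>) = a + b + c + 3 * \<theta>" by simp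
    moreover have "sin (a + b + c + 3 * \<theta>) \<noteq> 0" unfolding sinS' using p c1[of "j + k"] sign_cases[of s] by auto
    ultimately have "sin (a + \<theta> + (b + \<theta>) + (c + \<theta>)) \<noteq> 0" by (simp only: not_False_eq_True)
    then show ?thesis using elementary_imp_proper[OF d e] unfolding proper_def by (simp only: add_diff_cancel_right simp_thms)
  qed
  then show thesis
    using direct_isometry_between_triangles[OF S \<epsilon>] that[OF \<kappa>' th abc'] by blast
qed

lemma Phi_plus_dissects:
  assumes d: "4 < d" and p: "p \<in> {2..d div 2}" and T: "T \<in> prototiles d"
  shows "\<exists>C \<subseteq> Phi_plus d p T. dissects (prototiles d) C ((*\<^sub>R) (iota d p) ` fst T)"
proof -
  have d1: "1 < d" using d by simp
  obtain s a b c \<kappa> where Td: "T = decorated d s a b c" and \<kappa>: "\<kappa> \<in> fam_index d" and e: "elementary d \<kappa> s a b c"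
    using T unfolding prototiles_def by blast
  obtain \<kappa>' \<theta> l m n h k where \<kappa>': "\<kappa>' \<in> fam_index d"
    and th: "3 * \<theta> = - of_int (sign_val s) * (of_nat p + 1) * pi / of_nat d + of_int k * pi"
    and abc': "a + \<theta> = fam_angle d \<kappa>' l" "b + \<theta> = fam_angle d \<kappa>' m" "c + \<theta> = fam_angle d \<kappa>' n"
    and pr': "proper (a + \<theta>) (b + \<theta>) (c + \<theta>)" and h: "direct_isometry h"
    and hv: "h (crossing (a + \<theta>) (b + \<theta>)) = iota d p *\<^sub>R crossing a b" "h (crossing (b + \<theta>) (c + \<theta>)) = iota d p *\<^sub>R crossing b c"
    "h (crossing (c + \<theta>) (a + \<theta>)) = iota d p *\<^sub>R crossing c a"
    by (rule shifted_triangle[OF d1 \<kappa> e iota_ge(2)[OF d p]])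
  let ?t = "formed_triangle (a + \<theta>) (b + \<theta>) (c + \<theta>)"
  note pr = elementary_imp_proper[OF d1 e]
  obtain C where C: "C \<subseteq> family_patch d \<kappa>' ?t" "dissects (prototiles d) C ?t"
    using family_patch_dissects[OF d1 pr' \<kappa>' abc'] by blast
  have cong: "[3 * \<theta> = - of_int (sign_val s) * (of_nat p + 1) * pi / of_nat d] (rmod pi)"
    using rcong_altdef rcong_sym th by blast
  have fam: "seg (a + \<theta>) \<in> family d \<kappa>'" "seg (b + \<theta>) \<in> family d \<kappa>'" "seg (c + \<theta>) \<in> family d \<kappa>'"
    unfolding family_def abc' by blast+
  have segs: "h ` (seg (a + \<theta>) \<inter> seg (b + \<theta>)) = (*\<^sub>R) (iota d p) ` (seg a \<inter> seg b)"
    "h ` (seg (b + \<theta>) \<inter> seg (c + \<theta>)) = (*\<^sub>R) (iota d p) ` (seg b \<inter> seg c)"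
    "h ` (seg (c + \<theta>) \<inter> seg (a + \<theta>)) = (*\<^sub>R) (iota d p) ` (seg c \<inter> seg a)"
    using pr pr' hv unfolding proper_def by (simp_all add: seg_Int)
  have "map_tile h ` C \<subseteq> Phi_plus d p T"
    unfolding Phi_plus_def using C(1) \<kappa> \<kappa>' e Td cong fam h segs by blast
  moreover have "h ` ?t = (*\<^sub>R) (iota d p) ` fst T"
    unfolding Td decorated_def Let_def fst_conv formed_triangle_eq[OF pr] formed_triangle_eq[OF pr']
      isometry_convex_hull[OF direct_isometry_imp_isometry[OF h]] convex_hull_scaling[symmetric]
    by (simp add: hv)
  then have "dissects (prototiles d) (map_tile h ` C) ((*\<^sub>R) (iota d p) ` fst T)"
    using dissects_map[OF direct_isometry_imp_isometry[OF h] C(2)] by simp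
  ultimately show ?thesis by blast
qed

subsection \<open>The negative inflation rule\<close>

lemma elementary_rotate: "elementary d \<kappa> s a b c \<Longrightarrow> elementary d \<kappa> s b c a"
  unfolding elementary_def by (elim exE conjE) (rule exI, rule exI, rule exI, intro conjI, assumption+, auto simp: add_ac)

lemma elementary_swap: "elementary d \<kappa> s a b c \<Longrightarrow> elementary d \<kappa> s b a c"
  unfolding elementary_def
  by (elim exE conjE) (rule exI, rule exI, rule exI, intro conjI, assumption+, auto simp: add_ac cong_sym_eq)

lemma decorated_swap: "decorated d s a b c = decorated d s b a c"
  unfolding decorated_def Let_def formed_triangle_def by (simp add: Int_commute Un_ac)

section \<open>Decoration vertices and the sections of the edges\<close>

definition half_step :: "nat \<Rightarrow> sign \<Rightarrow> real" where
  "half_step d s = of_int (sign_val s) * pi / (2 * of_nat d)"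

lemma elementary_half_steps:
  assumes d: "1 < d" and e: "elementary d \<kappa> s a b c"
  obtains j where "a + b + c = 2 * half_step d s + of_int j * pi"
proof -
  obtain j where "a + b + c = of_int (sign_val s) * pi / of_nat d + of_int j * pi" using elementary_sum[OF d e] .
  then show thesis using that unfolding half_step_def by simp
qed

lemma sin_half_step:
  assumes "1 < d"
  shows "sin (half_step d s) \<noteq> 0"
proof -
  have "0 < sin (pi / (2 * of_nat d))" using assms by (intro sin_gt_zero) (simp_all add: divide_less_eq)
  then show ?thesis unfolding half_step_def using sign_cases[of s] by auto
qed

text \<open>The difference of two angles of the triangle is a lattice point where the sine does not
  vanish. Half a lattice step in either direction reaches no zero, so the sine has the same sign at
  both points.\<close>

lemma elementary_half_step_sin_pos:
  assumes d: "1 < d" and e: "elementary d \<kappa> s a b c"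
  shows "0 < sin (c - b - half_step d t) * sin (c - b + half_step d t)"
proof -
  have d0: "0 < d" using d by simp
  obtain m n where bc: "b = fam_angle d \<kappa> m" "c = fam_angle d \<kappa> n" and ne: "\<not> [n = m] (mod int d)"
    using e cong_sym unfolding elementary_def by blast
  define g where "g = pi / (2 * of_nat d)"
  have g: "0 < g" "g < pi / of_nat d" unfolding g_def using d by (simp_all add: field_simps)
  have "0 < sin (c - b) * sin (c - b - g)" "0 < sin (c - b) * sin (c - b + g)"
    using cell_sin_corner[OF d0 g ne, of \<kappa> Plus] cell_sin_corner[OF d0 g ne, of \<kappa> Minus]
    unfolding bc by (simp_all add: algebra_simps)
  then have *: "0 < sin (c - b - g) * sin (c - b + g)" by (auto simp: zero_less_mult_iff)
  have "half_step d t = g \<or> half_step d t = - g" unfolding half_step_def g_def using sign_cases[of t] by auto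
  then show ?thesis using * by (auto simp: mult.commute)
qed

text \<open>
  The lines \<open>a\<close>, \<open>b - half_step\<close>, \<open>c - half_step\<close> are concurrent, so the decoration vertex on the edge along \<open>a\<close> is the point
  where either of the two shifted lines crosses it.
\<close>

lemma decoration_vertex:
  assumes d: "1 < d" and e: "elementary d \<kappa> s a b c"
  defines "\<delta> \<equiv> half_step d s"
  shows "crossing (b - \<delta>) (c - \<delta>) = crossing a (b - \<delta>)" "crossing (b - \<delta>) (c - \<delta>) = crossing a (c - \<delta>)"
proof -
  obtain j where j: "a + b + c = 2 * \<delta> + of_int j * pi" using elementary_half_steps[OF d e] unfolding \<delta>_def .
  have 1: "(b - \<delta>) + (c - \<delta>) + (a + of_int (- j) * pi) = 0" "(c - \<delta>) + (a + of_int (- j) * pi) + (b - \<delta>) = 0"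
    using j by simp_all
  show "crossing (b - \<delta>) (c - \<delta>) = crossing a (c - \<delta>)" using crossing_third[OF 1(1)] crossing_add_int_pi crossing_commute by metis
  show "crossing (b - \<delta>) (c - \<delta>) = crossing a (b - \<delta>)" using crossing_third[OF 1(1)] crossing_third[OF 1(2)] crossing_add_int_pi crossing_commute by metis
qed

text \<open>The section at one end of the edge is governed by \<open>c - b - \<delta>\<close>, that
  at the other end by \<open>c - b + \<delta>\<close>. Negating \<delta>, that is changing the sign
  of the tile, exchanges the sections; this links the opposite sign to the hat.\<close>

lemma decoration_sections:
  assumes d: "1 < d" and e: "elementary d \<kappa> s a b c"
  defines "\<delta> \<equiv> half_step d s"
  shows "crossing (b - \<delta>) (c - \<delta>) \<in> closed_segment (crossing a b) (crossing c a)"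
    and "dist (crossing a b) (crossing (b - \<delta>) (c - \<delta>)) = 4 * \<bar>sin \<delta>\<bar> * \<bar>sin (c - b - \<delta>)\<bar>"
    and "dist (crossing c a) (crossing (b - \<delta>) (c - \<delta>)) = 4 * \<bar>sin \<delta>\<bar> * \<bar>sin (c - b + \<delta>)\<bar>"
proof -
  let ?D = "crossing (b - \<delta>) (c - \<delta>)"
  obtain j where j: "a + b + c = 2 * \<delta> + of_int j * pi" using elementary_half_steps[OF d e] unfolding \<delta>_def .
  let ?C = "cos (of_int j * pi)"
  have S: "sin (a + b + c - \<delta>) = ?C * sin \<delta>" using sin_add_int_pi[of \<delta> j] unfolding j by simp
  define w where "w = of_real (4 * (?C * sin \<delta>)) * cis a"
  define \<alpha> \<beta> where "\<alpha> = sin (c - b - \<delta>)" and "\<beta> = sin (c - b + \<delta>)"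
  have P: "crossing a b - ?D = of_real \<alpha> * w"
  proof -
    have 1: "a + b + (c - \<delta>) = a + b + c - \<delta>" "c - \<delta> - b = c - b - \<delta>" by simp_all
    show ?thesis unfolding decoration_vertex(2)[OF d e, folded \<delta>_def] crossing_diff 1 S w_def \<alpha>_def by simp
  qed
  have Q: "crossing c a - ?D = - (of_real \<beta> * w)"
  proof -
    have 1: "a + c + (b - \<delta>) = a + b + c - \<delta>" "b - \<delta> - c = - (c - b + \<delta>)" by simp_all
    show ?thesis unfolding decoration_vertex(1)[OF d e, folded \<delta>_def] crossing_commute[of c a] crossing_diff 1 S w_def \<beta>_def sin_minus by simp
  qed
  have pos: "0 < \<alpha> * \<beta>" using elementary_half_step_sin_pos[OF d e, of s] unfolding \<alpha>_def \<beta>_def \<delta>_def .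
  have nw: "cmod w = 4 * \<bar>sin \<delta>\<bar>"
  proof -
    have "\<bar>?C\<bar> = 1" using cos_int_pi_squared[of j] by (simp only: abs_square_eq_1)
    then show ?thesis unfolding w_def norm_mult norm_of_real abs_mult norm_cis by simp
  qed
  show "dist (crossing a b) ?D = 4 * \<bar>sin \<delta>\<bar> * \<bar>sin (c - b - \<delta>)\<bar>"
    unfolding dist_norm P norm_mult nw \<alpha>_def by simp
  show "dist (crossing c a) ?D = 4 * \<bar>sin \<delta>\<bar> * \<bar>sin (c - b + \<delta>)\<bar>"
    unfolding dist_norm Q norm_minus_cancel norm_mult nw \<beta>_def by simp
  \<comment> \<open>As \<alpha> and \<beta> have the same sign, the point divides the edge
    internally in the ratio \<alpha> : \<beta>.\<close>
  have ab: "\<alpha> + \<beta> \<noteq> 0" "0 \<le> \<alpha> / (\<alpha> + \<beta>)" "\<alpha> / (\<alpha> + \<beta>) \<le> 1"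
    using pos by (auto simp: zero_less_mult_iff divide_simps)
  have "?D = (1 - \<alpha> / (\<alpha> + \<beta>)) *\<^sub>R crossing a b + (\<alpha> / (\<alpha> + \<beta>)) *\<^sub>R crossing c a"
  proof -
    have "crossing a b = ?D + of_real \<alpha> * w" "crossing c a = ?D - of_real \<beta> * w" using P Q by (simp_all add: algebra_simps)
    then have "(1 - \<alpha> / (\<alpha> + \<beta>)) *\<^sub>R crossing a b + (\<alpha> / (\<alpha> + \<beta>)) *\<^sub>R crossing c a
      = (1 - \<alpha> / (\<alpha> + \<beta>)) *\<^sub>R (?D + of_real \<alpha> * w) + (\<alpha> / (\<alpha> + \<beta>)) *\<^sub>R (?D - of_real \<beta> * w)" by simp
    also have "\<dots> = ?D + of_real ((1 - \<alpha> / (\<alpha> + \<beta>)) * \<alpha> - (\<alpha> / (\<alpha> + \<beta>)) * \<beta>) * w"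
      by (simp add: scaleR_conv_of_real algebra_simps)
    also have "(1 - \<alpha> / (\<alpha> + \<beta>)) * \<alpha> - (\<alpha> / (\<alpha> + \<beta>)) * \<beta> = 0" using ab(1) by (simp add: field_simps)
    finally show ?thesis by simp
  qed
  then show "?D \<in> closed_segment (crossing a b) (crossing c a)" unfolding closed_segment_def using ab(2,3) by blast
qed

lemma decorated_eq:
  assumes d: "1 < d" and e: "elementary d \<kappa> s a b c"
  defines "\<delta> \<equiv> half_step d s"
  shows "decorated d s a b c = (convex hull {crossing a b, crossing b c, crossing c a},
    convex hull {crossing (a - \<delta>) (b - \<delta>), crossing (b - \<delta>) (c - \<delta>), crossing (c - \<delta>) (a - \<delta>)})"
proof -
  obtain j where j: "a + b + c = 2 * \<delta> + of_int j * pi" using elementary_half_steps[OF d e] unfolding \<delta>_def .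
  note p = elementary_imp_proper[OF d e]
  have "(a - \<delta>) + (b - \<delta>) + (c - \<delta>) = - \<delta> + of_int j * pi" using j by simp
  then have "sin ((a - \<delta>) + (b - \<delta>) + (c - \<delta>)) \<noteq> 0"
    using sin_half_step[OF d, of s] cos_int_pi_nonzero unfolding \<delta>_def by (simp only: sin_add_int_pi sin_minus) simp
  then have p': "proper (a - \<delta>) (b - \<delta>) (c - \<delta>)" using p unfolding proper_def by simp
  have dd: "of_int (sign_val s) * pi / (2 * of_nat d) = \<delta>" unfolding \<delta>_def half_step_def ..
  show ?thesis unfolding decorated_def Let_def dd formed_triangle_eq[OF p] formed_triangle_eq[OF p'] ..
qed

text \<open>The cross product of two sides contains the angle sum only through the square of its
  sine, so the differences of the angles decide the orientation, and exchanging two labels reverses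
  it.\<close>

lemma anticlockwise_crossing_iff:
  "anticlockwise (crossing a b) (crossing b c) (crossing c a) \<longleftrightarrow> sin (a + b + c) \<noteq> 0 \<and> 0 < sin (a - c) * sin (b - c) * sin (a - b)"
proof -
  let ?S = "sin (a + b + c)"
  have 1: "crossing b c - crossing a b = of_real (4 * ?S * sin (a - c)) * cis b"
    using crossing_diff[of b c a] by (simp add: crossing_commute add_ac)
  have 2: "crossing c a - crossing a b = of_real (4 * ?S * sin (b - c)) * cis a"
    using crossing_diff[of a c b] by (simp add: crossing_commute add_ac)
  have "Im (cnj (crossing b c - crossing a b) * (crossing c a - crossing a b)) = 16 * ?S ^ 2 * (sin (a - c) * sin (b - c) * sin (a - b))"
    unfolding 1 2 by (simp add: power2_eq_square sin_diff algebra_simps)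
  then show ?thesis unfolding anticlockwise_def by (simp add: zero_less_mult_iff)
qed

section \<open>Tiles of opposite sign and hats\<close>

primrec opposite :: "sign \<Rightarrow> sign" where
  "opposite Plus = Minus" | "opposite Minus = Plus"

lemma sign_val_opposite: "sign_val (opposite s) = - sign_val s"
  by (cases s) simp_all

lemma half_step_opposite: "half_step d (opposite s) = - half_step d s"
  by (simp add: half_step_def sign_val_opposite)

text \<open>For ratio 1 the shift negates the angle sum modulo pi, so the shifted indices satisfy
  the congruence for the opposite sign while the triangle keeps its size.\<close>

lemma opposite_tile:
  assumes d: "1 < d" and \<kappa>: "\<kappa> \<in> fam_index d" and e: "elementary d \<kappa> s a b c"
  obtains \<kappa>' \<theta> h where "\<kappa>' \<in> fam_index d" "elementary d \<kappa>' (opposite s) (a + \<theta>) (b + \<theta>) (c + \<theta>)"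
    "direct_isometry h" "h (crossing (a + \<theta>) (b + \<theta>)) = crossing a b" "h (crossing (b + \<theta>) (c + \<theta>)) = crossing b c"
    "h (crossing (c + \<theta>) (a + \<theta>)) = crossing c a"
proof -
  have d0: "0 < d" using d by simp
  have "0 < sin (pi / of_nat d)" using d by (intro sin_gt_zero) (simp_all add: divide_less_eq)
  then have p: "sin (of_nat 1 * pi / of_nat d) \<noteq> 0" by simp
  obtain \<kappa>' \<theta> l m n h k where \<kappa>': "\<kappa>' \<in> fam_index d"
    and th: "3 * \<theta> = - of_int (sign_val s) * (of_nat 1 + 1) * pi / of_nat d + of_int k * pi"
    and abc': "a + \<theta> = fam_angle d \<kappa>' l" "b + \<theta> = fam_angle d \<kappa>' m" "c + \<theta> = fam_angle d \<kappa>' n"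
    and pr': "proper (a + \<theta>) (b + \<theta>) (c + \<theta>)" and h: "direct_isometry h"
    and hv: "h (crossing (a + \<theta>) (b + \<theta>)) = iota d 1 *\<^sub>R crossing a b" "h (crossing (b + \<theta>) (c + \<theta>)) = iota d 1 *\<^sub>R crossing b c"
    "h (crossing (c + \<theta>) (a + \<theta>)) = iota d 1 *\<^sub>R crossing c a"
    by (rule shifted_triangle[OF d \<kappa> e p])
  obtain j where j: "a + b + c = of_int (sign_val s) * pi / of_nat d + of_int j * pi" using elementary_sum[OF d e] .
  have "of_int (l + m + n - \<kappa>') * pi / of_nat d = (a + b + c) + 3 * \<theta>"
    unfolding fam_angle_sum[OF d0, symmetric] abc'[symmetric] by simp
  also have "\<dots> = of_int (sign_val (opposite s) + int d * (j + k)) * pi / of_nat d"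
    unfolding j th sign_val_opposite using d0 by (simp add: field_simps)
  finally have "real_of_int (l + m + n - \<kappa>') = real_of_int (sign_val (opposite s) + int d * (j + k))"
    using d0 by (simp only: divide_cancel_right mult_cancel_right) simp
  then have "l + m + n - \<kappa>' = sign_val (opposite s) + int d * (j + k)" by (simp only: of_int_eq_iff)
  then have "l + m + n = \<kappa>' + sign_val (opposite s) + int d * (j + k)" by simp
  then have sum: "[l + m + n = \<kappa>' + sign_val (opposite s)] (mod int d)" by (simp add: cong_iff_dvd_diff)
  have ne: "\<not> [l = m] (mod int d)" "\<not> [m = n] (mod int d)" "\<not> [n = l] (mod int d)"
    using pr' sin_fam_diff_zero_iff[OF d0] unfolding proper_def abc' by blast+
  have "elementary d \<kappa>' (opposite s) (a + \<theta>) (b + \<theta>) (c + \<theta>)"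
    unfolding abc' by (rule elementaryI[OF d ne sum])
  then show thesis using that \<kappa>' h hv unfolding iota_one[OF d] scaleR_one by blast
qed

lemma isometry_closed_segment: "isometry f \<Longrightarrow> f ` closed_segment a b = closed_segment (f a) (f b)"
  by (simp add: segment_convex_hull isometry_convex_hull)

text \<open>The tile of opposite sign has the same triangle with the two sections of each edge
  exchanged. Reflecting it exchanges them once more in the anticlockwise reading, which gives the
  edges of the hat.\<close>

lemma hat_exists_anticlockwise:
  assumes d: "1 < d" and \<kappa>: "\<kappa> \<in> fam_index d" and e: "elementary d \<kappa> s a b c"
    and ac: "anticlockwise (crossing a b) (crossing b c) (crossing c a)"
  shows "\<exists>T'\<in>prototiles d. \<exists>h. direct_isometry h \<and> is_hat (decorated d s a b c) (mirror (map_tile h T'))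
    \<and> h ` fst T' = fst (decorated d s a b c)"
proof -
  obtain \<kappa>' \<theta> h where \<kappa>': "\<kappa>' \<in> fam_index d" and e': "elementary d \<kappa>' (opposite s) (a + \<theta>) (b + \<theta>) (c + \<theta>)"
    and h: "direct_isometry h" and hv: "h (crossing (a + \<theta>) (b + \<theta>)) = crossing a b" "h (crossing (b + \<theta>) (c + \<theta>)) = crossing b c"
    "h (crossing (c + \<theta>) (a + \<theta>)) = crossing c a"
    by (rule opposite_tile[OF d \<kappa> e])
  let ?T' = "decorated d (opposite s) (a + \<theta>) (b + \<theta>) (c + \<theta>)"
  define \<delta> where "\<delta> = half_step d s"
  define D where "D x y = crossing (x - \<delta>) (y - \<delta>)" for x y
  define D' where "D' x y = crossing (x + \<theta> - - \<delta>) (y + \<theta> - - \<delta>)" for x y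
  define g where "g = cnj \<circ> h"
  have hi: "isometry h" by (rule direct_isometry_imp_isometry[OF h])
  have gi: "isometry g" unfolding g_def by (rule isometry_compose[OF isometry_cnj hi])
  have gv: "g (crossing (a + \<theta>) (b + \<theta>)) = cnj (crossing a b)" "g (crossing (b + \<theta>) (c + \<theta>)) = cnj (crossing b c)"
    "g (crossing (c + \<theta>) (a + \<theta>)) = cnj (crossing c a)" unfolding g_def using hv by simp_all
  note opp = half_step_opposite[of d s, folded \<delta>_def]
  have T: "decorated d s a b c = (convex hull {crossing a b, crossing b c, crossing c a}, convex hull {D c a, D a b, D b c})"
    unfolding decorated_eq[OF d e] \<delta>_def[symmetric] D_def by (simp add: insert_commute)
  have T': "?T' = (convex hull {crossing (a + \<theta>) (b + \<theta>), crossing (b + \<theta>) (c + \<theta>), crossing (c + \<theta>) (a + \<theta>)}, convex hull {D' c a, D' a b, D' b c})"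
    unfolding decorated_eq[OF d e'] opp D'_def by (simp add: insert_commute)
  have H: "mirror (map_tile h ?T') = (convex hull {cnj (crossing a b), cnj (crossing b c), cnj (crossing c a)}, convex hull {g (D' c a), g (D' a b), g (D' b c)})"
  proof -
    have "mirror (map_tile h ?T') = map_tile g ?T'" unfolding mirror_def map_tile_compose g_def ..
    then show ?thesis unfolding T' map_tile_def fst_conv snd_conv isometry_convex_hull[OF gi] by (simp add: gv)
  qed
  have edge: "D y z \<in> closed_segment (crossing x y) (crossing z x) \<and> g (D' y z) \<in> closed_segment (g (crossing (x + \<theta>) (y + \<theta>))) (g (crossing (z + \<theta>) (x + \<theta>))) \<and>
      dist (g (crossing (x + \<theta>) (y + \<theta>))) (g (D' y z)) = dist (crossing z x) (D y z)"
    if xyz: "elementary d \<kappa> s x y z" "elementary d \<kappa>' (opposite s) (x + \<theta>) (y + \<theta>) (z + \<theta>)" for x y z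
  proof (intro conjI)
    show "D y z \<in> closed_segment (crossing x y) (crossing z x)"
      unfolding D_def \<delta>_def by (rule decoration_sections(1)[OF d xyz(1)])
    have "D' y z \<in> closed_segment (crossing (x + \<theta>) (y + \<theta>)) (crossing (z + \<theta>) (x + \<theta>))"
      using decoration_sections(1)[OF d xyz(2)] unfolding opp D'_def .
    then show "g (D' y z) \<in> closed_segment (g (crossing (x + \<theta>) (y + \<theta>))) (g (crossing (z + \<theta>) (x + \<theta>)))"
      unfolding isometry_closed_segment[OF gi, symmetric] by (rule imageI)
    have "dist (g (crossing (x + \<theta>) (y + \<theta>))) (g (D' y z)) = dist (crossing (x + \<theta>) (y + \<theta>)) (D' y z)"
      using gi unfolding isometry_def by simp
    also have "\<dots> = 4 * \<bar>sin \<delta>\<bar> * \<bar>sin (z - y + \<delta>)\<bar>"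
      unfolding D'_def using decoration_sections(2)[OF d xyz(2)] unfolding opp by simp
    also have "\<dots> = dist (crossing z x) (D y z)"
      unfolding D_def \<delta>_def by (rule decoration_sections(3)[OF d xyz(1), symmetric])
    finally show "dist (g (crossing (x + \<theta>) (y + \<theta>))) (g (D' y z)) = dist (crossing z x) (D y z)" .
  qed
  note eb = edge[OF elementary_rotate[OF e] elementary_rotate[OF e'], unfolded gv]
  note ec = edge[OF elementary_rotate[OF elementary_rotate[OF e]] elementary_rotate[OF elementary_rotate[OF e']], unfolded gv]
  note ea = edge[OF e e', unfolded gv]
  \<comment> \<open>The edge from \<open>crossing a b\<close> to \<open>crossing b c\<close> runs
    along line \<open>b\<close>, so its decoration vertex is \<open>D c a\<close>; the labels rotate
    accordingly on the other edges.\<close>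
  have "is_hat (decorated d s a b c) (mirror (map_tile h ?T'))"
    unfolding is_hat_def
    by (rule exI[of _ "crossing a b"], rule exI[of _ "crossing b c"], rule exI[of _ "crossing c a"],
        rule exI[of _ "D c a"], rule exI[of _ "D a b"], rule exI[of _ "D b c"],
        rule exI[of _ "g (D' c a)"], rule exI[of _ "g (D' a b)"], rule exI[of _ "g (D' b c)"])
      (intro conjI ac T H; use ea eb ec in \<open>simp add: closed_segment_commute\<close>)
  moreover have "?T' \<in> prototiles d" unfolding prototiles_def using \<kappa>' e' by blast
  moreover have "h ` fst ?T' = fst (decorated d s a b c)"
    unfolding T T' fst_conv isometry_convex_hull[OF hi] by (simp add: hv)
  ultimately show ?thesis using h by blast
qed

lemma hat_exists:
  assumes d: "1 < d" and T: "T \<in> prototiles d"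
  shows "\<exists>T'\<in>prototiles d. \<exists>h. direct_isometry h \<and> is_hat T (mirror (map_tile h T')) \<and> h ` fst T' = fst T"
proof -
  obtain s a b c \<kappa> where Td: "T = decorated d s a b c" and \<kappa>: "\<kappa> \<in> fam_index d" and e: "elementary d \<kappa> s a b c"
    using T unfolding prototiles_def by blast
  note p = elementary_imp_proper[OF d e]
  have n: "sin (c - a) = - sin (a - c)" "sin (b - a) = - sin (a - b)" by (simp_all flip: sin_minus)
  \<comment> \<open>Exchanging the labels \<open>a\<close> and \<open>b\<close> negates this
    product, so one of the two labellings is anticlockwise.\<close>
  have "sin (a - c) * sin (b - c) * sin (a - b) \<noteq> 0" using p n(1) unfolding proper_def by auto
  moreover have S: "sin (a + b + c) \<noteq> 0" using p unfolding proper_def by simp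
  moreover have "sin (b - c) * sin (a - c) * sin (b - a) = - (sin (a - c) * sin (b - c) * sin (a - b))"
    unfolding n by simp
  moreover have "sin (b + a + c) \<noteq> 0" using S by (simp only: add.commute[of b a] not_False_eq_True)
  ultimately consider "anticlockwise (crossing a b) (crossing b c) (crossing c a)" | "anticlockwise (crossing b a) (crossing a c) (crossing c b)"
    unfolding anticlockwise_crossing_iff by linarith
  then show ?thesis
  proof cases
    case 1
    show ?thesis unfolding Td by (rule hat_exists_anticlockwise[OF d \<kappa> e 1])
  next
    case 2
    show ?thesis unfolding Td decorated_swap[of d s a] by (rule hat_exists_anticlockwise[OF d \<kappa> elementary_swap[OF e] 2])
  qed
qed

lemma isosceles_direct_isometry:
  assumes "isosceles T"
  shows "\<exists>k. direct_isometry k \<and> k ` fst (mirror T) = fst T"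
proof -
  obtain a b c where nc: "\<not> collinear {a, b, c}" and T: "fst T = convex hull {a, b, c}" and ab: "dist a b = dist a c"
    using assms unfolding isosceles_def by blast
  have "b \<noteq> c"
  proof
    assume "b = c"
    then show False using nc by (simp add: insert_commute)
  qed
  \<comment> \<open>The factor \<open>u\<close> is determined by carrying the conjugated base to the
    reversed base, so that \<open>k\<close> after conjugation is the reflection in the axis of the
    triangle.\<close>
  define u where "u = (c - b) / cnj (b - c)"
  define k where "k z = u * z + (a - u * cnj a)" for z
  have "cmod (c - b) = cmod (b - c)" by (rule norm_minus_commute)
  then have "cmod u = 1" unfolding u_def norm_divide complex_mod_cnj using \<open>b \<noteq> c\<close> by simp
  then have k: "direct_isometry k" unfolding direct_isometry_def k_def by blast
  have nz: "cnj (b - c) \<noteq> 0" using \<open>b \<noteq> c\<close> by simp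
  have "cmod (b - a) = cmod (c - a)" using ab by (simp add: dist_norm norm_minus_commute)
  then have m: "(b - a) * cnj (b - a) = (c - a) * cnj (c - a)" unfolding complex_norm_square[symmetric] by simp
  have ub: "u * cnj (b - a) = c - a"
  proof -
    have "(c - b) * cnj (b - a) = (c - a) * cnj (b - c)"
      using m by (simp add: algebra_simps)
    then show ?thesis unfolding u_def using nz by (simp add: field_simps)
  qed
  have uc: "u * cnj (c - a) = b - a"
  proof -
    have "(c - b) * cnj (c - a) = (b - a) * cnj (b - c)"
      using m by (simp add: algebra_simps)
    then show ?thesis unfolding u_def using nz by (simp add: field_simps)
  qed
  have kv: "k (cnj a) = a" "k (cnj b) = c" "k (cnj c) = b"
    using ub uc unfolding k_def by (simp_all add: algebra_simps)
  have "k ` fst (mirror T) = fst T"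
    unfolding mirror_def fst_map_tile T isometry_convex_hull[OF isometry_cnj]
      isometry_convex_hull[OF direct_isometry_imp_isometry[OF k]]
    by (simp add: kv insert_commute)
  then show ?thesis using k by blast
qed

lemma Phi_minus_dissects:
  assumes d: "4 < d" and p: "p \<in> {2..d div 2}" and T: "T \<in> prototiles d"
  shows "\<exists>C \<subseteq> Phi_minus d p T. dissects (prototiles d) C ((*\<^sub>R) (iota d p) ` fst T)"
proof -
  have c: "0 < iota d p" using iota_ge(1)[OF d p] by simp
  \<comment> \<open>Both cases supply a copy of a prototile that serves as partner: the mirror image
    of \<open>T\<close> itself, moved back by \<open>k\<close>, or a tile of opposite sign already
    placed on the triangle of \<open>T\<close>, with \<open>k\<close> the identity.\<close>
  have *: ?thesis if W: "minus_partner T (map_tile f T')" and f: "isometry f" and T': "T' \<in> prototiles d"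
    and k: "direct_isometry k" and kW: "k ` fst (map_tile f T') = fst T" for f T' k
  proof -
    obtain C where "C \<subseteq> Phi_plus d p T'" "dissects (prototiles d) C ((*\<^sub>R) (iota d p) ` fst T')"
      using Phi_plus_dissects[OF d p T'] by blast
    then obtain C' where C': "C' \<subseteq> inflate_patch d p (Phi_plus d p) {map_tile f T'}"
      "dissects (prototiles d) C' ((*\<^sub>R) (iota d p) ` fst (map_tile f T'))"
      using inflate_patch_dissects[where R = "Phi_plus d p", OF c T' f] by blast
    let ?g = "inflated (iota d p) k"
    have "map_tile ?g ` C' \<subseteq> Phi_minus d p T"
      unfolding Phi_minus_def using W k kW C'(1) by blast
    moreover have "dissects (prototiles d) (map_tile ?g ` C') ((*\<^sub>R) (iota d p) ` fst T)"
      using dissects_map[OF isometry_inflated[OF c direct_isometry_imp_isometry[OF k]] C'(2)]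
      unfolding inflated_image[OF c] kW .
    ultimately show ?thesis by blast
  qed
  show ?thesis
  proof (cases "isosceles T")
    case True
    then obtain k where k: "direct_isometry k" "k ` fst (mirror T) = fst T" using isosceles_direct_isometry by blast
    show ?thesis
      by (rule *[of cnj T k]) (use True T k isometry_cnj in \<open>auto simp: minus_partner_def mirror_def\<close>)
  next
    case False
    have d1: "1 < d" using d by simp
    obtain T' h where T': "T' \<in> prototiles d" and h: "direct_isometry h" and hat: "is_hat T (mirror (map_tile h T'))"
      and hT: "h ` fst T' = fst T" using hat_exists[OF d1 T] by blast
    have "mirror (mirror X) = X" for X by (simp add: mirror_def map_tile_def image_image)
    then have "minus_partner T (map_tile h T')" unfolding minus_partner_def using False hat by metis
    moreover have "direct_isometry (\<lambda>z. z)" unfolding direct_isometry_def by (intro exI[of _ 1] exI[of _ 0]) simp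
    ultimately show ?thesis
      using *[of h T' "\<lambda>z. z"] direct_isometry_imp_isometry[OF h] T' hT by simp
  qed
qed

lemma Phi_rule_dissects:
  assumes "4 < d" "p \<in> {2..d div 2}" "T \<in> prototiles d"
  shows "\<exists>C \<subseteq> Phi_rule d p \<epsilon> T. dissects (prototiles d) C ((*\<^sub>R) (iota d p) ` fst T)"
  by (cases \<epsilon>) (simp_all add: Phi_plus_dissects[OF assms] Phi_minus_dissects[OF assms])

subsection \<open>Supertiles\<close>

lemma dissects_finite: "dissects F C R \<Longrightarrow> finite C"
  and dissects_congruent: "dissects F C R \<Longrightarrow> X \<in> C \<Longrightarrow> \<exists>T\<in>F. congruent_tile T X"
  and dissects_disjoint: "dissects F C R \<Longrightarrow> X \<in> C \<Longrightarrow> Y \<in> C \<Longrightarrow> X \<noteq> Y \<Longrightarrow> interior (fst X) \<inter> interior (fst Y) = {}"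
  and dissects_cover: "dissects F C R \<Longrightarrow> (\<Union>X\<in>C. fst X) = R"
  unfolding dissects_def by simp_all

lemma dissects_tileE:
  assumes "dissects F C R" "X \<in> C"
  obtains T f where "T \<in> F" "isometry f" "X = map_tile f T"
  using dissects_congruent[OF assms] unfolding congruent_tile_def by blast

lemma prototiles_nonempty:
  assumes "4 < d"
  shows "prototiles d \<noteq> {}"
proof -
  have "elementary d 0 Plus (fam_angle d 0 (-1)) (fam_angle d 0 0) (fam_angle d 0 2)"
  proof (rule elementaryI)
    have "\<not> int d dvd 1" "\<not> int d dvd 2" "\<not> int d dvd 3"
      using assms zdvd_imp_le[of "int d"] by fastforce+
    then show "\<not> [-1 = 0] (mod int d)" "\<not> [0 = 2] (mod int d)" "\<not> [2 = -1] (mod int d)"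
      by (auto simp: cong_iff_dvd_diff)
  qed (use assms in simp_all)
  moreover have "0 \<in> fam_index d" by (simp add: fam_index_def)
  ultimately show ?thesis unfolding prototiles_def by blast
qed

lemma prototile_triangle:
  assumes "1 < d" "T \<in> prototiles d"
  shows "interior (fst T) \<noteq> {}" "bounded (fst T)"
proof -
  obtain s a b c \<kappa> where T: "T = decorated d s a b c" and e: "elementary d \<kappa> s a b c"
    using assms(2) unfolding prototiles_def by blast
  note p = elementary_imp_proper[OF assms(1) e]
  have f: "fst T = formed_triangle a b c" unfolding T decorated_def Let_def by simp
  show "interior (fst T) \<noteq> {}" unfolding f by (rule formed_triangle_interior_nonempty[OF p])
  show "bounded (fst T)" unfolding f formed_triangle_eq[OF p]
    by (intro bounded_convex_hull finite_imp_bounded) simp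
qed

context
  fixes d p :: nat and \<epsilon> :: sign
  assumes d: "4 < d" and p: "p \<in> {2..d div 2}"
begin

private abbreviation (input) "\<rho> \<equiv> iota d p"
private abbreviation (input) "\<Phi> \<equiv> Phi d p \<epsilon>"
private abbreviation (input) "F \<equiv> prototiles d"

lemma iota_gt_one: "1 < \<rho>" "0 < \<rho>" "0 < \<rho> ^ n"
  using iota_ge(1)[OF d p] by simp_all

lemma Phi_power_mono: "P \<subseteq> Q \<Longrightarrow> (\<Phi> ^^ n) P \<subseteq> (\<Phi> ^^ n) Q"
  by (induction n) (simp_all add: Phi_def inflate_patch_mono)

lemma Phi_power_map:
  assumes g: "isometry g"
  shows "map_tile (inflated (\<rho> ^ n) g) ` (\<Phi> ^^ n) P \<subseteq> (\<Phi> ^^ n) (map_tile g ` P)"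
proof (induction n)
  case 0
  have "inflated 1 g = g" by (auto simp: inflated_def)
  then show ?case by simp
next
  case (Suc n)
  have "map_tile (inflated (\<rho> ^ Suc n) g) ` \<Phi> ((\<Phi> ^^ n) P)
      = map_tile (inflated \<rho> (inflated (\<rho> ^ n) g)) ` \<Phi> ((\<Phi> ^^ n) P)"
    unfolding inflated_mult[OF iota_gt_one(2,3)] by simp
  also have "\<dots> \<subseteq> \<Phi> (map_tile (inflated (\<rho> ^ n) g) ` (\<Phi> ^^ n) P)"
    unfolding Phi_def by (rule inflate_patch_map[OF iota_gt_one(2) isometry_inflated[OF iota_gt_one(3) g]])
  also have "\<dots> \<subseteq> \<Phi> ((\<Phi> ^^ n) (map_tile g ` P))"
    using Suc unfolding Phi_def by (rule inflate_patch_mono)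
  finally show ?case by simp
qed

text \<open>Tiles inside different \<open>Y\<close> stay apart because scaling is injective. The
  dissections \<open>D Y\<close> may be chosen freely for each tile; this freedom later keeps a
  given dissection inside a larger supertile.\<close>

lemma dissects_Union:
  assumes C: "C \<subseteq> (\<Phi> ^^ m) {X}" "dissects F C ((*\<^sub>R) (\<rho> ^ m) ` fst X)"
    and D: "\<And>Y. Y \<in> C \<Longrightarrow> D Y \<subseteq> (\<Phi> ^^ n) {Y} \<and> dissects F (D Y) ((*\<^sub>R) (\<rho> ^ n) ` fst Y)"
  shows "(\<Union>Y\<in>C. D Y) \<subseteq> (\<Phi> ^^ (n + m)) {X}" "dissects F (\<Union>Y\<in>C. D Y) ((*\<^sub>R) (\<rho> ^ (n + m)) ` fst X)"
proof -
  have "D Y \<subseteq> (\<Phi> ^^ n) ((\<Phi> ^^ m) {X})" if "Y \<in> C" for Y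
    using D[OF that] Phi_power_mono[of "{Y}" "(\<Phi> ^^ m) {X}" n] that C(1) by blast
  then show "(\<Union>Y\<in>C. D Y) \<subseteq> (\<Phi> ^^ (n + m)) {X}" unfolding funpow_add comp_def by blast
  have region: "(\<Union>Z\<in>(\<Union>Y\<in>C. D Y). fst Z) = (*\<^sub>R) (\<rho> ^ (n + m)) ` fst X"
  proof -
    have "(\<Union>Z\<in>D Y. fst Z) = (*\<^sub>R) (\<rho> ^ n) ` fst Y" if "Y \<in> C" for Y
      using dissects_cover[of F "D Y"] D[OF that] by blast
    then have "(\<Union>Z\<in>(\<Union>Y\<in>C. D Y). fst Z) = (\<Union>Y\<in>C. (*\<^sub>R) (\<rho> ^ n) ` fst Y)" by (simp add: UN_UN_flatten)
    also have "\<dots> = (*\<^sub>R) (\<rho> ^ n) ` (\<Union>Y\<in>C. fst Y)" by blast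
    also have "(\<Union>Y\<in>C. fst Y) = (*\<^sub>R) (\<rho> ^ m) ` fst X" by (rule dissects_cover[OF C(2)])
    finally show ?thesis by (simp add: image_image power_add)
  qed
  have fin: "finite (\<Union>Y\<in>C. D Y)"
    using dissects_finite[OF C(2)] dissects_finite[of F "D _"] D by blast
  have cong: "\<exists>T\<in>F. congruent_tile T Z" if "Z \<in> (\<Union>Y\<in>C. D Y)" for Z
    using D dissects_congruent that by blast
  have dis: "interior (fst Z) \<inter> interior (fst Z') = {}" if Z: "Z \<in> (\<Union>Y\<in>C. D Y)" "Z' \<in> (\<Union>Y\<in>C. D Y)" "Z \<noteq> Z'" for Z Z'
  proof -
    obtain Y where Y: "Y \<in> C" "Z \<in> D Y" using Z(1) by blast
    obtain Y' where Y': "Y' \<in> C" "Z' \<in> D Y'" using Z(2) by blast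
    show ?thesis
    proof (cases "Y = Y'")
      case True
      have "dissects F (D Y) ((*\<^sub>R) (\<rho> ^ n) ` fst Y)" using D[OF Y(1)] by blast
      from dissects_disjoint[OF this Y(2) _ Z(3)] show ?thesis using Y'(2) True by blast
    next
      case False
      have sub: "fst Z \<subseteq> (*\<^sub>R) (\<rho> ^ n) ` fst Y" if "Y \<in> C" "Z \<in> D Y" for Y Z
        using D[OF that(1)] that(2) dissects_cover[of F "D Y"] by blast
      have int: "interior ((*\<^sub>R) (\<rho> ^ n) ` S) = (*\<^sub>R) (\<rho> ^ n) ` interior S" for S :: "complex set"
        using iota_gt_one(2) by (intro interior_injective_linear_image) (auto simp: linear_scale_self inj_on_def)
      have "interior (fst Z) \<subseteq> (*\<^sub>R) (\<rho> ^ n) ` interior (fst Y)" "interior (fst Z') \<subseteq> (*\<^sub>R) (\<rho> ^ n) ` interior (fst Y')"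
        using interior_mono[OF sub[OF Y]] interior_mono[OF sub[OF Y']] unfolding int .
      moreover have "interior (fst Y) \<inter> interior (fst Y') = {}"
        by (rule dissects_disjoint[OF C(2) Y(1) Y'(1) False])
      moreover have "inj ((*\<^sub>R) (\<rho> ^ n) :: complex \<Rightarrow> complex)" using iota_gt_one(2) by (auto simp: inj_on_def)
      then have "(*\<^sub>R) (\<rho> ^ n) ` interior (fst Y) \<inter> (*\<^sub>R) (\<rho> ^ n) ` interior (fst Y') = {}"
        using \<open>interior (fst Y) \<inter> interior (fst Y') = {}\<close> by (simp flip: image_Int)
      ultimately show ?thesis by (meson disjoint_iff subset_iff)
    qed
  qed
  show "dissects F (\<Union>Y\<in>C. D Y) ((*\<^sub>R) (\<rho> ^ (n + m)) ` fst X)"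
    unfolding dissects_def by (intro conjI ballI impI fin cong region dis) assumption+
qed

lemma level_dissects:
  assumes "\<exists>T\<in>F. congruent_tile T X"
  shows "\<exists>C\<subseteq>(\<Phi> ^^ n) {X}. dissects F C ((*\<^sub>R) (\<rho> ^ n) ` fst X)"
  using assms
proof (induction n)
  case 0
  then have "dissects F {X} ((*\<^sub>R) (\<rho> ^ 0) ` fst X)" unfolding dissects_def by simp
  then show ?case by (intro exI[of _ "{X}"]) simp
next
  case (Suc n)
  then obtain C where C: "C \<subseteq> (\<Phi> ^^ n) {X}" "dissects F C ((*\<^sub>R) (\<rho> ^ n) ` fst X)" by blast
  have "\<exists>D. D \<subseteq> (\<Phi> ^^ 1) {Y} \<and> dissects F D ((*\<^sub>R) (\<rho> ^ 1) ` fst Y)" if Y: "Y \<in> C" for Y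
  proof -
    obtain T f where T: "T \<in> F" and f: "isometry f" "Y = map_tile f T"
      by (rule dissects_tileE[OF C(2) Y])
    obtain A where "A \<subseteq> Phi_rule d p \<epsilon> T" "dissects F A ((*\<^sub>R) \<rho> ` fst T)"
      using Phi_rule_dissects[OF d p T] by blast
    then show ?thesis
      using inflate_patch_dissects[where R = "Phi_rule d p \<epsilon>", OF iota_gt_one(2) T f(1)] unfolding f(2) by (simp add: Phi_def)
  qed
  then obtain D where D: "\<And>Y. Y \<in> C \<Longrightarrow> D Y \<subseteq> (\<Phi> ^^ 1) {Y} \<and> dissects F (D Y) ((*\<^sub>R) (\<rho> ^ 1) ` fst Y)" by metis
  show ?case using dissects_Union[OF C D] by auto
qed

lemma inner_tile_exists:
  "\<exists>k. \<forall>T\<in>F. \<exists>C\<subseteq>(\<Phi> ^^ k) {T}. dissects F C ((*\<^sub>R) (\<rho> ^ k) ` fst T) \<and>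
     (\<exists>Y\<in>C. \<forall>y\<in>fst Y. cball y 1 \<subseteq> (*\<^sub>R) (\<rho> ^ k) ` fst T)"
proof -
  have d1: "1 < d" and d0: "0 < d" using d by simp_all
  have "bounded (\<Union>T\<in>F. fst T)"
    using finite_prototiles[OF d0] prototile_triangle(2)[OF d1] by blast
  then obtain B where B: "\<And>x. x \<in> (\<Union>T\<in>F. fst T) \<Longrightarrow> norm x \<le> B" unfolding bounded_iff by blast
  have diam: "dist x y \<le> 2 * B" if T: "T \<in> F" "x \<in> fst T" "y \<in> fst T" for T x y
    using B[of x] B[of y] T norm_triangle_ineq4[of x y] unfolding dist_norm by force
  have "\<exists>r c. 0 < r \<and> ball c r \<subseteq> fst T" if T: "T \<in> F" for T
    using prototile_triangle(1)[OF d1 T] unfolding mem_interior ex_in_conv[symmetric] by blast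
  then obtain r c where rc: "\<And>T. T \<in> F \<Longrightarrow> 0 < r T \<and> ball (c T) (r T) \<subseteq> fst T" by metis
  define r0 where "r0 = Min (r ` F)"
  have F: "finite F" "F \<noteq> {}" using finite_prototiles[OF d0] prototiles_nonempty[OF d] by auto
  have r0: "0 < r0" "\<And>T. T \<in> F \<Longrightarrow> r0 \<le> r T" unfolding r0_def using F rc by auto
  \<comment> \<open>The tile over the scaled centre has diameter at most \<open>2 * B\<close>, and
    the scaled disc has radius at least \<open>\<rho> ^ k * r0\<close>; the additional 1 is the
    required margin. The bounds hold for all prototiles, so one \<open>k\<close> serves them
    all.\<close>
  obtain k where k: "(2 * B + 1) / r0 < \<rho> ^ k" using real_arch_pow[OF iota_gt_one(1)] by blast
  have kr: "2 * B + 1 < \<rho> ^ k * r0" using k r0(1) by (simp add: divide_less_eq)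
  have "\<exists>C\<subseteq>(\<Phi> ^^ k) {T}. dissects F C ((*\<^sub>R) (\<rho> ^ k) ` fst T) \<and>
     (\<exists>Y\<in>C. \<forall>y\<in>fst Y. cball y 1 \<subseteq> (*\<^sub>R) (\<rho> ^ k) ` fst T)" if T: "T \<in> F" for T
  proof -
    obtain C where C: "C \<subseteq> (\<Phi> ^^ k) {T}" "dissects F C ((*\<^sub>R) (\<rho> ^ k) ` fst T)"
      using level_dissects[of T k] T congruent_tile_refl by blast
    let ?c = "\<rho> ^ k *\<^sub>R c T"
    have "c T \<in> fst T" using rc[OF T] by auto
    then have "?c \<in> (\<Union>Y\<in>C. fst Y)" unfolding dissects_cover[OF C(2)] by blast
    then obtain Y where Y: "Y \<in> C" "?c \<in> fst Y" by blast
    obtain T' f where T': "T' \<in> F" and f: "isometry f" "Y = map_tile f T'"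
      by (rule dissects_tileE[OF C(2) Y(1)])
    have diamY: "dist x y \<le> 2 * B" if xy: "x \<in> fst Y" "y \<in> fst Y" for x y
    proof -
      obtain x' y' where "x' \<in> fst T'" "y' \<in> fst T'" "x = f x'" "y = f y'" using xy unfolding f(2) fst_map_tile by blast
      then show ?thesis using diam[OF T'] f(1) unfolding isometry_def by simp
    qed
    have "cball y 1 \<subseteq> (*\<^sub>R) (\<rho> ^ k) ` fst T" if y: "y \<in> fst Y" for y
    proof
      fix w assume w: "w \<in> cball y 1"
      have "dist ?c w \<le> dist ?c y + dist y w" by (rule dist_triangle)
      also have "\<dots> \<le> 2 * B + 1" using diamY[OF Y(2) y] w by simp
      finally have "dist ?c w < \<rho> ^ k * r0" using kr by simp
      moreover have "dist ?c w = \<rho> ^ k * dist (c T) (w /\<^sub>R \<rho> ^ k)"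
      proof -
        have "?c - w = \<rho> ^ k *\<^sub>R (c T - w /\<^sub>R \<rho> ^ k)" using iota_gt_one(2) by (simp add: scaleR_diff_right)
        then show ?thesis unfolding dist_norm using iota_gt_one(2) by simp
      qed
      ultimately have "dist (c T) (w /\<^sub>R \<rho> ^ k) < r0" using iota_gt_one(3)[of k] by simp
      then have "w /\<^sub>R \<rho> ^ k \<in> fst T" using rc[OF T] r0(2)[OF T] by auto
      moreover have "w = \<rho> ^ k *\<^sub>R (w /\<^sub>R \<rho> ^ k)" using iota_gt_one(2) by simp
      ultimately show "w \<in> (*\<^sub>R) (\<rho> ^ k) ` fst T" by blast
    qed
    then show ?thesis using C Y(1) by blast
  qed
  then show ?thesis by blast
qed

end

section \<open>Nested supertiles that exhaust the plane\<close>

lemma periodic_backward_orbit: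
  assumes "finite A" "A \<noteq> {}" "\<And>x. x \<in> A \<Longrightarrow> h x \<in> A"
  obtains t :: "nat \<Rightarrow> 'a" where "\<And>i. t i \<in> A" "\<And>i. h (t (Suc i)) = t i"
proof -
  obtain x0 where x0: "x0 \<in> A" using assms(2) by blast
  have in_A: "(h ^^ n) x \<in> A" if "x \<in> A" for n x using that by (induction n) (simp_all add: assms(3))
  have "\<not> inj (\<lambda>n. (h ^^ n) x0)"
    using assms(1) in_A[OF x0] finite_subset[of "range (\<lambda>n. (h ^^ n) x0)" A] range_inj_infinite by blast
  then obtain i j where "i \<noteq> j" "(h ^^ i) x0 = (h ^^ j) x0" unfolding inj_on_def by blast
  then obtain i j where ij: "i < j" "(h ^^ i) x0 = (h ^^ j) x0" by (metis linorder_neqE_nat)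
  define x m where "x = (h ^^ i) x0" and "m = j - i - 1"
  have x: "x \<in> A" unfolding x_def using in_A[OF x0] .
  have per: "(h ^^ Suc m) x = x"
  proof -
    have "Suc m + i = j" using ij(1) by (simp add: m_def)
    then have "(h ^^ Suc m) x = (h ^^ j) x0" unfolding x_def by (metis comp_apply funpow_add)
    then show ?thesis using ij(2) x_def by simp
  qed
  \<comment> \<open>At a point of period \<open>Suc m\<close>, one step back is \<open>m\<close>
    steps forward.\<close>
  show thesis
  proof (rule that[of "\<lambda>n. (h ^^ (m * n)) x"])
    show "(h ^^ (m * n)) x \<in> A" for n using in_A[OF x] .
    show "h ((h ^^ (m * Suc n)) x) = (h ^^ (m * n)) x" for n
    proof -
      have "h ((h ^^ (m * Suc n)) x) = (h ^^ Suc (m * Suc n)) x" by simp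
      also have "Suc (m * Suc n) = m * n + Suc m" by simp
      also have "(h ^^ (m * n + Suc m)) x = (h ^^ (m * n)) ((h ^^ Suc m) x)" unfolding funpow_add by simp
      finally show ?thesis unfolding per .
    qed
  qed
qed

lemma countable_nested_dissections_tile:
  assumes P: "\<And>n. dissects F (P n) (R n)" and mono: "\<And>n. P n \<subseteq> P (Suc n)"
    and base: "y0 \<in> R 0" and grow: "\<And>n y. y \<in> R n \<Longrightarrow> cball y 1 \<subseteq> R (Suc n)"
  shows "tiling_by F (\<Union>n. P n)"
proof -
  have inc: "P m \<subseteq> P n" if "m \<le> n" for m n using lift_Suc_mono_le[of P] mono that by blast
  have ball: "cball y0 (real n) \<subseteq> R n" for n
  proof (induction n)
    case 0
    then show ?case using base by simp
  next
    case (Suc n)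
    show ?case
    proof
      fix w assume w: "w \<in> cball y0 (real (Suc n))"
      \<comment> \<open>On the way from \<open>y0\<close> to \<open>w\<close>, this point is within
        distance \<open>n\<close> of \<open>y0\<close> and within distance 1 of
        \<open>w\<close>.\<close>
      define y where "y = y0 + (real n / real (Suc n)) *\<^sub>R (w - y0)"
      have nw: "norm (w - y0) \<le> real (Suc n)" using w by (simp add: dist_norm norm_minus_commute)
      have "norm (y - y0) = real n / real (Suc n) * norm (w - y0)" unfolding y_def by simp
      also have "\<dots> \<le> real n / real (Suc n) * real (Suc n)" by (intro mult_left_mono nw) simp
      also have "\<dots> = real n" by simp
      finally have "y \<in> R n" using Suc by (auto simp: dist_norm norm_minus_commute)
      have "w - y = (1 - real n / real (Suc n)) *\<^sub>R (w - y0)" unfolding y_def by (simp add: algebra_simps)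
      also have "1 - real n / real (Suc n) = 1 / real (Suc n)" by (simp add: field_simps)
      finally have "norm (w - y) = 1 / real (Suc n) * norm (w - y0)" by simp
      also have "\<dots> \<le> 1 / real (Suc n) * real (Suc n)" by (intro mult_left_mono nw) simp
      finally have "w \<in> cball y 1" by (simp add: dist_norm norm_minus_commute)
      then show "w \<in> R (Suc n)" using grow[OF \<open>y \<in> R n\<close>] by blast
    qed
  qed
  have cover: "(\<Union>X\<in>(\<Union>n. P n). fst X) = UNIV"
  proof -
    have "w \<in> (\<Union>X\<in>(\<Union>n. P n). fst X)" for w
    proof -
      obtain n where "dist y0 w < real n" using reals_Archimedean2 by blast
      then have "w \<in> R n" using ball[of n] by auto
      then show ?thesis using dissects_cover[OF P[of n]] by blast
    qed
    then show ?thesis by blast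
  qed
  have dis: "interior (fst X) \<inter> interior (fst Y) = {}" if XY: "X \<in> (\<Union>n. P n)" "Y \<in> (\<Union>n. P n)" "X \<noteq> Y" for X Y
  proof -
    obtain m n where "X \<in> P m" "Y \<in> P n" using XY by blast
    then have "X \<in> P (max m n)" "Y \<in> P (max m n)" using inc[of m "max m n"] inc[of n "max m n"] by auto
    then show ?thesis by (rule dissects_disjoint[OF P _ _ XY(3)])
  qed
  have count: "countable (\<Union>n. P n)"
    using dissects_finite[OF P] by (intro countable_UN) (auto intro: countable_finite)
  have cong: "\<exists>T\<in>F. congruent_tile T X" if "X \<in> (\<Union>n. P n)" for X
    using dissects_congruent[OF P] that by blast
  show ?thesis unfolding tiling_by_def by (intro conjI ballI impI count cong dis cover) assumption+
qed

lemma is_patch_map: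
  assumes f: "isometry f" and Q: "is_patch Q"
  shows "is_patch (map_tile f ` Q)"
  unfolding is_patch_def
proof (intro ballI impI)
  have inj: "inj f" using isometry_bij[OF f] by (rule bij_is_inj)
  have fr: "f ` frontier S \<subseteq> frontier (f ` S)" for S
  proof -
    have "f ` closure S \<subseteq> closure (f ` S)"
    proof (rule closure_subset[THEN image_closure_subset[rotated 2]])
      show "continuous_on (closure S) f"
        using f unfolding continuous_on_iff isometry_def by auto
    qed simp
    then show ?thesis unfolding frontier_def isometry_interior[OF f] image_set_diff[OF inj] by blast
  qed
  fix X' Y' assume "X' \<in> map_tile f ` Q" "Y' \<in> map_tile f ` Q" "X' \<noteq> Y'"
  then obtain X Y where XY: "X \<in> Q" "Y \<in> Q" "X' = map_tile f X" "Y' = map_tile f Y" "X \<noteq> Y" by blast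
  have "fst X' \<inter> fst Y' = f ` (fst X \<inter> fst Y)" unfolding XY fst_map_tile by (rule image_Int[OF inj, symmetric])
  also have "\<dots> \<subseteq> f ` (frontier (fst X) \<inter> frontier (fst Y))" using Q XY unfolding is_patch_def by blast
  also have "\<dots> \<subseteq> frontier (fst X') \<inter> frontier (fst Y')" unfolding XY fst_map_tile using fr by blast
  finally show "fst X' \<inter> fst Y' \<subseteq> frontier (fst X') \<inter> frontier (fst Y')" .
qed

text \<open>A supertile over \<open>S\<close> placed by \<open>g\<close> becomes the inner part of a
  supertile over \<open>T\<close> whose level is larger by \<open>k\<close>. The given dissection
  \<open>P\<close> is kept unchanged, so that the stages are nested as sets of tiles.\<close>

lemma supertile_extends:
  fixes d p :: nat and \<epsilon> :: sign
  defines "\<rho> \<equiv> iota d p" and "\<Phi> \<equiv> Phi d p \<epsilon>" and "F \<equiv> prototiles d"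
  assumes d: "4 < d" and p: "p \<in> {2..d div 2}"
    and f: "isometry f" and C: "C \<subseteq> (\<Phi> ^^ k) {T}" "dissects F C ((*\<^sub>R) (\<rho> ^ k) ` fst T)"
    and S: "map_tile f S \<in> C" and inner: "\<And>y. y \<in> fst (map_tile f S) \<Longrightarrow> cball y 1 \<subseteq> (*\<^sub>R) (\<rho> ^ k) ` fst T"
    and g: "isometry g" and P: "P \<subseteq> (\<Phi> ^^ n) {map_tile g S}" "dissects F P ((*\<^sub>R) (\<rho> ^ n) ` fst (map_tile g S))"
  shows "\<exists>g' P'. isometry g' \<and> P' \<subseteq> (\<Phi> ^^ (n + k)) {map_tile g' T} \<and>
    dissects F P' ((*\<^sub>R) (\<rho> ^ (n + k)) ` fst (map_tile g' T)) \<and> P \<subseteq> P' \<and>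
    (\<forall>y \<in> (*\<^sub>R) (\<rho> ^ n) ` fst (map_tile g S). cball y 1 \<subseteq> (*\<^sub>R) (\<rho> ^ (n + k)) ` fst (map_tile g' T))"
proof -
  note iota_gt_one = iota_gt_one[OF d p, folded \<rho>_def]
  define c where "c = \<rho> ^ k"
  have c: "0 < c" unfolding c_def by (rule iota_gt_one(3))
  define G where "G = g \<circ> inv f"
  have G: "isometry G" unfolding G_def by (rule isometry_compose[OF g isometry_inv[OF f]])
  \<comment> \<open>Inflating by \<open>c\<close> cancels the factor \<open>1 / c\<close>, so the
    copy of \<open>C\<close> moved by \<open>G\<close> comes from the single tile
    \<open>map_tile g' T\<close>.\<close>
  define g' where "g' = inflated (1 / c) G"
  have g': "isometry g'" unfolding g'_def using isometry_inflated[OF _ G, of "1 / c"] c by simp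
  have cg': "inflated c g' = G" unfolding g'_def using c by (auto simp: inflated_def)
  have GS: "map_tile G (map_tile f S) = map_tile g S"
    unfolding G_def map_tile_compose comp_assoc inv_o_cancel[OF bij_is_inj[OF isometry_bij[OF f]]] by simp
  let ?C = "map_tile G ` C"
  have "?C \<subseteq> map_tile (inflated (\<rho> ^ k) g') ` (\<Phi> ^^ k) {T}" using C(1) cg' unfolding c_def by blast
  also have "\<dots> \<subseteq> (\<Phi> ^^ k) (map_tile g' ` {T})" unfolding \<rho>_def \<Phi>_def by (rule Phi_power_map[OF d p g'])
  finally have C1: "?C \<subseteq> (\<Phi> ^^ k) {map_tile g' T}" by simp
  have Gc: "G ` ((*\<^sub>R) c ` fst T) = (*\<^sub>R) c ` fst (map_tile g' T)"
    unfolding cg'[symmetric] inflated_image[OF c] fst_map_tile ..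
  have C2: "dissects F ?C ((*\<^sub>R) (\<rho> ^ k) ` fst (map_tile g' T))"
    using dissects_map[OF G C(2)] unfolding c_def[symmetric] Gc .
  \<comment> \<open>The distinguished tile keeps its dissection \<open>P\<close>; every other tile
    receives any dissection of the same level.\<close>
  have "\<exists>D. D \<subseteq> (\<Phi> ^^ n) {Y} \<and> dissects F D ((*\<^sub>R) (\<rho> ^ n) ` fst Y) \<and> (Y = map_tile g S \<longrightarrow> D = P)" if Y: "Y \<in> ?C" for Y
  proof (cases "Y = map_tile g S")
    case True
    then show ?thesis using P by blast
  next
    case False
    have "\<exists>T\<in>F. congruent_tile T Y" by (rule dissects_congruent[OF C2 Y])
    then show ?thesis using level_dissects[OF d p, of Y n \<epsilon>] False unfolding \<rho>_def \<Phi>_def F_def by blast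
  qed
  then obtain D where D: "\<And>Y. Y \<in> ?C \<Longrightarrow> D Y \<subseteq> (\<Phi> ^^ n) {Y} \<and> dissects F (D Y) ((*\<^sub>R) (\<rho> ^ n) ` fst Y) \<and> (Y = map_tile g S \<longrightarrow> D Y = P)"
    by metis
  let ?P = "\<Union>Y\<in>?C. D Y"
  have PS: "P \<subseteq> ?P" using D S GS by (metis SUP_upper imageI)
  have P1: "?P \<subseteq> (\<Phi> ^^ (n + k)) {map_tile g' T}" "dissects F ?P ((*\<^sub>R) (\<rho> ^ (n + k)) ` fst (map_tile g' T))"
    using dissects_Union[OF d p C1[unfolded \<Phi>_def] C2[unfolded F_def \<rho>_def], of D n] D
    unfolding \<rho>_def \<Phi>_def F_def by blast+
  have "cball y 1 \<subseteq> (*\<^sub>R) (\<rho> ^ (n + k)) ` fst (map_tile g' T)" if y: "y \<in> (*\<^sub>R) (\<rho> ^ n) ` fst (map_tile g S)" for y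
  proof
    fix w assume w: "w \<in> cball y 1"
    obtain y0 where y0: "y = \<rho> ^ n *\<^sub>R y0" "y0 \<in> fst (map_tile g S)" using y by blast
    obtain y1 where y1: "y0 = G y1" "y1 \<in> fst (map_tile f S)" using y0(2) unfolding GS[symmetric] fst_map_tile[of G] by blast
    define w0 where "w0 = w /\<^sub>R \<rho> ^ n"
    have w0: "w = \<rho> ^ n *\<^sub>R w0" unfolding w0_def using iota_gt_one(2) by simp
    \<comment> \<open>As \<open>\<rho> ^ n\<close> is at least 1, the margin 1 before scaling grants
      the margin 1 after it.\<close>
    have "1 \<le> \<rho> ^ n" using iota_gt_one(1) by simp
    moreover have "\<rho> ^ n * dist y0 w0 \<le> 1"
      using w iota_gt_one(3)[of n] unfolding w0 y0(1) by (simp add: dist_norm flip: scaleR_diff_right)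
    ultimately have "dist y0 w0 \<le> 1" using mult_right_mono[of 1 "\<rho> ^ n" "dist y0 w0"] by simp
    moreover obtain w1 where w1: "w0 = G w1" using bij_is_surj[OF isometry_bij[OF G]] by (metis surj_def)
    ultimately have "w1 \<in> cball y1 1" using G unfolding y1(1) isometry_def by simp
    then have "w1 \<in> (*\<^sub>R) c ` fst T" using inner[OF y1(2)] unfolding c_def by blast
    then have "w0 \<in> (*\<^sub>R) c ` fst (map_tile g' T)" unfolding Gc[symmetric] w1 by blast
    then show "w \<in> (*\<^sub>R) (\<rho> ^ (n + k)) ` fst (map_tile g' T)"
      unfolding w0 c_def power_add by (auto simp: image_iff)
  qed
  then show ?thesis using g' P1 PS by blast
qed

theorem theorem3p7:
  fixes d p :: nat and \<epsilon> :: sign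
  assumes "d > 4" and "p \<in> {2..d div 2}"
  shows "tilings_S d p \<epsilon> \<noteq> {} \<and>
    (\<forall>P\<in>tilings_S d p \<epsilon>. tiling_by (prototiles d) P)"
proof
  show "\<forall>P\<in>tilings_S d p \<epsilon>. tiling_by (prototiles d) P" unfolding tilings_S_def by blast
next
  define \<rho> \<Phi> F where "\<rho> = iota d p" and "\<Phi> = Phi d p \<epsilon>" and "F = prototiles d"
  have fin: "finite F" "F \<noteq> {}" unfolding F_def using assms(1) finite_prototiles prototiles_nonempty by simp_all
  obtain k where k: "\<And>T. T \<in> F \<Longrightarrow> \<exists>C\<subseteq>(\<Phi> ^^ k) {T}. dissects F C ((*\<^sub>R) (\<rho> ^ k) ` fst T) \<and>
     (\<exists>Y\<in>C. \<forall>y\<in>fst Y. cball y 1 \<subseteq> (*\<^sub>R) (\<rho> ^ k) ` fst T)"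
    using inner_tile_exists[OF assms, of \<epsilon>] unfolding \<rho>_def \<Phi>_def F_def by blast
  have "\<exists>C S f. S \<in> F \<and> isometry f \<and> C \<subseteq> (\<Phi> ^^ k) {T} \<and> dissects F C ((*\<^sub>R) (\<rho> ^ k) ` fst T) \<and>
     map_tile f S \<in> C \<and> (\<forall>y\<in>fst (map_tile f S). cball y 1 \<subseteq> (*\<^sub>R) (\<rho> ^ k) ` fst T)" if T: "T \<in> F" for T
  proof -
    obtain C Y where C: "C \<subseteq> (\<Phi> ^^ k) {T}" "dissects F C ((*\<^sub>R) (\<rho> ^ k) ` fst T)"
      and Y: "Y \<in> C" "\<forall>y\<in>fst Y. cball y 1 \<subseteq> (*\<^sub>R) (\<rho> ^ k) ` fst T" using k[OF T] by blast
    obtain S f where "S \<in> F" "isometry f" "Y = map_tile f S"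
      by (rule dissects_tileE[OF C(2) Y(1)])
    then show ?thesis using C Y by blast
  qed
  then obtain C S f where CSf: "\<And>T. T \<in> F \<Longrightarrow> S T \<in> F \<and> isometry (f T) \<and> C T \<subseteq> (\<Phi> ^^ k) {T} \<and>
     dissects F (C T) ((*\<^sub>R) (\<rho> ^ k) ` fst T) \<and> map_tile (f T) (S T) \<in> C T \<and>
     (\<forall>y\<in>fst (map_tile (f T) (S T)). cball y 1 \<subseteq> (*\<^sub>R) (\<rho> ^ k) ` fst T)" by metis
  \<comment> \<open>\<open>S\<close> sends a prototile to that of its inner tile, so
    \<open>t n\<close> is the inner prototile of \<open>t (Suc n)\<close> for every
    \<open>n\<close>.\<close>
  obtain t where t: "\<And>i::nat. t i \<in> F" "\<And>i. S (t (Suc i)) = t i"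
    by (rule periodic_backward_orbit[OF fin, of S]) (use CSf in blast)+
  \<comment> \<open>Stage \<open>n\<close> is a supertile over \<open>t n\<close> of level
    \<open>n * k\<close>. Its placement varies with the stage because the earlier stages stay fixed
    in the plane.\<close>
  define R where "R n g = (*\<^sub>R) (\<rho> ^ (n * k)) ` fst (map_tile g (t n))" for n g
  define ok where "ok n gP \<longleftrightarrow> isometry (fst gP) \<and> snd gP \<subseteq> (\<Phi> ^^ (n * k)) {map_tile (fst gP) (t n)} \<and>
    dissects F (snd gP) (R n (fst gP))" for n and gP :: "(complex \<Rightarrow> complex) \<times> tile set"
  define ext where "ext n gP gP' \<longleftrightarrow> snd gP \<subseteq> snd gP' \<and> (\<forall>y\<in>R n (fst gP). cball y 1 \<subseteq> R (Suc n) (fst gP'))"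
    for n and gP gP' :: "(complex \<Rightarrow> complex) \<times> tile set"
  have "\<exists>gP. ok 0 gP"
  proof -
    have "dissects F {t 0} (fst (t 0))" using t(1)[of 0] congruent_tile_refl[of "t 0"] unfolding dissects_def by auto
    then show ?thesis unfolding ok_def R_def by (intro exI[of _ "(\<lambda>z. z, {t 0})"]) (simp add: isometry_id)
  qed
  moreover have "\<exists>gP'. ok (Suc n) gP' \<and> ext n gP gP'" if gP: "ok n gP" for gP n
  proof -
    note T = CSf[OF t(1)[of "Suc n"], unfolded t(2)]
    have "\<exists>g' P'. isometry g' \<and> P' \<subseteq> (\<Phi> ^^ (n * k + k)) {map_tile g' (t (Suc n))} \<and>
      dissects F P' ((*\<^sub>R) (\<rho> ^ (n * k + k)) ` fst (map_tile g' (t (Suc n)))) \<and> snd gP \<subseteq> P' \<and>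
      (\<forall>y \<in> (*\<^sub>R) (\<rho> ^ (n * k)) ` fst (map_tile (fst gP) (t n)). cball y 1 \<subseteq> (*\<^sub>R) (\<rho> ^ (n * k + k)) ` fst (map_tile g' (t (Suc n))))"
      unfolding \<rho>_def \<Phi>_def F_def
      by (rule supertile_extends[OF assms, of "f (t (Suc n))" "C (t (Suc n))"])
        (use T gP in \<open>auto simp: ok_def R_def \<rho>_def \<Phi>_def F_def\<close>)
    then show ?thesis unfolding ok_def ext_def R_def by (simp add: add.commute)
  qed
  ultimately obtain gP where gP: "\<And>n. ok n (gP n)" "\<And>n. ext n (gP n) (gP (Suc n))"
    using dependent_nat_choice[of ok ext] by blast
  define P where "P n = snd (gP n)" for n
  obtain y0 where "y0 \<in> fst (t 0)" using prototile_triangle(1)[of d "t 0"] t(1)[of 0] interior_subset assms(1) unfolding F_def by fastforce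
  then have "fst (gP 0) y0 \<in> R 0 (fst (gP 0))" unfolding R_def by simp
  then have "tiling_by F (\<Union>n. P n)"
    using gP unfolding ok_def ext_def P_def
    by (intro countable_nested_dissections_tile[where R = "\<lambda>n. R n (fst (gP n))"]) blast+
  moreover have "\<exists>T\<in>F. \<exists>m. \<exists>Q'. Q' \<subseteq> (\<Phi> ^^ m) {T} \<and> is_patch Q' \<and> congruent_patch Q Q'"
    if Q: "Q \<subseteq> (\<Union>n. P n)" "finite Q" "is_patch Q" for Q
  proof -
    have inc: "P m \<subseteq> P n" if "m \<le> n" for m n
      using lift_Suc_mono_le[of P] gP(2) that unfolding ext_def P_def by blast
    obtain n where n: "Q \<subseteq> P n"
    proof -
      have "\<exists>n. Q \<subseteq> P n" using Q(2,1)
      proof (induction Q)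
        case (insert X Q)
        then obtain m n where "Q \<subseteq> P m" "X \<in> P n" by blast
        then have "insert X Q \<subseteq> P (max m n)" using inc[of m "max m n"] inc[of n "max m n"] by auto
        then show ?case by blast
      qed simp
      then show thesis using that by blast
    qed
    let ?g = "fst (gP n)"
    have g: "isometry ?g" and Pn: "P n \<subseteq> (\<Phi> ^^ (n * k)) {map_tile ?g (t n)}" using gP(1)[of n] unfolding ok_def P_def by simp_all
    \<comment> \<open>The placement \<open>?g\<close> acts before inflation; its inverse, inflated
      to level \<open>n * k\<close>, brings the patch into the iterated rule on the prototile
      \<open>t n\<close> itself.\<close>
    let ?h = "inflated (\<rho> ^ (n * k)) (inv ?g)"
    have h: "isometry ?h" unfolding \<rho>_def by (rule isometry_inflated[OF iota_gt_one(3)[OF assms] isometry_inv[OF g]])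
    have "map_tile ?h ` Q \<subseteq> map_tile ?h ` (\<Phi> ^^ (n * k)) {map_tile ?g (t n)}" using n Pn by blast
    also have "\<dots> \<subseteq> (\<Phi> ^^ (n * k)) (map_tile (inv ?g) ` {map_tile ?g (t n)})"
      unfolding \<rho>_def \<Phi>_def by (rule Phi_power_map[OF assms isometry_inv[OF g]])
    also have "map_tile (inv ?g) ` {map_tile ?g (t n)} = {t n}" using map_tile_inv(1)[OF isometry_bij[OF g]] by simp
    finally have "map_tile ?h ` Q \<subseteq> (\<Phi> ^^ (n * k)) {t n}" .
    moreover have "congruent_patch Q (map_tile ?h ` Q)" unfolding congruent_patch_def using h by blast
    ultimately show ?thesis using is_patch_map[OF h Q(3)] t(1) by blast
  qed
  ultimately have "(\<Union>n. P n) \<in> tilings_S d p \<epsilon>" unfolding tilings_S_def F_def \<Phi>_def by blast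
  then show "tilings_S d p \<epsilon> \<noteq> {}" by blast
qed

end
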